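(* Let $0<p\le1$ and let $W\ge0$ be a locally integrable function on $\mathbb D$. For every arc $I\subseteq\mathbb T$ define $$h_W(I):=\frac{1}{|I|^{p+2}}\int_{Q_I^{\mathrm{up}}}W(z)\,dA(z).$$ Then the following are equivalent. (i) There exists a constant $C$ such that $$\int_{\mathbb D}|F'(z)|^2W(z)\,dA(z)\le C\|F\|_{\mathcal Q_p,*}^2\qquad\text{for all }F\in\mathcal Q_p.$$ (ii) There exists a dyadic system $\mathcal D$ on $\mathbb T$ such that $\|h_W\|_{\mathcal B_p(\mathcal D)}<\infty$, where for each fixed $\mathcal D$ the sequence is understood as $\{h_W(I)\}_{I\in\mathcal D}$. Moreover, if $C_{\mathrm{best}}$ denotes the best (smallest) constant in (i), then $$C_{\mathrm{best}}\simeq\inf_{\mathcal D}\|h_W\|_{\mathcal B_p(\mathcal D)}\simeq\sup_{\mathcal D}\|h_W\|_{\mathcal B_p(\mathcal D)},$$ where the infimum and supremum are taken over all dyadic systems $\mathcal D$ on $\mathbb T$.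
   Context: $\mathbb D$ is the open unit disc, $\mathbb T$ the unit circle, $dA$ is normalized area measure on $\mathbb D$, and $H(\mathbb D)$ is the space of holomorphic functions on $\mathbb D$. For $a\in\mathbb D$, $\sigma_a(z)=\frac{a-z}{1-\overline a z}$ and $g(z,a)=\log\frac{1}{|\sigma_a(z)|}$. $\mathcal Q_p$ is the space of $f\in H(\mathbb D)$ with $\|f\|_{\mathcal Q_p,*}^2:=\sup_{a\in\mathbb D}\int_{\mathbb D}|f'(z)|^2g(z,a)^p\,dA(z)<\infty$. $|I|$ denotes arc length normalized so that $|\mathbb T|=1$; arcs include $\mathbb T$ itself. For an arc $I$, $Q_I^{\mathrm{up}}:=\{re^{it}: e^{it}\in I,\ 1-|I|\le r<1-\frac{|I|}{2}\}$. A dyadic system on $\mathbb T$ is a family $\mathcal D=\bigcup_{k\ge0}\mathcal D_k$ of half-open arcs where $\mathcal D_0=\{\mathbb T\}$, each $\mathcal D_k$ is a partition of $\mathbb T$ into $2^k$ arcs of length $2^{-k}$, and each arc of $\mathcal D_{k+1}$ is contained in an arc of $\mathcal D_k$. For a nonnegative sequence $h=\{h(I)\}_{I\in\mathcal D}$, the dyadic $p$-capacity gauge is $$\|h\|_{\mathcal B_p(\mathcal D)}:=\inf\Big\{\sum_{J\in\mathcal D}\lambda_J|J|^p:\ \lambda_J\ge0,\ \sum_{J\in\mathcal D,\,J\supseteq I}\lambda_J\ge h(I)\ \text{for all }I\in\mathcal D\Big\}\in[0,\infty],$$ with $\inf\emptyset=+\infty$. $A\simeq B$ means $C^{-1}B\le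 A\le CB$ with a constant $C\ge 1$ depending only on $p$ (in particular independent of $W$). $C_{\mathrm{best}}=+\infty$ if no constant exists in (i). *)

theory Defs
  imports "HOL-Complex_Analysis.Complex_Analysis" "HOL-Library.Disjoint_Sets"
begin

abbreviation unit_disc :: "complex set"
  where "unit_disc \<equiv> ball 0 1"

abbreviation unit_circle :: "complex set"
  where "unit_circle \<equiv> sphere 0 1"

definition dA :: "complex measure"
  where "dA = uniform_measure lebesgue unit_disc"

definition locally_integrable_disc :: "(complex \<Rightarrow> real) \<Rightarrow> bool"
  where "locally_integrable_disc W \<longleftrightarrow>
    (\<forall>K. compact K \<and> K \<subseteq> unit_disc \<longrightarrow> set_integrable dA K W)"

definition \<sigma> :: "complex \<Rightarrow> complex \<Rightarrow> complex"
  where "\<sigma> a z = (a - z) / (1 - cnj a * z)"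

text \<open>On the diagonal \<open>z = a\<close>, where the Green function is infinite, this
  evaluates to the conventional value \<open>ln (1 / 0) = 0\<close>; only integrals in \<open>z\<close> are used,
  so this null set plays no role.\<close>
definition green :: "complex \<Rightarrow> complex \<Rightarrow> real"
  where "green z a = ln (1 / norm (\<sigma> a z))"

text \<open>The square of the seminorm, with values in \<open>[0, \<infinity>]\<close>.\<close>
definition Q_seminorm_sq :: "real \<Rightarrow> (complex \<Rightarrow> complex) \<Rightarrow> ennreal"
  where "Q_seminorm_sq p f =
    (SUP a\<in>unit_disc. \<integral>\<^sup>+z\<in>unit_disc. ennreal ((norm (deriv f z))\<^sup>2 * green z a powr p) \<partial>dA)"

definition Q_space :: "real \<Rightarrow> (complex \<Rightarrow> complex) set"
  where "Q_space p = {f. f holomorphic_on unit_disc \<and> Q_seminorm_sq p f < \<infinity>}"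

text \<open>Normalized arc length on the unit circle: the pullback of Lebesgue measure under
  \<open>t \<mapsto> exp (2 \<pi> i t)\<close>.\<close>
definition arc_length :: "complex set \<Rightarrow> real"
  where "arc_length I = measure lebesgue {t\<in>{0..<1}. cis (2 * pi * t) \<in> I}"

text \<open>Either end point may be the included one; the full circle is the case \<open>b = a + 2 * pi\<close>.\<close>
definition half_open_arc :: "complex set \<Rightarrow> bool"
  where "half_open_arc I \<longleftrightarrow>
    (\<exists>a b. a < b \<and> b \<le> a + 2 * pi \<and> (I = cis ` {a..<b} \<or> I = cis ` {a<..b}))"

definition Q_up :: "complex set \<Rightarrow> complex set"
  where "Q_up I = {of_real r * cis t | r t.
    cis t \<in> I \<and> 1 - arc_length I \<le> r \<and> r < 1 - arc_length I / 2}"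

definition dyadic_system :: "complex set set \<Rightarrow> bool"
  where "dyadic_system \<D> \<longleftrightarrow>
    (\<exists>D :: nat \<Rightarrow> complex set set.
       \<D> = (\<Union>k. D k) \<and>
       D 0 = {unit_circle} \<and>
       (\<forall>k. partition_on unit_circle (D k) \<and> card (D k) = 2 ^ k \<and>
            (\<forall>I\<in>D k. half_open_arc I \<and> arc_length I = 1 / 2 ^ k)) \<and>
       (\<forall>k. \<forall>I\<in>D (Suc k). \<exists>J\<in>D k. I \<subseteq> J))"

text \<open>All sums are unconditional sums in \<open>[0, \<infinity>]\<close>, and the infimum of the empty set is \<open>\<infinity>\<close>.\<close>
definition capacity_gauge :: "real \<Rightarrow> complex set set \<Rightarrow> (complex set \<Rightarrow> ennreal) \<Rightarrow> ennreal"
  where "capacity_gauge p \<D> h =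
    Inf {(\<Sum>\<^sub>\<infinity>J\<in>\<D>. ennreal (l J * arc_length J powr p)) | l :: complex set \<Rightarrow> real.
      (\<forall>J\<in>\<D>. 0 \<le> l J) \<and> (\<forall>I\<in>\<D>. h I \<le> (\<Sum>\<^sub>\<infinity>J\<in>{J\<in>\<D>. I \<subseteq> J}. ennreal (l J)))}"

definition h_weight :: "real \<Rightarrow> (complex \<Rightarrow> real) \<Rightarrow> complex set \<Rightarrow> ennreal"
  where "h_weight p W I =
    (\<integral>\<^sup>+z\<in>Q_up I. ennreal (W z) \<partial>dA) / ennreal (arc_length I powr (p + 2))"

definition embedding_bound :: "real \<Rightarrow> (complex \<Rightarrow> real) \<Rightarrow> real \<Rightarrow> bool"
  where "embedding_bound p W C \<longleftrightarrow>
    (\<forall>F\<in>Q_space p. (\<integral>\<^sup>+z\<in>unit_disc. ennreal ((norm (deriv F z))\<^sup>2 * W z) \<partial>dA)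
                     \<le> ennreal C * Q_seminorm_sq p F)"

text \<open>Infimum in \<open>[0, \<infinity>]\<close>, hence \<open>\<infinity>\<close> if there is no admissible constant.\<close>
definition C_best :: "real \<Rightarrow> (complex \<Rightarrow> real) \<Rightarrow> ennreal"
  where "C_best p W = Inf {ennreal C | C. 0 \<le> C \<and> embedding_bound p W C}"

definition comparable :: "real \<Rightarrow> ennreal \<Rightarrow> ennreal \<Rightarrow> bool"
  where "comparable K A B \<longleftrightarrow> B / ennreal K \<le> A \<and> A \<le> ennreal K * B"

end

theory Submission imports Defs begin

text \<open>
  Both inequalities between the embedding constant and the gauge are instances of linear
  programming duality on the tree \<open>Dy\<close> of dyadic arcs, with constants that do not depend on
  the dyadic system.  In particular the gauges for any two dyadic systems are comparable to the same
  number, and hence so are their infimum and their supremum.  The gauge of \<open>h\<close> is the value of the program ``minimize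
  \<open>\<Sum>J. l J * |J|^p\<close> over \<open>l \<ge> 0\<close> with \<open>\<Sum>J \<supseteq> I. l J \<ge> h I\<close>''; its dual is ``maximize \<open>\<Sum>I. h I * x I\<close>
  over \<open>x \<ge> 0\<close> with \<open>\<Sum>I \<subseteq> J. x I \<le> |J|^p\<close>''.  The constraint of the dual says that \<open>x\<close> is a discrete
  \<open>p\<close>-Carleson measure, and \<open>\<Q>\<^sub>p\<close> functions are those for which \<open>|F'(z)|\<^sup>2 (1 - |z|)^p dA\<close> is a
  \<open>p\<close>-Carleson measure.

  Upper bound for the embedding constant (\<open>embedding_le_cover_cost\<close>).  The boxes \<open>Q_up I\<close> cover the
  disc.  On \<open>Q_up I\<close> the mean value inequality bounds \<open>|F'|\<^sup>2 |I|^(p+2)\<close> by the mass that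
  \<open>|F'|\<^sup>2 (1 - |z|)^p dA\<close> gives to a slightly larger Whitney region.  These regions overlap boundedly
  (\<open>packing\<close>), and those below \<open>J\<close> lie in a Carleson box over \<open>J\<close>, where \<open>1 - |z|\<close> is at most a
  multiple of \<open>|J|\<close> times the Green function with pole at the point \<open>arc_pt J\<close> of that box.  So the
  masses are, up to the factor \<open>\<parallel>F\<parallel>\<^sup>2\<close>, feasible for the dual program, and weak duality (an
  exchange of two sums) gives the bound.

  Lower bound (\<open>gauge_le_embedding_constant\<close>).  Strong duality holds for laminar families:
  a greedy procedure solves the finite programs and Tychonoff's theorem passes to all of \<open>Dy\<close>
  (\<open>laminar_duality\<close>).  It remains to bound \<open>\<Sum>I. h I * x I\<close> for a finitely supported feasible \<open>x\<close>.
  To \<open>x\<close> belong the functions \<open>F = \<Sum>I. \<plusminus> F_I\<close>, where \<open>F_I'(z) = (x I / |I|^p)^(1/2) |I|\<^sup>2 / (1 - cnj a_I z)^3\<close>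
  and \<open>a_I = arc_pt I\<close> has distance \<open>|I| / 2\<close> to the circle.  On \<open>Q_up I\<close>, \<open>|F_I'|\<^sup>2\<close> is at least a multiple of
  \<open>x I / |I|^(p+2)\<close>, and for a suitable choice of signs \<open>\<integral> |F'|\<^sup>2 W dA\<close> is at least
  \<open>\<Sum>I. \<integral> |F_I'|\<^sup>2 W dA\<close> (parallelogram law), hence at least a multiple of \<open>\<Sum>I. h I * x I\<close>.  On the other hand,
  \<open>\<parallel>F\<parallel>\<close> is bounded by a constant that depends only on \<open>p\<close>, for every choice of signs
  (\<open>green_integral_bound\<close>).

  The bounds for these \<open>F\<close> rest on one device.  The function \<open>hdist a z = (1 - |a|) + (1 - |z|) + |a - z|\<close> is
  comparable to \<open>|1 - cnj a z|\<close> and satisfies the triangle inequality.  If a measure gives mass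
  \<open>O(\<rho>^p)\<close> to every set \<open>{d < \<rho>}\<close>, then summation over dyadic layers bounds the integral of
  \<open>max r d powr -\<gamma>\<close> for \<open>\<gamma> > p\<close> (\<open>nn_integral_layers\<close>).  It is applied to the area measure, to
  point masses at the \<open>a_I\<close> and to \<open>|F'|\<^sup>2 (1 - |z|)^p dA\<close>, in place of explicit integrals of
  Bergman kernels.
\<close>

section \<open>Area measure and distance to the boundary\<close>

text \<open>The Euclidean distance of two points plus their distances to the circle.  Up to constants it is
  the modulus of \<open>1 - cnj a * z\<close>, the denominator of the Green function and of all kernels below,
  but it satisfies an exact triangle inequality.  Note \<open>hdist a z \<ge> 1 - norm a\<close>.\<close>
definition hdist :: "complex \<Rightarrow> complex \<Rightarrow> real"
  where "hdist a z = (1 - norm a) + (1 - norm z) + norm (a - z)"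

lemma hdist_commute: "hdist a z = hdist z a"
  by (simp add: hdist_def norm_minus_commute)

lemma hdist_triangle:
  assumes "norm w \<le> 1"
  shows "hdist a z \<le> hdist a w + hdist w z"
  using norm_triangle_ineq[of "a - w" "w - z"] assms by (simp add: hdist_def)

text \<open>The identity behind \<open>1 - |\<sigma>|\<^sup>2\<close>; it also shows that \<open>|a - z| \<le> |1 - cnj a z|\<close> in the disc.\<close>
lemma norm_one_minus_cnj_mult_squared:
  "(norm (1 - cnj a * z))\<^sup>2 = (norm (a - z))\<^sup>2 + (1 - (norm a)\<^sup>2) * (1 - (norm z)\<^sup>2)"
  by (simp only: cmod_power2) (simp add: algebra_simps power2_eq_square)

lemma hdist_le_cross_norm:
  assumes "norm a \<le> 1" "norm z \<le> 1"
  shows "hdist a z \<le> 3 * norm (1 - cnj a * z)"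
proof -
  have "norm a * norm z \<le> norm a * 1" "norm a * norm z \<le> 1 * norm z"
    using assms by (intro mult_mono; simp)+
  moreover have "1 - norm a * norm z \<le> norm (1 - cnj a * z)"
    using norm_triangle_ineq2[of 1 "cnj a * z"] by (simp add: norm_mult)
  moreover have "norm (a - z) \<le> norm (1 - cnj a * z)"
  proof (rule power2_le_imp_le)
    have "0 \<le> (1 - (norm a)\<^sup>2) * (1 - (norm z)\<^sup>2)"
      using assms by (intro mult_nonneg_nonneg) (auto simp: power_le_one)
    then show "(norm (a - z))\<^sup>2 \<le> (norm (1 - cnj a * z))\<^sup>2"
      by (simp add: norm_one_minus_cnj_mult_squared)
  qed simp
  ultimately show ?thesis by (simp add: hdist_def)
qed

lemma cross_norm_le_hdist:
  assumes "norm a \<le> 1" "norm z \<le> 1"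
  shows "norm (1 - cnj a * z) \<le> 2 * hdist a z"
proof -
  have "1 - cnj a * z = of_real (1 - (norm a)\<^sup>2) + cnj a * (a - z)"
    using complex_norm_square[of a] by (simp add: algebra_simps)
  then have "norm (1 - cnj a * z) \<le> norm (of_real (1 - (norm a)\<^sup>2) :: complex) + norm (cnj a * (a - z))"
    by (metis norm_triangle_ineq)
  also have "norm (of_real (1 - (norm a)\<^sup>2) :: complex) = 1 - (norm a)\<^sup>2"
    using assms by (simp only: norm_of_real) (simp add: abs_square_le_1 power_le_one)
  also have "1 - (norm a)\<^sup>2 = (1 - norm a) * (1 + norm a)"
    by (simp add: power2_eq_square algebra_simps)
  also have "\<dots> \<le> (1 - norm a) * 2"
    using assms by (intro mult_left_mono) auto
  also have "norm (cnj a * (a - z)) \<le> 1 * norm (a - z)"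
    using assms by (simp add: norm_mult mult_left_le_one_le)
  finally have "norm (1 - cnj a * z) \<le> (1 - norm a) * 2 + norm (a - z)" by simp
  also have "\<dots> \<le> 2 * hdist a z"
    using assms unfolding hdist_def by (smt (verit) norm_ge_zero)
  finally show ?thesis .
qed

lemma sets_dA [measurable_cong, simp]: "sets dA = sets lebesgue"
  by (simp add: dA_def)

lemma space_dA [simp]: "space dA = UNIV"
  by (simp add: dA_def)

lemma emeasure_lborel_ball_complex:
  assumes "0 \<le> r"
  shows "emeasure lborel (ball (a::complex) r) = ennreal (pi * r\<^sup>2)"
  using assms by (simp add: emeasure_ball unit_ball_vol_numeral(1)[of Num.One, simplified] DIM_complex eval_unit_ball_vol)

lemma borel_measurable_dA: "f \<in> borel_measurable borel \<Longrightarrow> f \<in> borel_measurable dA"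
  using measurable_completion[of f lborel borel] by (simp add: measurable_def)

lemma borel_measurable_ennreal_indicator:
  fixes g :: "'a::topological_space \<Rightarrow> real"
  assumes "continuous_on A g" "A \<in> sets borel"
  shows "(\<lambda>z. ennreal (g z) * indicator A z) \<in> borel_measurable borel"
proof -
  have "(\<lambda>z. indicator A z *\<^sub>R g z) \<in> borel_measurable borel"
    using assms(2,1) by (rule borel_measurable_continuous_on_indicator)
  then have "(\<lambda>z. ennreal (indicator A z *\<^sub>R g z)) \<in> borel_measurable borel" by simp
  also have "(\<lambda>z. ennreal (indicator A z *\<^sub>R g z)) = (\<lambda>z. ennreal (g z) * indicator A z)"
    by (auto simp: indicator_def)
  finally show ?thesis .
qed

lemma nn_integral_dA:
  assumes "f \<in> borel_measurable lebesgue"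
  shows "(\<integral>\<^sup>+z. f z \<partial>dA) = (\<integral>\<^sup>+z\<in>unit_disc. f z \<partial>lebesgue) / ennreal pi"
  using assms emeasure_lborel_ball_complex[of 1 0]
  by (simp add: dA_def nn_integral_uniform_measure)

lemma emeasure_dA_ball_le:
  assumes "0 \<le> r"
  shows "emeasure dA (ball a r) \<le> ennreal (r\<^sup>2)"
proof -
  have "emeasure dA (ball a r) = emeasure lebesgue (unit_disc \<inter> ball a r) / ennreal pi"
    using emeasure_lborel_ball_complex[of 1 0] by (simp add: dA_def)
  also have "\<dots> \<le> emeasure lebesgue (ball a r) / ennreal pi"
    by (intro divide_right_mono_ennreal emeasure_mono) auto
  also have "\<dots> = ennreal (r\<^sup>2)"
    using assms by (simp add: emeasure_lborel_ball_complex divide_ennreal)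
  finally show ?thesis .
qed

lemma AE_dA_neq: "AE z in dA. z \<noteq> a"
proof -
  have "AE z in lebesgue. z \<noteq> a"
    by (intro AE_I[of _ _ "{a}"]) auto
  then show ?thesis unfolding dA_def
    by (intro AE_uniform_measureI) (auto simp: eventually_mono)
qed

text \<open>The geometric series that arises when the sets \<open>d < 2 ^ (n + 1) * r\<close>, of mass at most
  \<open>(2 ^ (n + 1) * r) powr p\<close>, are weighted by \<open>(2 ^ n * r) powr -\<gamma>\<close>.\<close>
definition layer_const :: "real \<Rightarrow> real \<Rightarrow> real"
  where "layer_const p \<gamma> = 2 powr p / (1 - 2 powr (p - \<gamma>))"

lemma layer_const_nonneg: "p < \<gamma> \<Longrightarrow> 0 \<le> layer_const p \<gamma>"
  using powr_mono[of "p - \<gamma>" 0 2] by (simp add: layer_const_def)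

text \<open>The integrand is at most \<open>(2 ^ n * r) powr -\<gamma>\<close> on the layer where \<open>max r d\<close> is between
  \<open>2 ^ n * r\<close> and \<open>2 ^ (n + 1) * r\<close>; the masses of the layers grow more slowly than these
  values decay because \<open>p < \<gamma>\<close>.\<close>
lemma nn_integral_layers:
  fixes d :: "'a \<Rightarrow> real"
  assumes [measurable]: "d \<in> borel_measurable N"
    and p: "0 < p" "p < \<gamma>" and C: "0 \<le> C" and r: "0 < r"
    and small: "\<And>\<rho>. \<rho> > 0 \<Longrightarrow> emeasure N {x\<in>space N. d x < \<rho>} \<le> ennreal (C * \<rho> powr p)"
  shows "(\<integral>\<^sup>+x. ennreal (max r (d x) powr -\<gamma>) \<partial>N) \<le> ennreal (C * layer_const p \<gamma> * r powr (p - \<gamma>))"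
proof -
  define T where "T n x = ennreal ((2^n * r) powr -\<gamma>) * indicator {x\<in>space N. d x < 2^Suc n * r} x" for n x
  define q where "q = 2 powr (p - \<gamma>)"
  have q: "0 < q" "q < 1" using p by (auto simp: q_def powr_less_one)
  have [measurable]: "T n \<in> borel_measurable N" for n unfolding T_def by measurable
  have pw: "ennreal (max r (d x) powr -\<gamma>) \<le> (\<Sum>n. T n x)" if "x \<in> space N" for x
  proof -
    define m where "m = max r (d x)"
    (* the layer that contains x has index n *)
    define L where "L = log 2 (m / r)"
    define n where "n = nat \<lfloor>L\<rfloor>"
    have m: "m > 0" "m / r \<ge> 1" using r by (auto simp: m_def)
    then have "L \<ge> 0" by (simp add: L_def)
    then have n: "real n \<le> L" "L < real (Suc n)" unfolding n_def by linarith+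
    have mL: "m = 2 powr L * r" using m r by (simp add: L_def)
    have 1: "2^n * r \<le> m" using n(1) r by (simp add: mL powr_realpow[symmetric])
    have "2 powr L < 2 powr real (Suc n)" using n(2) by simp
    then have 2: "m < 2^Suc n * r" using r by (simp only: mL powr_realpow mult_less_cancel_right) simp
    have "m powr -\<gamma> \<le> (2^n * r) powr -\<gamma>"
      using 1 r p by (intro powr_mono2') auto
    then have "ennreal (m powr -\<gamma>) \<le> T n x"
      using 2 that by (auto simp: T_def m_def intro!: ennreal_leI)
    also have "\<dots> \<le> (\<Sum>n. T n x)"
      using sum_le_suminf[OF summableI, of "{n}" "\<lambda>n. T n x"] by simp
    finally show ?thesis by (simp add: m_def)
  qed
  have layer: "(\<integral>\<^sup>+x. T n x \<partial>N) \<le> ennreal (C * 2 powr p * r powr (p - \<gamma>) * q ^ n)" for n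
  proof -
    have "(\<integral>\<^sup>+x. T n x \<partial>N) = ennreal ((2^n * r) powr -\<gamma>) * emeasure N {x\<in>space N. d x < 2^Suc n * r}"
      unfolding T_def by (simp add: nn_integral_cmult_indicator)
    also have "\<dots> \<le> ennreal ((2^n * r) powr -\<gamma>) * ennreal (C * (2^Suc n * r) powr p)"
      using r by (intro mult_left_mono small) auto
    also have "\<dots> = ennreal ((2^n * r) powr -\<gamma> * (C * (2^Suc n * r) powr p))"
      using C by (simp add: ennreal_mult)
    also have "(2^n * r) powr -\<gamma> * (C * (2^Suc n * r) powr p) = C * 2 powr p * ((2^n * r) powr -\<gamma> * (2^n * r) powr p)"
      using r by (simp add: powr_mult mult_ac)
    also have "(2^n * r) powr -\<gamma> * (2^n * r) powr p = (2^n * r) powr (p - \<gamma>)"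
      using r by (simp add: powr_add[symmetric])
    also have "\<dots> = r powr (p - \<gamma>) * (2 powr real n) powr (p - \<gamma>)"
      using r by (simp add: powr_mult powr_realpow)
    also have "(2 powr real n) powr (p - \<gamma>) = q ^ n"
      using q by (simp add: q_def powr_powr mult.commute flip: powr_realpow)
    finally show ?thesis by (simp add: mult_ac)
  qed
  have "(\<integral>\<^sup>+x. ennreal (max r (d x) powr -\<gamma>) \<partial>N) \<le> (\<integral>\<^sup>+x. (\<Sum>n. T n x) \<partial>N)"
    by (intro nn_integral_mono pw)
  also have "\<dots> = (\<Sum>n. \<integral>\<^sup>+x. T n x \<partial>N)" by (rule nn_integral_suminf) measurable
  also have "\<dots> \<le> (\<Sum>n. ennreal (C * 2 powr p * r powr (p - \<gamma>) * q ^ n))"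
    by (intro suminf_le layer summableI)
  also have "\<dots> = ennreal (\<Sum>n. C * 2 powr p * r powr (p - \<gamma>) * q ^ n)"
    using q C by (intro suminf_ennreal2 summable_mult summable_geometric) auto
  also have "(\<Sum>n. C * 2 powr p * r powr (p - \<gamma>) * q ^ n) = C * 2 powr p * r powr (p - \<gamma>) * (1 / (1 - q))"
    using q by (simp add: suminf_mult suminf_geometric summable_geometric)
  finally show ?thesis by (simp add: layer_const_def q_def mult_ac)
qed

text \<open>A ball of radius \<open>\<rho>\<close> has area at most \<open>\<rho>\<^sup>2\<close>, so this is the layer estimate with
  growth exponent \<open>2\<close>.\<close>
lemma nn_integral_hdist_powr_le:
  assumes w: "w \<in> unit_disc" and "2 < \<gamma>"
  shows "(\<integral>\<^sup>+z\<in>unit_disc. ennreal (hdist w z powr -\<gamma>) \<partial>dA) \<le> ennreal (layer_const 2 \<gamma> * (1 - norm w) powr (2 - \<gamma>))"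
proof -
  have "max (1 - norm w) (norm (w - z)) \<le> hdist w z" if "norm z < 1" for z
    using that w norm_ge_zero[of "w - z"] by (auto simp: hdist_def simp del: norm_ge_zero)
  then have "(\<integral>\<^sup>+z\<in>unit_disc. ennreal (hdist w z powr -\<gamma>) \<partial>dA)
      \<le> (\<integral>\<^sup>+z. ennreal (max (1 - norm w) (norm (w - z)) powr -\<gamma>) \<partial>dA)"
    using assms
    by (intro nn_integral_mono) (auto simp: indicator_def simp del: max.bounded_iff intro!: ennreal_leI powr_mono2')
  also have "\<dots> \<le> ennreal (1 * layer_const 2 \<gamma> * (1 - norm w) powr (2 - \<gamma>))"
  proof (rule nn_integral_layers)
    show "emeasure dA {x \<in> space dA. norm (w - x) < \<rho>} \<le> ennreal (1 * \<rho> powr 2)" if "0 < \<rho>" for \<rho>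
      using emeasure_dA_ball_le[of \<rho> w] that
      by (simp add: ball_def dist_norm powr_numeral)
  qed (use assms in \<open>auto intro!: borel_measurable_dA\<close>)
  finally show ?thesis by simp
qed

section \<open>The area mean value inequality\<close>

lemma borel_measurable_Complex_pair: "(\<lambda>(x, y). Complex x y) \<in> borel_measurable (lborel \<Otimes>\<^sub>M lborel)"
  unfolding Complex_eq case_prod_unfold by measurable

text \<open>Lebesgue measure on the complex plane as a product, which makes Fubini's theorem available for
  integrals over horizontal and vertical segments.\<close>
lemma lborel_complex: "lborel = distr (lborel \<Otimes>\<^sub>M lborel) borel (\<lambda>(x, y). Complex x y)"
proof (rule lborel_eqI)
  have [measurable]: "(\<lambda>(x, y). Complex x y) \<in> borel_measurable (lborel \<Otimes>\<^sub>M lborel)"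
    by (rule borel_measurable_Complex_pair)
  show "emeasure (distr (lborel \<Otimes>\<^sub>M lborel) borel (\<lambda>(x, y). Complex x y)) (box l u)
      = ennreal (\<Prod>b\<in>Basis. (u - l) \<bullet> b)" if "\<And>b. b \<in> Basis \<Longrightarrow> l \<bullet> b \<le> u \<bullet> b" for l u :: complex
  proof -
    have le: "Re l \<le> Re u" "Im l \<le> Im u"
      using that[of 1] that[of \<i>] by (auto simp: Basis_complex_def inner_complex_def)
    have "(\<lambda>(x, y). Complex x y) -` box l u = {Re l<..<Re u} \<times> {Im l<..<Im u}"
      by (auto simp: in_box_complex_iff)
    then show ?thesis using le
      by (simp add: emeasure_distr space_pair_measure lborel.emeasure_pair_measure_Times
          Basis_complex_def inner_complex_def ennreal_mult)
  qed
qed simp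

lemma nn_integral_complex:
  assumes [measurable]: "K \<in> borel_measurable (borel :: complex measure)"
  shows "(\<integral>\<^sup>+w. K w \<partial>lborel) = (\<integral>\<^sup>+x. \<integral>\<^sup>+y. K (Complex x y) \<partial>lborel \<partial>lborel)"
    and "(\<integral>\<^sup>+w. K w \<partial>lborel) = (\<integral>\<^sup>+y. \<integral>\<^sup>+x. K (Complex x y) \<partial>lborel \<partial>lborel)"
proof -
  have C [measurable]: "(\<lambda>(x, y). Complex x y) \<in> borel_measurable (lborel \<Otimes>\<^sub>M lborel)"
    by (rule borel_measurable_Complex_pair)
  have "(\<integral>\<^sup>+w. K w \<partial>lborel) = (\<integral>\<^sup>+q. K (case q of (x, y) \<Rightarrow> Complex x y) \<partial>(lborel \<Otimes>\<^sub>M lborel))"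
    by (subst lborel_complex) (simp add: nn_integral_distr)
  then show "(\<integral>\<^sup>+w. K w \<partial>lborel) = (\<integral>\<^sup>+x. \<integral>\<^sup>+y. K (Complex x y) \<partial>lborel \<partial>lborel)"
    using lborel.nn_integral_fst[of "\<lambda>q. K (case q of (x, y) \<Rightarrow> Complex x y)" lborel] by simp
  then show "(\<integral>\<^sup>+w. K w \<partial>lborel) = (\<integral>\<^sup>+y. \<integral>\<^sup>+x. K (Complex x y) \<partial>lborel \<partial>lborel)"
    using lborel_pair.Fubini'[of "\<lambda>x y. K (Complex x y)"] measurable_compose[OF C assms]
    by (simp add: case_prod_beta')
qed

lemma nn_integral_lborel_reflect:
  assumes [measurable]: "g \<in> borel_measurable (borel :: real measure)"
  shows "(\<integral>\<^sup>+x. g (-x) \<partial>lborel) = (\<integral>\<^sup>+x. g x \<partial>lborel)"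
  using nn_integral_real_affine[of g "-1" 0] by simp

lemma ennreal_norm_integral_le:
  fixes g :: "real \<Rightarrow> complex"
  assumes "continuous_on {a..b} g"
  shows "ennreal (norm (integral {a..b} g)) \<le> (\<integral>\<^sup>+x\<in>{a..b}. ennreal (norm (g x)) \<partial>lborel)"
proof -
  have i: "(\<lambda>x. norm (g x)) integrable_on {a..b}"
    by (intro integrable_continuous_real continuous_intros assms)
  have "norm (integral {a..b} g) \<le> integral {a..b} (\<lambda>x. norm (g x))"
    using integral_norm_bound_integral[OF integrable_continuous_real[OF assms] i] by simp
  moreover have "(\<integral>\<^sup>+x\<in>{a..b}. ennreal (norm (g x)) \<partial>lborel) = ennreal (integral {a..b} (\<lambda>x. norm (g x)))"
    by (rule nn_integral_has_integral_lebesgue') (use i in \<open>auto simp: has_integral_integral\<close>)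
  ultimately show ?thesis by (simp add: ennreal_leI)
qed

lemma norm_contour_integral_vertical_le:
  assumes "a < b" "continuous_on {a..b} (\<lambda>y. g (Complex c y))"
  shows "ennreal (norm (contour_integral (linepath (Complex c a) (Complex c b)) g))
    \<le> (\<integral>\<^sup>+y\<in>{a..b}. ennreal (norm (g (Complex c y))) \<partial>lborel)"
  using ennreal_norm_integral_le[OF assms(2)] assms(1)
  by (subst contour_integral_linepath_same_Re) (auto simp: norm_mult)

lemma norm_contour_integral_horizontal_le:
  assumes "a < b" "continuous_on {a..b} (\<lambda>x. g (Complex x c))"
  shows "ennreal (norm (contour_integral (linepath (Complex a c) (Complex b c)) g))
    \<le> (\<integral>\<^sup>+x\<in>{a..b}. ennreal (norm (g (Complex x c))) \<partial>lborel)"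
proof -
  have "contour_integral (linepath (Complex a c) (Complex b c)) g
      = contour_integral (linepath (of_real a) (of_real b)) (\<lambda>w. g (w + \<i> * c))"
    by (simp add: contour_integral_integral linepath_def Complex_eq algebra_simps scaleR_conv_of_real)
  also have "\<dots> = integral {a..b} (\<lambda>x. g (Complex x c))"
    using assms(1) by (subst contour_integral_linepath_Reals_eq) (auto simp: Complex_eq)
  finally show ?thesis using ennreal_norm_integral_le[OF assms(2)] by simp
qed

definition csquare :: "real \<Rightarrow> complex set"
  where "csquare r = {w. \<bar>Re w\<bar> \<le> r \<and> \<bar>Im w\<bar> \<le> r}"

lemma csquare_eq_cbox: "csquare r = cbox (Complex (-r) (-r)) (Complex r r)"
  by (auto simp: csquare_def in_cbox_complex_iff)

text \<open>Cauchy's formula on the boundary of a square centred at the origin, where the Cauchy kernel is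
  at most \<open>1 / s\<close>.  Squares are used in place of circles because averaging their sides only needs
  Fubini's theorem in Cartesian coordinates.\<close>
lemma norm_le_sides_of_square:
  fixes f :: "complex \<Rightarrow> complex"
  assumes s: "0 < s" and holo: "f holomorphic_on csquare s"
  defines "H \<equiv> \<lambda>w. ennreal (norm (f w)) * indicator (csquare s) w"
  shows "ennreal (2 * pi * s * norm (f 0)) \<le>
     (\<integral>\<^sup>+y. H (Complex s y) \<partial>lborel) + (\<integral>\<^sup>+y. H (Complex (-s) y) \<partial>lborel)
   + (\<integral>\<^sup>+x. H (Complex x s) \<partial>lborel) + (\<integral>\<^sup>+x. H (Complex x (-s)) \<partial>lborel)"
proof -
  let ?a = "Complex (-s) (-s)" and ?b = "Complex s s"
  let ?a2 = "Complex s (-s)" and ?a4 = "Complex (-s) s"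
  define g where "g = (\<lambda>w. f w / (w - 0))"
  have cf: "continuous_on (csquare s) f" using holo by (rule holomorphic_on_imp_continuous_on)
  have cg: "continuous_on (csquare s - {0}) g" unfolding g_def
    by (intro continuous_intros continuous_on_subset[OF cf]) auto
  have img: "path_image (rectpath ?a ?b) \<subseteq> csquare s - {0}"
    using s by (subst path_image_rectpath_cbox_minus_box)
       (auto simp: csquare_eq_cbox in_box_complex_iff)
  have z: "0 \<in> interior (csquare s)"
    using s by (auto simp: csquare_eq_cbox interior_cbox in_box_complex_iff)
  have "((\<lambda>w. f w / (w - 0)) has_contour_integral (2 * pi * \<i> * winding_number (rectpath ?a ?b) 0 * f 0)) (rectpath ?a ?b)"
    by (rule Cauchy_integral_formula_convex_simple[OF _ holo z])
       (use img in \<open>auto simp: csquare_eq_cbox\<close>)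
  moreover have "winding_number (rectpath ?a ?b) 0 = 1"
    using s by (intro winding_number_rectpath) (auto simp: in_box_complex_iff)
  ultimately have I: "(g has_contour_integral (2 * pi * \<i> * f 0)) (rectpath ?a ?b)"
    by (simp add: g_def)
  have seg: "g contour_integrable_on linepath p q" if "closed_segment p q \<subseteq> csquare s - {0}" for p q
    by (intro contour_integrable_continuous_linepath continuous_on_subset[OF cg] that)
  have sub: "closed_segment ?a ?a2 \<subseteq> csquare s - {0}" "closed_segment ?a2 ?b \<subseteq> csquare s - {0}"
    "closed_segment ?b ?a4 \<subseteq> csquare s - {0}" "closed_segment ?a4 ?a \<subseteq> csquare s - {0}"
    using img by (simp_all add: rectpath_def Let_def path_image_join)
  note ci = sub[THEN seg]
  have eq: "2 * pi * \<i> * f 0 = contour_integral (linepath ?a ?a2) g + contour_integral (linepath ?a2 ?b) g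
     - contour_integral (linepath ?a4 ?b) g - contour_integral (linepath ?a ?a4) g"
    using contour_integral_unique[OF I] ci contour_integral_reverse_linepath[of ?a4 ?b g] contour_integral_reverse_linepath[of ?a ?a4 g]
       continuous_on_subset[OF cg sub(3)] continuous_on_subset[OF cg sub(4)]
    by (simp add: rectpath_def Let_def closed_segment_commute algebra_simps)
  have inQ: "Complex x y \<in> csquare s \<longleftrightarrow> \<bar>x\<bar> \<le> s \<and> \<bar>y\<bar> \<le> s" for x y by (simp add: csquare_def)
  have bd: "ennreal (norm (g w)) \<le> ennreal (1/s) * ennreal (norm (f w))" if "s \<le> norm w" for w
  proof -
    have "norm (f w) / norm w \<le> norm (f w) / s" using that s by (intro divide_left_mono mult_pos_pos) auto
    then show ?thesis using s by (simp add: g_def norm_divide ennreal_mult[symmetric] ennreal_leI)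
  qed
  have nr: "s \<le> norm (Complex s t)" "s \<le> norm (Complex (-s) t)" "s \<le> norm (Complex t s)" "s \<le> norm (Complex t (-s))" for t
    using s abs_Re_le_cmod[of "Complex s t"] abs_Re_le_cmod[of "Complex (-s) t"]
      abs_Im_le_cmod[of "Complex t s"] abs_Im_le_cmod[of "Complex t (-s)"] by auto
  have cl: "continuous_on {-s..s} (\<lambda>t. g (h t))"
    if "continuous_on {-s..s} h" "\<And>t. t \<in> {-s..s} \<Longrightarrow> h t \<in> csquare s - {0}" for h
    by (rule continuous_on_compose2[OF cg that(1)]) (use that(2) in auto)
  have cC: "continuous_on {-s..s} (\<lambda>t. Complex t c)" "continuous_on {-s..s} (\<lambda>t. Complex c t)" for c
    by (auto simp: Complex_eq intro!: continuous_intros)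
  have side: "(\<integral>\<^sup>+t\<in>{-s..s}. ennreal (norm (g (h t))) \<partial>lborel) \<le> ennreal (1/s) * (\<integral>\<^sup>+t. H (h t) \<partial>lborel)"
    if "continuous_on {-s..s} h" "\<And>t. h t \<in> csquare s \<longleftrightarrow> t \<in> {-s..s}" "\<And>t. s \<le> norm (h t)" for h
  proof -
    have "continuous_on {-s..s} (\<lambda>t. f (h t))"
      using that(2) by (intro continuous_on_compose2[OF cf that(1)]) blast
    then have "(\<lambda>t. ennreal (norm (f (h t))) * indicator {-s..s} t) \<in> borel_measurable borel"
      by (intro borel_measurable_ennreal_indicator continuous_on_norm) auto
    moreover have "ennreal (norm (f (h t))) * indicator {-s..s} t = H (h t)" for t
      using that(2)[of t] by (auto simp: H_def indicator_def)
    ultimately have m: "(\<lambda>t. H (h t)) \<in> borel_measurable lborel" by simp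
    have "(\<integral>\<^sup>+t\<in>{-s..s}. ennreal (norm (g (h t))) \<partial>lborel) \<le> (\<integral>\<^sup>+t. ennreal (1/s) * H (h t) \<partial>lborel)"
      using that bd by (intro nn_integral_mono) (auto simp: H_def indicator_def)
    also have "\<dots> = ennreal (1/s) * (\<integral>\<^sup>+t. H (h t) \<partial>lborel)"
      using m by (rule nn_integral_cmult)
    finally show ?thesis .
  qed
  have nz: "Complex s t \<noteq> 0" "Complex (-s) t \<noteq> 0" "Complex t s \<noteq> 0" "Complex t (-s) \<noteq> 0" for t
    using s by (auto simp: complex_eq_iff)
  have s2: "-s < s" using s by simp
  have L1: "ennreal (norm (contour_integral (linepath ?a ?a2) g)) \<le> ennreal (1/s) * (\<integral>\<^sup>+x. H (Complex x (-s)) \<partial>lborel)"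
    by (rule order.trans[OF norm_contour_integral_horizontal_le[OF s2 cl] side]) (use s in \<open>auto simp: cC inQ nz nr\<close>)
  have L2: "ennreal (norm (contour_integral (linepath ?a4 ?b) g)) \<le> ennreal (1/s) * (\<integral>\<^sup>+x. H (Complex x s) \<partial>lborel)"
    by (rule order.trans[OF norm_contour_integral_horizontal_le[OF s2 cl] side]) (use s in \<open>auto simp: cC inQ nz nr\<close>)
  have L3: "ennreal (norm (contour_integral (linepath ?a2 ?b) g)) \<le> ennreal (1/s) * (\<integral>\<^sup>+y. H (Complex s y) \<partial>lborel)"
    by (rule order.trans[OF norm_contour_integral_vertical_le[OF s2 cl] side]) (use s in \<open>auto simp: cC inQ nz nr\<close>)
  have L4: "ennreal (norm (contour_integral (linepath ?a ?a4) g)) \<le> ennreal (1/s) * (\<integral>\<^sup>+y. H (Complex (-s) y) \<partial>lborel)"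
    by (rule order.trans[OF norm_contour_integral_vertical_le[OF s2 cl] side]) (use s in \<open>auto simp: cC inQ nz nr\<close>)
  note L = L1 L2 L3 L4
  have "norm (2 * pi * \<i> * f 0) \<le> norm (contour_integral (linepath ?a2 ?b) g) + norm (contour_integral (linepath ?a ?a4) g)
     + norm (contour_integral (linepath ?a4 ?b) g) + norm (contour_integral (linepath ?a ?a2) g)"
    unfolding eq using norm_triangle_ineq4 norm_triangle_ineq by (smt (verit))
  then have "ennreal (2 * pi * norm (f 0)) \<le> ennreal (norm (contour_integral (linepath ?a2 ?b) g)) + ennreal (norm (contour_integral (linepath ?a ?a4) g))
     + ennreal (norm (contour_integral (linepath ?a4 ?b) g)) + ennreal (norm (contour_integral (linepath ?a ?a2) g))"
    by (simp add: norm_mult ennreal_plus[symmetric] ennreal_leI del: ennreal_plus)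
  also have "\<dots> \<le> ennreal (1/s) * (\<integral>\<^sup>+y. H (Complex s y) \<partial>lborel) + ennreal (1/s) * (\<integral>\<^sup>+y. H (Complex (-s) y) \<partial>lborel)
     + ennreal (1/s) * (\<integral>\<^sup>+x. H (Complex x s) \<partial>lborel) + ennreal (1/s) * (\<integral>\<^sup>+x. H (Complex x (-s)) \<partial>lborel)"
    by (intro add_mono L)
  finally have *: "ennreal (2 * pi * norm (f 0)) \<le> ennreal (1/s) * ((\<integral>\<^sup>+y. H (Complex s y) \<partial>lborel) + (\<integral>\<^sup>+y. H (Complex (-s) y) \<partial>lborel)
     + (\<integral>\<^sup>+x. H (Complex x s) \<partial>lborel) + (\<integral>\<^sup>+x. H (Complex x (-s)) \<partial>lborel))"
    by (simp add: distrib_left)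
  have "ennreal (2 * pi * s * norm (f 0)) = ennreal s * ennreal (2 * pi * norm (f 0))"
    using s by (simp add: ennreal_mult[symmetric] mult_ac)
  also have "\<dots> \<le> ennreal s * (ennreal (1/s) * ((\<integral>\<^sup>+y. H (Complex s y) \<partial>lborel) + (\<integral>\<^sup>+y. H (Complex (-s) y) \<partial>lborel)
     + (\<integral>\<^sup>+x. H (Complex x s) \<partial>lborel) + (\<integral>\<^sup>+x. H (Complex x (-s)) \<partial>lborel)))"
    by (intro mult_left_mono *) simp
  also have "ennreal s * (ennreal (1/s) * X) = X" for X
    using s by (simp add: mult.assoc[symmetric] ennreal_mult[symmetric])
  finally show ?thesis .
qed

text \<open>The previous bound is integrated over \<open>s \<in> {r/2..r}\<close>: each of the four families of sides sweeps
  out part of the square and contributes at most the full area integral.\<close>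
lemma norm_le_integral_square:
  fixes f :: "complex \<Rightarrow> complex"
  assumes r: "0 < r" and holo: "f holomorphic_on csquare r"
  shows "ennreal (norm (f 0)) \<le> ennreal (8 / (pi * r\<^sup>2)) * (\<integral>\<^sup>+w\<in>csquare r. ennreal (norm (f w)) \<partial>lborel)"
proof -
  define H where "H = (\<lambda>w. ennreal (norm (f w)) * indicator (csquare r) w)"
  have H [measurable]: "H \<in> borel_measurable borel"
    unfolding H_def
    by (intro borel_measurable_ennreal_indicator continuous_intros holomorphic_on_imp_continuous_on[OF holo])
       (simp add: csquare_eq_cbox)
  have [measurable]: "(\<lambda>y. Complex c y) \<in> borel_measurable borel" "(\<lambda>x. Complex x c) \<in> borel_measurable borel" for c
    by (auto simp: Complex_eq)
  have [measurable]: "(\<lambda>q. Complex (fst q) (snd q)) \<in> borel_measurable (borel \<Otimes>\<^sub>M borel)"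
    "(\<lambda>q. Complex (snd q) (fst q)) \<in> borel_measurable (borel \<Otimes>\<^sub>M borel)"
    by (auto simp: Complex_eq)
  define I where "I = (\<integral>\<^sup>+w. H w \<partial>lborel)"
  define V where "V = (\<lambda>s. \<integral>\<^sup>+y. H (Complex s y) \<partial>lborel)"
  define U where "U = (\<lambda>s. \<integral>\<^sup>+x. H (Complex x s) \<partial>lborel)"
  have [measurable]: "V \<in> borel_measurable borel" "U \<in> borel_measurable borel"
    unfolding V_def U_def by measurable
  have VI: "(\<integral>\<^sup>+s. V s \<partial>lborel) = I" "(\<integral>\<^sup>+s. U s \<partial>lborel) = I"
    using nn_integral_complex[OF H] by (simp_all add: I_def V_def U_def)
  have pt: "ennreal (pi * r * norm (f 0)) * indicator {r/2..r} s \<le> V s + V (-s) + U s + U (-s)" for s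
  proof (cases "s \<in> {r/2..r}")
    case True
    then have s: "s > 0" "csquare s \<subseteq> csquare r" using r by (auto simp: csquare_def)
    have le: "ennreal (norm (f w)) * indicator (csquare s) w \<le> H w" for w
      using s(2) by (auto simp: H_def indicator_def)
    have "pi * r * norm (f 0) \<le> 2 * pi * s * norm (f 0)"
      using True by (intro mult_right_mono) auto
    then have "ennreal (pi * r * norm (f 0)) * indicator {r/2..r} s \<le> ennreal (2 * pi * s * norm (f 0))"
      using True by (simp add: ennreal_leI)
    also note norm_le_sides_of_square[OF s(1) holomorphic_on_subset[OF holo s(2)]]
    also have "(\<integral>\<^sup>+ y. ennreal (norm (f (Complex s y))) * indicator (csquare s) (Complex s y) \<partial>lborel) +
      (\<integral>\<^sup>+ y. ennreal (norm (f (Complex (- s) y))) * indicator (csquare s) (Complex (- s) y) \<partial>lborel) +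
      (\<integral>\<^sup>+ x. ennreal (norm (f (Complex x s))) * indicator (csquare s) (Complex x s) \<partial>lborel) +
      (\<integral>\<^sup>+ x. ennreal (norm (f (Complex x (- s)))) * indicator (csquare s) (Complex x (- s)) \<partial>lborel)
      \<le> V s + V (-s) + U s + U (-s)"
      unfolding V_def U_def by (intro add_mono nn_integral_mono le)
    finally show ?thesis .
  qed simp
  have "ennreal (pi * r\<^sup>2 / 2 * norm (f 0)) = ennreal (pi * r * norm (f 0)) * ennreal (r / 2)"
    using r by (simp add: ennreal_mult[symmetric] power2_eq_square mult_ac)
  also have "\<dots> = (\<integral>\<^sup>+s. ennreal (pi * r * norm (f 0)) * indicator {r/2..r} s \<partial>lborel)"
    using r by (simp add: nn_integral_cmult_indicator)
  also have "\<dots> \<le> (\<integral>\<^sup>+s. V s + V (-s) + U s + U (-s) \<partial>lborel)"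
    by (intro nn_integral_mono pt)
  also have "\<dots> = I + I + I + I"
    by (simp add: nn_integral_add nn_integral_lborel_reflect VI)
  also have "\<dots> = ennreal 4 * I"
  proof -
    have "ennreal 4 = 1 + 1 + 1 + 1" by simp
    then show ?thesis by (simp only: distrib_right mult_1)
  qed
  finally have *: "ennreal (pi * r\<^sup>2 / 2 * norm (f 0)) \<le> ennreal 4 * I" .
  have "ennreal (norm (f 0)) = ennreal (2 / (pi * r\<^sup>2)) * ennreal (pi * r\<^sup>2 / 2 * norm (f 0))"
    using r by (simp add: ennreal_mult[symmetric])
  also have "\<dots> \<le> ennreal (2 / (pi * r\<^sup>2)) * (ennreal 4 * I)"
    by (intro mult_left_mono *) simp
  also have "\<dots> = ennreal (8 / (pi * r\<^sup>2)) * I"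
    using r by (simp add: mult.assoc[symmetric] ennreal_mult[symmetric] del: ennreal_numeral)
  finally show ?thesis by (simp add: I_def H_def)
qed

text \<open>The preceding bound is applied to the holomorphic function \<open>f\<^sup>2\<close>; the square of half-side
  \<open>\<rho> / 2\<close> fits into the disc of radius \<open>\<rho>\<close>.\<close>
lemma norm_squared_le_area_mean:
  fixes f :: "complex \<Rightarrow> complex"
  assumes holo: "f holomorphic_on ball z \<rho>" and \<rho>: "0 < \<rho>" and sub: "ball z \<rho> \<subseteq> unit_disc"
  shows "ennreal ((norm (f z))\<^sup>2) \<le> ennreal (32 / \<rho>\<^sup>2) * (\<integral>\<^sup>+w\<in>ball z \<rho>. ennreal ((norm (f w))\<^sup>2) \<partial>dA)"
proof -
  define u where "u = (\<lambda>w. ennreal ((norm (f w))\<^sup>2) * indicator (ball z \<rho>) w)"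
  have [measurable]: "u \<in> borel_measurable borel"
    unfolding u_def
    by (intro borel_measurable_ennreal_indicator continuous_intros holomorphic_on_imp_continuous_on[OF holo]) auto
  have "csquare (\<rho>/2) \<subseteq> ball 0 \<rho>"
  proof
    fix w assume w: "w \<in> csquare (\<rho>/2)"
    have "(norm w)\<^sup>2 = \<bar>Re w\<bar>\<^sup>2 + \<bar>Im w\<bar>\<^sup>2" by (simp add: cmod_power2)
    also have "\<dots> \<le> (\<rho>/2)\<^sup>2 + (\<rho>/2)\<^sup>2"
      using w by (intro add_mono power_mono) (auto simp: csquare_def)
    also have "\<dots> < \<rho>\<^sup>2" using \<rho> by (simp add: power2_eq_square)
    finally show "w \<in> ball 0 \<rho>" using \<rho> by (simp add: power2_less_imp_less)
  qed
  then have Q: "z + w \<in> ball z \<rho>" if "w \<in> csquare (\<rho>/2)" for w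
    using that by (auto simp: dist_norm)
  have "(\<lambda>w. (f (z + w))\<^sup>2) holomorphic_on csquare (\<rho>/2)"
    by (intro holomorphic_intros holomorphic_on_compose_gen[OF _ holo, unfolded o_def]) (use Q in auto)
  from norm_le_integral_square[OF _ this]
  have "ennreal ((norm (f z))\<^sup>2) \<le> ennreal (32 / (pi * \<rho>\<^sup>2)) *
     (\<integral>\<^sup>+w\<in>csquare (\<rho>/2). ennreal ((norm (f (z + w)))\<^sup>2) \<partial>lborel)"
    using \<rho> by (simp add: norm_power power_divide)
  also have "(\<integral>\<^sup>+w\<in>csquare (\<rho>/2). ennreal ((norm (f (z + w)))\<^sup>2) \<partial>lborel) \<le> (\<integral>\<^sup>+w. u (z + w) \<partial>lborel)"
    using Q by (intro nn_integral_mono) (auto simp: u_def indicator_def)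
  also have "\<dots> = (\<integral>\<^sup>+w. u w \<partial>lborel)"
    by (subst (2) lborel_distr_plus[of z, symmetric]) (simp add: nn_integral_distr)
  also have "\<dots> = (\<integral>\<^sup>+w\<in>unit_disc. u w \<partial>lebesgue)"
    using sub by (subst nn_integral_completion[symmetric], intro nn_integral_cong) (auto simp: u_def indicator_def)
  also have "\<dots> = ennreal pi * (\<integral>\<^sup>+w. u w \<partial>dA)"
    by (subst nn_integral_dA) (auto simp: measurable_completion ennreal_divide_times mult.commute divide_ennreal_def mult.assoc[symmetric] ennreal_mult[symmetric] inverse_ennreal)
  finally show ?thesis
    using \<rho> by (simp add: mult.assoc[symmetric] ennreal_mult[symmetric] u_def mult_left_mono)
qed

section \<open>Arcs and dyadic systems\<close>

lemma cis_eq_iff_shift: "cis s = cis t \<longleftrightarrow> (\<exists>n::int. s = t + 2 * pi * n)"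
  using sin_cos_eq_iff[of s t] by (auto simp: complex_eq_iff)

text \<open>The parameter set of an arc in \<open>{0..<1}\<close> is, after division of the angles by \<open>2 * pi\<close> and a
  translation by an integer, an interval or the union of two intervals (if the arc passes through \<open>1\<close>),
  up to end points.\<close>
lemma arc_length_eq:
  assumes ab: "a < b" "b \<le> a + 2 * pi" and sub: "cis ` {a<..<b} \<subseteq> I" "I \<subseteq> cis ` {a..b}"
  shows "arc_length I = (b - a) / (2 * pi)"
proof -
  define m where "m = \<lfloor>a / (2 * pi)\<rfloor>"
  define A B where "A = a / (2 * pi) - m" and "B = b / (2 * pi) - m"
  have A: "0 \<le> A" "A < 1" unfolding A_def m_def by linarith+
  have "(b - a) / (2 * pi) = B - A" by (simp add: A_def B_def diff_divide_distrib)
  moreover have "0 < (b - a) / (2 * pi)" "(b - a) / (2 * pi) \<le> 1"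
    using ab by (auto simp: field_simps)
  ultimately have B: "A < B" "B \<le> A + 1" and BA: "B - A = (b - a) / (2 * pi)" by auto
  have a: "a = 2 * pi * (A + m)" and b: "b = 2 * pi * (B + m)"
    by (auto simp: A_def B_def)
  define T where "T = {t \<in> {0..<1}. cis (2 * pi * t) \<in> I}"
  define U where "U = {A<..<min B 1} \<union> {0<..<B - 1}"
  have shift: "cis (2 * pi * (t + real_of_int n)) = cis (2 * pi * t)" for t n
    by (subst cis_eq_iff_shift) (auto simp: algebra_simps)
  have "U \<subseteq> T"
  proof
    fix t assume t: "t \<in> U"
    then have "\<exists>n::int. A < t + n \<and> t + n < B"
    proof (cases "A < t \<and> t < min B 1")
      case True then show ?thesis by (intro exI[of _ 0]) auto
    next
      case False then show ?thesis using t A by (intro exI[of _ 1]) (auto simp: U_def)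
    qed
    then obtain n :: int where n: "A < t + n" "t + n < B" by auto
    have "2 * pi * (t + (n + m)) \<in> {a<..<b}"
      using n by (auto simp: a b)
    then have "cis (2 * pi * (t + real_of_int (n + m))) \<in> I" using sub(1) by auto
    then have "cis (2 * pi * t) \<in> I" by (simp only: shift)
    then show "t \<in> T" using t A B by (auto simp: T_def U_def)
  qed
  (* T and U differ at most in the end points, a null set *)
  moreover have "T - U \<subseteq> {A, min B 1, 0, B - 1}"
  proof
    fix t assume t: "t \<in> T - U"
    then obtain s where s: "s \<in> {a..b}" "cis (2 * pi * t) = cis s" and t01: "0 \<le> t" "t < 1"
      using sub(2) by (auto simp: T_def)
    from s(2) obtain n :: int where "s = 2 * pi * t + 2 * pi * n"
      by (metis cis_eq_iff_shift)
    then have s_eq: "s = 2 * pi * (t + n)" by (simp add: algebra_simps)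
    define k where "k = n - m"
    have "A + m \<le> t + n" "t + n \<le> B + m" using s(1) by (auto simp: a b s_eq)
    then have k: "A \<le> t + k" "t + k \<le> B" by (auto simp: k_def)
    have "-1 < k" "k < 2" using k A B t01 by linarith+
    then have "k = 0 \<or> k = 1" by auto
    then show "t \<in> {A, min B 1, 0, B - 1}"
      using k t t01 A B by (auto simp: U_def)
  qed
  ultimately have "T = U \<union> (T - U)" and "finite (T - U)"
    by (auto intro: finite_subset)
  have "arc_length I = measure lebesgue T" by (simp add: arc_length_def T_def)
  also have "\<dots> = measure lebesgue (U \<union> (T - U))" using \<open>T = U \<union> (T - U)\<close> by simp
  also have "\<dots> = measure lebesgue U"
    using \<open>finite (T - U)\<close>
    by (intro measure_Un_null_set) (auto simp: U_def intro!: null_sets_completionI finite_imp_null_set_lborel)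
  also have "\<dots> = measure lebesgue {A<..<min B 1} + measure lebesgue {0<..<B - 1}"
    unfolding U_def using A B by (intro measure_Union) (cases "B \<le> 1"; auto)+
  also have "\<dots> = B - A"
    using A B by (cases "B \<le> 1") auto
  finally show ?thesis using BA by simp
qed

text \<open>The number \<open>c\<close> is the angle of the centre of \<open>I\<close>.  The open and the closed arc about it enclose \<open>I\<close>
  whichever of its end points belongs to \<open>I\<close>.\<close>
definition arc_angle :: "complex set \<Rightarrow> real \<Rightarrow> bool"
  where "arc_angle I c \<longleftrightarrow> cis ` {c - pi * arc_length I<..<c + pi * arc_length I} \<subseteq> I \<and>
    I \<subseteq> cis ` {c - pi * arc_length I..c + pi * arc_length I}"

definition arc_mid :: "complex set \<Rightarrow> complex"
  where "arc_mid I = cis (SOME c. arc_angle I c)"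

lemma half_open_arc_angle:
  assumes "half_open_arc I"
  shows "\<exists>c. arc_angle I c" "0 < arc_length I" "arc_length I \<le> 1"
proof -
  obtain a b where ab: "a < b" "b \<le> a + 2 * pi" and I: "I = cis ` {a..<b} \<or> I = cis ` {a<..b}"
    using assms by (auto simp: half_open_arc_def)
  have sub: "cis ` {a<..<b} \<subseteq> I" "I \<subseteq> cis ` {a..b}" using I by auto
  have l: "arc_length I = (b - a) / (2 * pi)" by (rule arc_length_eq[OF ab sub])
  show "0 < arc_length I" "arc_length I \<le> 1" using ab by (auto simp: l field_simps)
  have "(a + b) / 2 - pi * arc_length I = a" "(a + b) / 2 + pi * arc_length I = b"
    by (auto simp: l field_simps)
  then have "arc_angle I ((a + b) / 2)" using sub by (simp add: arc_angle_def)
  then show "\<exists>c. arc_angle I c" ..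
qed

lemma arc_midE:
  assumes "half_open_arc I"
  obtains c where "arc_mid I = cis c" "arc_angle I c"
  using someI_ex[OF half_open_arc_angle(1)[OF assms]] by (auto simp: arc_mid_def)

lemma norm_arc_mid [simp]: "norm (arc_mid I) = 1"
  by (simp add: arc_mid_def)

lemma half_open_arc_subset_circle: "half_open_arc I \<Longrightarrow> I \<subseteq> unit_circle"
  by (auto simp: half_open_arc_def)

lemma half_open_arc_borel:
  assumes "half_open_arc I"
  shows "I \<in> sets borel"
proof -
  obtain a b where ab: "a < b" and I: "I = cis ` {a..<b} \<or> I = cis ` {a<..b}"
    using assms by (auto simp: half_open_arc_def)
  have pos: "0 < 1 / real (Suc n)" for n by simp
  have "\<exists>n. x \<le> b - 1 / real (Suc n)" if x: "x < b" for x
  proof -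
    obtain n where "1 / real (Suc n) < b - x" using nat_approx_posE[of "b - x"] x by auto
    then show ?thesis by (intro exI[of _ n]) linarith
  qed
  moreover have "x < b" if "x \<le> b - 1 / real (Suc n)" for x n
    using that pos[of n] by linarith
  ultimately have 1: "{a..<b} = (\<Union>n. {a..b - 1 / real (Suc n)})"
    by (intro set_eqI) (simp del: of_nat_Suc, blast)
  have "\<exists>n. a + 1 / real (Suc n) \<le> x" if x: "a < x" for x
  proof -
    obtain n where "1 / real (Suc n) < x - a" using nat_approx_posE[of "x - a"] x by auto
    then show ?thesis by (intro exI[of _ n]) linarith
  qed
  moreover have "a < x" if "a + 1 / real (Suc n) \<le> x" for x n
    using that pos[of n] by linarith
  ultimately have 2: "{a<..b} = (\<Union>n. {a + 1 / real (Suc n)..b})"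
    by (intro set_eqI) (simp del: of_nat_Suc, blast)
  have "cis ` {u..v} \<in> sets borel" for u v
    by (intro borel_closed compact_imp_closed compact_continuous_image continuous_intros) auto
  then show ?thesis using I unfolding 1 2 image_UN by auto
qed

lemma arc_mid_in: "half_open_arc I \<Longrightarrow> arc_mid I \<in> I"
proof -
  assume I: "half_open_arc I"
  then obtain c where c: "arc_mid I = cis c" "arc_angle I c" by (rule arc_midE)
  have "c \<in> {c - pi * arc_length I<..<c + pi * arc_length I}"
    using half_open_arc_angle(2)[OF I] by simp
  then show ?thesis using c unfolding arc_angle_def by blast
qed

lemma norm_cis_diff_le: "norm (cis s - cis t) \<le> \<bar>s - t\<bar>"
proof -
  have "cis s - cis t = cis t * (cis (s - t) - 1)" by (simp add: cis_mult algebra_simps)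
  then have "norm (cis s - cis t) = norm (cis (s - t) - 1)" by (simp add: norm_mult)
  also have "\<dots> = 2 * \<bar>sin ((s - t) / 2)\<bar>" by (metis cis_conv_exp dist_exp_i_1)
  also have "\<dots> \<le> \<bar>s - t\<bar>" using abs_sin_x_le_abs_x[of "(s - t) / 2"] by simp
  finally show ?thesis .
qed

lemma norm_diff_arc_mid_le:
  assumes "half_open_arc I" "w \<in> I"
  shows "norm (w - arc_mid I) \<le> 4 * arc_length I"
proof -
  obtain c where c: "arc_mid I = cis c" "arc_angle I c" using assms(1) by (rule arc_midE)
  have "w \<in> cis ` {c - pi * arc_length I..c + pi * arc_length I}"
    using c(2) assms(2) unfolding arc_angle_def by blast
  then obtain t where t: "w = cis t" "\<bar>t - c\<bar> \<le> pi * arc_length I"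
    by (auto simp: abs_le_iff)
  have "norm (w - arc_mid I) \<le> pi * arc_length I"
    using norm_cis_diff_le[of t c] t c by simp
  also have "\<dots> \<le> 4 * arc_length I"
    using pi_less_4 half_open_arc_angle(2)[OF assms(1)] by (intro mult_right_mono) auto
  finally show ?thesis .
qed

lemma Q_upD:
  assumes "half_open_arc I" "z \<in> Q_up I"
  shows "1 - arc_length I \<le> norm z" "norm z < 1 - arc_length I / 2"
    and "norm (z - arc_mid I) \<le> 5 * arc_length I"
proof -
  obtain r t where z: "z = of_real r * cis t" "cis t \<in> I" "1 - arc_length I \<le> r" "r < 1 - arc_length I / 2"
    using assms(2) by (auto simp: Q_up_def)
  have r: "0 \<le> r" "r < 1" using z half_open_arc_angle(2,3)[OF assms(1)] by auto
  then have n: "norm z = r" by (simp add: z norm_mult)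
  show "1 - arc_length I \<le> norm z" "norm z < 1 - arc_length I / 2" using z n by auto
  have "z - arc_mid I = of_real (r - 1) * cis t + (cis t - arc_mid I)"
    by (simp add: z algebra_simps)
  then have "norm (z - arc_mid I) \<le> norm (of_real (r - 1) * cis t) + norm (cis t - arc_mid I)"
    by (metis norm_triangle_ineq)
  also have "norm (of_real (r - 1) * cis t) = 1 - r"
    using r by (simp only: norm_mult norm_of_real norm_cis) simp
  finally show "norm (z - arc_mid I) \<le> 5 * arc_length I"
    using norm_diff_arc_mid_le[OF assms(1) z(2)] z by simp
qed

text \<open>The box is the preimage of a Borel set under \<open>z \<mapsto> (sgn z, norm z)\<close>, except that for the full circle
  it also contains the origin, where \<open>sgn\<close> is not continuous.\<close>
lemma Q_up_measurable:
  assumes "half_open_arc I"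
  shows "Q_up I \<in> sets borel"
proof -
  have l: "0 < arc_length I" "arc_length I \<le> 1" using half_open_arc_angle[OF assms] by auto
  have "Q_up I = {z. z \<noteq> 0 \<and> sgn z \<in> I \<and> 1 - arc_length I \<le> norm z \<and> norm z < 1 - arc_length I / 2}
      \<union> (if arc_length I = 1 then {0} else {})" (is "_ = ?A \<union> ?B")
  proof (intro subset_antisym subsetI)
    fix z assume z: "z \<in> Q_up I"
    then obtain r t where zr: "z = of_real r * cis t" "cis t \<in> I" "1 - arc_length I \<le> r" "r < 1 - arc_length I / 2"
      by (auto simp: Q_up_def)
    have "r \<ge> 0" using zr l by auto
    then show "z \<in> ?A \<union> ?B"
      using zr l Q_upD[OF assms z] by (cases "r = 0") (auto simp: sgn_mult sgn_cis sgn_of_real)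
  next
    fix z assume z: "z \<in> ?A \<union> ?B"
    show "z \<in> Q_up I"
    proof (cases "z = 0")
      case True
      then have "arc_length I = 1" using z by (auto split: if_splits)
      moreover obtain c where "arc_mid I = cis c" using assms by (rule arc_midE)
      then have "cis c \<in> I" using arc_mid_in[OF assms] by simp
      ultimately show ?thesis using True by (auto simp: Q_up_def)
    next
      case False
      then have A: "z \<in> ?A" using z by (auto split: if_splits)
      then have "z = of_real (norm z) * cis (Arg z)" "sgn z = cis (Arg z)"
        using False by (auto simp: cis_Arg sgn_div_norm scaleR_conv_of_real)
      then show ?thesis using A unfolding Q_up_def by force
    qed
  qed
  moreover have "?A = ({z. z \<noteq> 0} \<inter> sgn -` I) \<inter> {z. 1 - arc_length I \<le> norm z} \<inter> {z. norm z < 1 - arc_length I / 2}"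
    by auto
  moreover have "{z::complex. z \<noteq> 0} \<inter> sgn -` I \<in> sets borel"
  proof -
    have o: "{z::complex. z \<noteq> 0} \<in> sets borel" by (intro borel_open) (auto simp: open_Collect_neq)
    have "sgn \<in> borel_measurable (restrict_space borel {z::complex. z \<noteq> 0})"
      by (intro borel_measurable_continuous_on_restrict continuous_intros) auto
    from measurable_sets[OF this half_open_arc_borel[OF assms]]
    show ?thesis using o by (simp add: sets_restrict_space_iff space_restrict_space Int_commute)
  qed
  moreover have "{z::complex. 1 - arc_length I \<le> norm z} \<in> sets borel" "{z::complex. norm z < 1 - arc_length I / 2} \<in> sets borel"
    by measurable
  ultimately show ?thesis by (auto intro!: sets.Un sets.Int)
qed

text \<open>A ball of radius comparable to the side of the box, about its centre.  It replaces the area of the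
  box itself in packing arguments.\<close>
lemma ball_subset_Q_up:
  assumes "half_open_arc I"
  shows "ball (of_real (1 - 3/4 * arc_length I) * arc_mid I) (arc_length I / 10) \<subseteq> Q_up I"
proof
  fix w assume w: "w \<in> ball (of_real (1 - 3/4 * arc_length I) * arc_mid I) (arc_length I / 10)"
  obtain c where c: "arc_mid I = cis c" "arc_angle I c" using assms by (rule arc_midE)
  define l where "l = arc_length I"
  have l: "0 < l" "l \<le> 1" using half_open_arc_angle[OF assms] by (auto simp: l_def)
  define v where "v = w * cis (-c)"
  have wv: "w = v * cis c" by (simp add: v_def cis_mult mult.assoc)
  have "norm (of_real (1 - 3/4 * l) * cis c - w) < l / 10"
    using w c by (simp add: dist_norm l_def)
  also have "of_real (1 - 3/4 * l) * cis c - w = (of_real (1 - 3/4 * l) - v) * cis c"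
    by (simp add: wv algebra_simps)
  finally have d: "norm (of_real (1 - 3/4 * l) - v) < l / 10" by (simp only: norm_mult norm_cis mult_1_right)
  have re: "\<bar>1 - 3/4 * l - Re v\<bar> < l / 10" and im: "\<bar>Im v\<bar> < l / 10"
    using abs_Re_le_cmod[of "of_real (1 - 3/4 * l) - v"] abs_Im_le_cmod[of "of_real (1 - 3/4 * l) - v"] d by auto
  have nv: "\<bar>1 - 3/4 * l - norm v\<bar> < l / 10"
    using norm_triangle_ineq3[of "of_real (1 - 3/4 * l)" v] d l by (simp add: norm_of_real del: of_real_diff of_real_mult)
  have re0: "Re v > 3/20" using re l by linarith
  have arg: "Arg v = arctan (Im v / Re v)" using re0 by (intro arg_conv_arctan) auto
  have "\<bar>Arg v\<bar> \<le> \<bar>Im v / Re v\<bar>" unfolding arg by (rule abs_arctan_le)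
  also have "\<dots> \<le> (l / 10) / (3/20)"
    using re0 im by (simp only: abs_divide) (intro frac_le; simp)
  also have "\<dots> < pi * l" using pi_ge_two l by (simp add: mult_strict_right_mono)
  finally have "cis (c + Arg v) \<in> I"
    using c(2) by (auto simp: arc_angle_def l_def abs_less_iff)
  moreover have "w = of_real (norm v) * cis (c + Arg v)"
    using rcis_cmod_Arg[of v] by (simp add: wv rcis_def cis_mult[symmetric] mult_ac)
  moreover have "1 - l \<le> norm v" "norm v < 1 - l / 2" using nv l by linarith+
  ultimately show "w \<in> Q_up I" unfolding Q_up_def l_def by blast
qed

lemma dyadic_scale:
  fixes s :: real
  assumes s: "0 < s" "s \<le> 1"
  shows "\<exists>k. s \<le> 1 / 2 ^ k \<and> 1 / 2 ^ k < 2 * s"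
proof -
  define k where "k = nat \<lfloor>log 2 (1 / s)\<rfloor>"
  have "0 \<le> log 2 (1 / s)" using s by (subst zero_le_log_cancel_iff) auto
  then have k: "real k \<le> log 2 (1 / s)" "log 2 (1 / s) < real (Suc k)"
    unfolding k_def by linarith+
  have "2 powr real k \<le> 1 / s" using k(1) s by (simp add: le_log_iff)
  then have "s \<le> 1 / 2 ^ k" using s by (simp add: powr_realpow field_simps)
  moreover have "1 / s < 2 powr real (Suc k)" using k(2) s by (subst log_less_iff[symmetric]) auto
  then have "1 / 2 ^ k < 2 * s" using s by (simp only: powr_realpow) (simp add: field_simps)
  ultimately show ?thesis by blast
qed

text \<open>The generations are a parameter of their own: a dyadic system is a mere set of arcs, for which suitable
  generations exist.\<close>
locale dyadic_arcs =
  fixes Dy :: "complex set set" and D :: "nat \<Rightarrow> complex set set"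
  assumes Dy_eq: "Dy = (\<Union>k. D k)"
    and D_0: "D 0 = {unit_circle}"
    and D_partition: "partition_on unit_circle (D k)"
    and D_card: "card (D k) = 2 ^ k"
    and D_arc: "I \<in> D k \<Longrightarrow> half_open_arc I"
    and D_length: "I \<in> D k \<Longrightarrow> arc_length I = 1 / 2 ^ k"
    and D_Suc: "I \<in> D (Suc k) \<Longrightarrow> \<exists>J\<in>D k. I \<subseteq> J"

lemma dyadic_systemE:
  assumes "dyadic_system Dy"
  obtains D where "dyadic_arcs Dy D"
proof -
  obtain D where "Dy = (\<Union>k. D k)" "D 0 = {unit_circle}"
    and *: "\<forall>k. partition_on unit_circle (D k) \<and> card (D k) = 2 ^ k \<and>
            (\<forall>I\<in>D k. half_open_arc I \<and> arc_length I = 1 / 2 ^ k)"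
    and "\<forall>k. \<forall>I\<in>D (Suc k). \<exists>J\<in>D k. I \<subseteq> J"
    using assms unfolding dyadic_system_def by metis
  then have "dyadic_arcs Dy D" by unfold_locales (use * in simp_all)
  then show ?thesis by (rule that)
qed

context dyadic_arcs
begin

lemma finite_D [simp]: "finite (D k)"
  using D_card[of k] by (intro card_ge_0_finite) simp

lemma countable_Dy: "countable Dy"
  unfolding Dy_eq using countable_finite[OF finite_D] by (intro countable_UN) auto

lemma Dy_arc: "I \<in> Dy \<Longrightarrow> half_open_arc I"
  by (auto simp: Dy_eq D_arc)

lemma arc_length_pos: "I \<in> Dy \<Longrightarrow> 0 < arc_length I"
  and arc_length_le_1: "I \<in> Dy \<Longrightarrow> arc_length I \<le> 1"
  using half_open_arc_angle Dy_arc by auto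

lemma circle_in_Dy: "unit_circle \<in> Dy"
  using D_0 by (auto simp: Dy_eq)

lemma subset_circle: "I \<in> Dy \<Longrightarrow> I \<subseteq> unit_circle"
  by (simp add: Dy_arc half_open_arc_subset_circle)

lemma nonempty: "I \<in> Dy \<Longrightarrow> I \<noteq> {}"
  using D_partition by (auto simp: Dy_eq partition_on_def)

lemma ancestor:
  assumes "I \<in> D k" "j \<le> k"
  shows "\<exists>J\<in>D j. I \<subseteq> J"
  using assms
proof (induction k arbitrary: I)
  case (Suc k)
  show ?case
  proof (cases "j = Suc k")
    case False
    obtain J where "J \<in> D k" "I \<subseteq> J" using D_Suc Suc.prems(1) by blast
    moreover have "j \<le> k" using Suc.prems(2) False by simp
    ultimately show ?thesis using Suc.IH[of J] by blast
  qed (use Suc.prems in auto)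
qed auto

lemma D_disjoint: "I \<in> D k \<Longrightarrow> J \<in> D k \<Longrightarrow> I \<noteq> J \<Longrightarrow> I \<inter> J = {}"
  using D_partition[of k] by (auto simp: partition_on_def disjoint_def)

lemma laminar:
  assumes "I \<in> Dy" "J \<in> Dy"
  shows "I \<subseteq> J \<or> J \<subseteq> I \<or> I \<inter> J = {}"
proof -
  have *: "I \<subseteq> J \<or> I \<inter> J = {}" if "I \<in> D k" "J \<in> D j" "j \<le> k" for I J k j
    using ancestor[OF that(1,3)] D_disjoint[OF that(2)] by blast
  obtain k j where "I \<in> D k" "J \<in> D j" using assms by (auto simp: Dy_eq)
  then show ?thesis using *[of I k J j] *[of J j I k] by (cases "j \<le> k") auto
qed

lemma length_mono:
  assumes "I \<in> Dy" "J \<in> Dy" "I \<subseteq> J"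
  shows "arc_length I \<le> arc_length J"
proof -
  obtain k j where kj: "I \<in> D k" "J \<in> D j" using assms by (auto simp: Dy_eq)
  have "j \<le> k"
  proof (rule ccontr)
    assume "\<not> j \<le> k"
    then obtain K where K: "K \<in> D k" "J \<subseteq> K" using ancestor[OF kj(2), of k] by auto
    then have "K = I" using D_disjoint[OF K(1) kj(1)] assms nonempty[of I] by auto
    then have "J = I" using K assms by auto
    then have "(1::real) / 2 ^ j = 1 / 2 ^ k" using kj D_length by metis
    then show False using \<open>\<not> j \<le> k\<close> by simp
  qed
  then show ?thesis using D_length kj by (simp add: frac_le)
qed

lemma finite_ancestors: "I \<in> Dy \<Longrightarrow> finite {J \<in> Dy. I \<subseteq> J}"
proof -
  assume I: "I \<in> Dy"
  then obtain k where k: "I \<in> D k" by (auto simp: Dy_eq)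
  have "{J \<in> Dy. I \<subseteq> J} \<subseteq> (\<Union>j\<le>k. D j)"
  proof
    fix J assume J: "J \<in> {J \<in> Dy. I \<subseteq> J}"
    then obtain j where j: "J \<in> D j" by (auto simp: Dy_eq)
    have "(1::real) / 2 ^ k \<le> 1 / 2 ^ j" using length_mono[OF I, of J] J D_length[OF k] D_length[OF j] by simp
    then have "(2::real) ^ j \<le> 2 ^ k" by (simp add: field_simps)
    then show "J \<in> (\<Union>j\<le>k. D j)" using j by auto
  qed
  then show ?thesis by (rule finite_subset) auto
qed

lemma Q_up_disjoint:
  assumes "I \<in> Dy" "J \<in> Dy" "I \<noteq> J"
  shows "Q_up I \<inter> Q_up J = {}"
proof (rule ccontr)
  assume "Q_up I \<inter> Q_up J \<noteq> {}"
  then obtain z where z: "z \<in> Q_up I" "z \<in> Q_up J" by auto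
  obtain k j where kj: "I \<in> D k" "J \<in> D j" using assms by (auto simp: Dy_eq)
  have b: "1 - 1 / 2 ^ k \<le> norm z" "norm z < 1 - 1 / 2 ^ k / 2"
     "1 - 1 / 2 ^ j \<le> norm z" "norm z < 1 - 1 / 2 ^ j / 2"
    using Q_upD[OF Dy_arc[OF assms(1)] z(1)] Q_upD[OF Dy_arc[OF assms(2)] z(2)] D_length[OF kj(1)] D_length[OF kj(2)]
    by auto
  have "\<not> k < j" if "1 - (1::real) / 2 ^ j \<le> norm z" "norm z < 1 - 1 / 2 ^ k / 2" for k j
  proof
    assume "k < j"
    then have "(2::real) ^ Suc k \<le> 2 ^ j" by (intro power_increasing) auto
    then have "(1::real) / 2 ^ j \<le> 1 / 2 ^ Suc k" by (intro divide_left_mono) auto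
    then show False using that by simp
  qed
  then have "k = j" using b by (meson linorder_neqE_nat)
  then have IJ: "I \<inter> J = {}" using D_disjoint kj assms(3) by auto
  obtain r t where r: "z = of_real r * cis t" "cis t \<in> I" "1 - arc_length I \<le> r" "r < 1 - arc_length I / 2"
    using z by (auto simp: Q_up_def)
  obtain s u where s: "z = of_real s * cis u" "cis u \<in> J" "1 - arc_length J \<le> s" "s < 1 - arc_length J / 2"
    using z by (auto simp: Q_up_def)
  have "r \<ge> 0" "s \<ge> 0" using r s arc_length_le_1 assms by (smt (verit))+
  have "norm z = \<bar>r\<bar>" "norm z = \<bar>s\<bar>"
    using arg_cong[OF r(1), of norm] arg_cong[OF s(1), of norm] by (simp_all add: norm_mult)
  with \<open>r \<ge> 0\<close> \<open>s \<ge> 0\<close> have rs: "r = norm z" "s = norm z" by simp_all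
  show False
  proof (cases "norm z = 0")
    case True
    then have "arc_length I = 1" using r(3) rs(1) arc_length_le_1[OF assms(1)] by simp
    then have "(2::real) ^ k = 1" using D_length[OF kj(1)] by simp
    then have "k = 0" using one_less_power[of "2::real" k] by (cases "k = 0") auto
    then show False using kj D_0 assms \<open>k = j\<close> by auto
  next
    case False
    then have "r = s" "r \<noteq> 0" using rs by simp_all
    moreover have "of_real r * cis t = of_real s * cis u" using r(1) s(1) by metis
    ultimately have "cis t = cis u" by simp
    then show False using IJ r(2) s(2) by auto
  qed
qed

lemma Q_up_cover:
  assumes "z \<in> unit_disc"
  shows "\<exists>I\<in>Dy. z \<in> Q_up I"
proof -
  have z: "norm z < 1" using assms by simp
  then obtain k where 1: "1 - norm z \<le> 1 / 2 ^ k" and 2: "1 / 2 ^ k < 2 * (1 - norm z)"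
    using dyadic_scale[of "1 - norm z"] by auto
  have "cis (Arg z) \<in> unit_circle" by simp
  then obtain I where I: "I \<in> D k" "cis (Arg z) \<in> I" using D_partition[of k] unfolding partition_on_def by blast
  have "z = of_real (norm z) * cis (Arg z)" using rcis_cmod_Arg[of z] by (simp add: rcis_def)
  then have "z \<in> Q_up I" using I 1 2 D_length[OF I(1)] unfolding Q_up_def by force
  then show ?thesis using I by (auto simp: Dy_eq)
qed

text \<open>The boxes \<open>Q_up I\<close> are disjoint and each contains a ball of radius \<open>arc_length I / 10\<close>; the hypothesis
  places all these balls in \<open>ball w r\<close>, and their areas add up to at most that of \<open>ball w r\<close>.\<close>
lemma packing:
  assumes S: "finite S" "S \<subseteq> Dy" and r: "0 \<le> r"
    and near: "\<And>I. I \<in> S \<Longrightarrow> norm (arc_mid I - w) + arc_length I \<le> r"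
  shows "(\<Sum>I\<in>S. (arc_length I)\<^sup>2) \<le> 100 * r\<^sup>2"
proof -
  define B where "B I = ball (of_real (1 - 3/4 * arc_length I) * arc_mid I) (arc_length I / 10)" for I
  have "B I \<inter> B J = {}" if "I \<in> S" "J \<in> S" "I \<noteq> J" for I J
    using ball_subset_Q_up[OF Dy_arc, of I] ball_subset_Q_up[OF Dy_arc, of J] Q_up_disjoint[of I J] that S(2)
    unfolding B_def by blast
  then have disj: "disjoint_family_on B S" by (auto simp: disjoint_family_on_def)
  have sub: "B I \<subseteq> ball w r" if "I \<in> S" for I
  proof
    fix v assume v: "v \<in> B I"
    have l: "0 < arc_length I" using arc_length_pos that S(2) by auto
    have e: "of_real (1 - 3/4 * arc_length I) * arc_mid I - arc_mid I = - (of_real (3/4 * arc_length I) * arc_mid I)"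
      by (simp add: algebra_simps)
    have "norm (of_real (1 - 3/4 * arc_length I) * arc_mid I - arc_mid I) = 3/4 * arc_length I"
      unfolding e norm_minus_cancel norm_mult norm_of_real using l by simp
    moreover have "norm (of_real (1 - 3/4 * arc_length I) * arc_mid I - v) < arc_length I / 10"
      using v by (simp add: B_def dist_norm)
    moreover have "norm (v - w) \<le> norm (x - v) + norm (x - m) + norm (m - w)" for x m
      using norm_triangle_ineq[of "v - x" "x - w"] norm_triangle_ineq[of "x - m" "m - w"]
      by (simp add: norm_minus_commute)
    ultimately have "norm (v - w) < arc_length I / 10 + 3/4 * arc_length I + norm (arc_mid I - w)"
      by (smt (verit, best))
    then have "norm (v - w) < norm (arc_mid I - w) + arc_length I" using l by simp
    then show "v \<in> ball w r" using near[OF that] by (simp add: dist_norm norm_minus_commute)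
  qed
  have "ennreal (\<Sum>I\<in>S. pi * (arc_length I / 10)\<^sup>2) = (\<Sum>I\<in>S. emeasure lborel (B I))"
    using arc_length_pos S(2) unfolding B_def
    by (subst sum_ennreal[symmetric]) (auto simp: emeasure_lborel_ball_complex less_imp_le subset_iff intro!: sum.cong)
  also have "\<dots> = emeasure lborel (\<Union>I\<in>S. B I)"
    by (intro sum_emeasure disj S) (auto simp: B_def)
  also have "\<dots> \<le> emeasure lborel (ball w r)"
    using sub by (intro emeasure_mono) auto
  also have "\<dots> = ennreal (pi * r\<^sup>2)" using r by (rule emeasure_lborel_ball_complex)
  finally have "(\<Sum>I\<in>S. pi * (arc_length I / 10)\<^sup>2) \<le> pi * r\<^sup>2" by simp
  also have "(\<Sum>I\<in>S. pi * (arc_length I / 10)\<^sup>2) = pi * ((\<Sum>I\<in>S. (arc_length I)\<^sup>2) / 100)"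
    by (simp add: sum_distrib_left sum_divide_distrib power_divide)
  finally show ?thesis by simp
qed

lemma norm_arc_mid_diff_le:
  assumes "I \<in> Dy" "J \<in> Dy" "I \<subseteq> J"
  shows "norm (arc_mid I - arc_mid J) \<le> 4 * arc_length J"
  using norm_diff_arc_mid_le[OF Dy_arc[OF assms(2)]] arc_mid_in[OF Dy_arc[OF assms(1)]] assms(3) by auto

end

section \<open>Linear programming duality on laminar families\<close>

text \<open>A feasible point \<open>x\<close> of the dual program and a cover \<open>l\<close> (supported on the finite set \<open>F\<close>) of at most the
  same value.  The disjoint family \<open>T\<close> of sets for which the constraint is an equality, and
  which covers \<open>S\<close>, is what makes the induction work.\<close>
definition optimal_pair ::
    "'a set set \<Rightarrow> ('a set \<Rightarrow> real) \<Rightarrow> ('a set \<Rightarrow> real) \<Rightarrow> 'a set set \<Rightarrow>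
      ('a set \<Rightarrow> real) \<Rightarrow> ('a set \<Rightarrow> real) \<Rightarrow> 'a set set \<Rightarrow> 'a set set \<Rightarrow> bool"
  where "optimal_pair A w h S x l T F \<longleftrightarrow>
      (\<forall>I. 0 \<le> x I) \<and> (\<forall>J\<in>A. (\<Sum>I\<in>{I\<in>S. I \<subseteq> J}. x I) \<le> w J) \<and>
      finite T \<and> T \<subseteq> A \<and> disjoint T \<and> (\<forall>I\<in>S. \<exists>J\<in>T. I \<subseteq> J) \<and>
      (\<forall>J\<in>T. (\<Sum>I\<in>{I\<in>S. I \<subseteq> J}. x I) = w J) \<and>
      finite F \<and> F \<subseteq> A \<and> (\<forall>J. 0 \<le> l J) \<and> (\<forall>J. J \<notin> F \<longrightarrow> l J = 0) \<and>
      (\<forall>I\<in>S. h I \<le> (\<Sum>J\<in>{J\<in>A. I \<subseteq> J}. l J)) \<and>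
      (\<Sum>J\<in>F. l J * w J) \<le> (\<Sum>I\<in>S. h I * x I)"

text \<open>Greedy algorithm: the elements of \<open>S\<close> are processed in order of decreasing \<open>h\<close>, and \<open>x\<close> is made as
  large as the constraints permit.  A new element \<open>y\<close> is therefore contained in a set for
  which the constraint is tight.  Since the family is laminar, a disjoint family \<open>T'\<close> of tight sets above all
  processed elements can be kept, and its total weight is the total of \<open>x\<close>.  Lowering the level from \<open>h y\<close> to \<open>m\<close> and adding \<open>h y - m\<close> to
  \<open>l\<close> on \<open>T'\<close> therefore increases the cost of the cover and the value of \<open>x\<close> by the same amount.  For
  this, the statement has to speak of \<open>h - m\<close> for every \<open>m\<close> below \<open>h\<close>.\<close>
lemma laminar_greedy_duality:
  fixes A :: "'a set set" and w h :: "'a set \<Rightarrow> real"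
  assumes lam: "\<And>I J. I \<in> A \<Longrightarrow> J \<in> A \<Longrightarrow> I \<subseteq> J \<or> J \<subseteq> I \<or> I \<inter> J = {}"
    and ne: "{} \<notin> A"
    and fin: "\<And>I. I \<in> A \<Longrightarrow> finite {J \<in> A. I \<subseteq> J}"
    and w: "\<And>J. J \<in> A \<Longrightarrow> 0 \<le> w J"
    and S: "finite S" "S \<subseteq> A"
  shows "(\<forall>I\<in>S. m \<le> h I) \<longrightarrow> (\<exists>x l T F. optimal_pair A w (\<lambda>I. h I - m) S x l T F)"
  using S(1,2)
proof (induction S arbitrary: m rule: finite_ranking_induct[where f = "\<lambda>I. - h I"])
  case empty
  show ?case
    by (rule impI, rule exI[of _ "\<lambda>_. 0"], rule exI[of _ "\<lambda>_. 0"], rule exI[of _ "{}"], rule exI[of _ "{}"])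
       (use w in \<open>auto simp: disjoint_def optimal_pair_def\<close>)
next
  case (insert y S)
  show ?case
  proof (cases "y \<in> S")
    case True
    then show ?thesis using insert.IH insert.prems by (simp add: insert_absorb)
  next
    case y: False
    show ?thesis
    proof
      assume m: "\<forall>I\<in>insert y S. m \<le> h I"
      have yA: "y \<in> A" and SA: "S \<subseteq> A" using insert.prems by auto
      have "\<forall>I\<in>S. h y \<le> h I" using insert.hyps(2) by auto
      then obtain x l T F where st: "optimal_pair A w (\<lambda>I. h I - h y) S x l T F"
        using insert.IH[OF SA, of "h y"] by blast
      then have
        x0: "\<And>I. 0 \<le> x I" and feas: "\<And>J. J \<in> A \<Longrightarrow> (\<Sum>I\<in>{I\<in>S. I \<subseteq> J}. x I) \<le> w J"
        and T: "finite T" "T \<subseteq> A" "disjoint T" and Tcov: "\<And>I. I \<in> S \<Longrightarrow> \<exists>J\<in>T. I \<subseteq> J"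
        and tight: "\<And>J. J \<in> T \<Longrightarrow> (\<Sum>I\<in>{I\<in>S. I \<subseteq> J}. x I) = w J"
        and F: "finite F" "F \<subseteq> A" and l0: "\<And>J. 0 \<le> l J" and lF: "\<And>J. J \<notin> F \<Longrightarrow> l J = 0"
        and cov: "\<And>I. I \<in> S \<Longrightarrow> h I - h y \<le> (\<Sum>J\<in>{J\<in>A. I \<subseteq> J}. l J)"
        and cost: "(\<Sum>J\<in>F. l J * w J) \<le> (\<Sum>I\<in>S. (h I - h y) * x I)"
        by (simp_all add: optimal_pair_def)
      define slack where "slack J = w J - (\<Sum>I\<in>{I\<in>S. I \<subseteq> J}. x I)" for J
      (* the largest value that the constraints above y leave for x y, attained at J0 *)
      define anc where "anc = {J \<in> A. y \<subseteq> J}"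
      have anc: "finite anc" "anc \<noteq> {}" using fin[OF yA] yA by (auto simp: anc_def)
      define \<delta> where "\<delta> = Min (slack ` anc)"
      have "\<delta> \<in> slack ` anc" using anc by (auto simp: \<delta>_def)
      then obtain J0 where J0: "J0 \<in> A" "y \<subseteq> J0" "\<delta> = slack J0" by (auto simp: anc_def)
      have \<delta>_le: "\<delta> \<le> slack J" if "J \<in> A" "y \<subseteq> J" for J
        using anc that by (auto simp: \<delta>_def anc_def)
      have \<delta>0: "0 \<le> \<delta>" using J0 feas by (simp add: slack_def)
      define x' where "x' = x(y := \<delta>)"
      have mass: "(\<Sum>I\<in>{I\<in>insert y S. I \<subseteq> J}. x' I) = (\<Sum>I\<in>{I\<in>S. I \<subseteq> J}. x I) + (if y \<subseteq> J then \<delta> else 0)" for J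
      proof -
        have "(\<Sum>I\<in>{I\<in>S. I \<subseteq> J}. x' I) = (\<Sum>I\<in>{I\<in>S. I \<subseteq> J}. x I)"
          using y by (intro sum.cong) (auto simp: x'_def)
        moreover have "{I\<in>insert y S. I \<subseteq> J} = (if y \<subseteq> J then insert y {I\<in>S. I \<subseteq> J} else {I\<in>S. I \<subseteq> J})"
          by auto
        ultimately show ?thesis using y insert.hyps(1) by (simp add: x'_def)
      qed
      have feas': "(\<Sum>I\<in>{I\<in>insert y S. I \<subseteq> J}. x' I) \<le> w J" if "J \<in> A" for J
        using feas[OF that] \<delta>_le[OF that] unfolding mass by (auto simp: slack_def)
      obtain T' where T': "finite T'" "T' \<subseteq> A" "disjoint T'"
        and Tcov': "\<And>I. I \<in> insert y S \<Longrightarrow> \<exists>J\<in>T'. I \<subseteq> J"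
        and tight': "\<And>J. J \<in> T' \<Longrightarrow> (\<Sum>I\<in>{I\<in>insert y S. I \<subseteq> J}. x' I) = w J"
      proof (cases "\<exists>J\<in>T. y \<subseteq> J")
        case True
        (* y lies below a tight set, so nothing is left for it *)
        then obtain J where J: "J \<in> T" "y \<subseteq> J" by auto
        have "\<delta> = 0" using \<delta>0 \<delta>_le[of J] J T(2) tight[of J] by (auto simp: slack_def)
        then have "(\<Sum>I\<in>{I\<in>insert y S. I \<subseteq> J}. x' I) = w J" if "J \<in> T" for J
          using tight[OF that] unfolding mass by simp
        then show ?thesis using T Tcov True by (intro that[of T]) auto
      next
        case False
        (* J0 becomes tight and absorbs the tight sets that it contains *)
        define T' where "T' = insert J0 {J\<in>T. \<not> J \<subseteq> J0}"
        have "J0 \<inter> J = {}" if "J \<in> T" "\<not> J \<subseteq> J0" for J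
          using lam[of J0 J] that J0 T(2) False by blast
        then have "disjoint T'" using T(3) unfolding T'_def disjoint_def by blast
        moreover have "\<exists>J\<in>T'. I \<subseteq> J" if "I \<in> insert y S" for I
          using that Tcov[of I] J0(2) unfolding T'_def by blast
        moreover have "(\<Sum>I\<in>{I\<in>insert y S. I \<subseteq> J}. x' I) = w J" if "J \<in> T'" for J
          unfolding mass using that tight[of J] J0 False by (auto simp: T'_def slack_def)
        ultimately show ?thesis using T J0 by (intro that[of T']) (auto simp: T'_def)
      qed
      define d where "d = h y - m"
      have d0: "0 \<le> d" using m by (simp add: d_def)
      have Tsum: "(\<Sum>J\<in>T'. w J) = (\<Sum>I\<in>insert y S. x' I)"
      proof -
        have "(\<Sum>J\<in>T'. w J) = (\<Sum>J\<in>T'. \<Sum>I\<in>{I\<in>insert y S. I \<subseteq> J}. x' I)"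
          by (intro sum.cong refl) (simp only: tight')
        also have "\<dots> = sum x' (\<Union>J\<in>T'. {I\<in>insert y S. I \<subseteq> J})"
        proof (rule sum.UNION_disjoint[symmetric])
          show "\<forall>i\<in>T'. \<forall>j\<in>T'. i \<noteq> j \<longrightarrow> {I \<in> insert y S. I \<subseteq> i} \<inter> {I \<in> insert y S. I \<subseteq> j} = {}"
          proof (intro ballI impI)
            fix i j assume "i \<in> T'" "j \<in> T'" "i \<noteq> j"
            then have "i \<inter> j = {}" using T'(3) by (auto simp: disjoint_def)
            then have "I = {}" if "I \<subseteq> i" "I \<subseteq> j" for I using that by blast
            moreover have "{} \<notin> insert y S" using ne insert.prems by blast
            ultimately show "{I \<in> insert y S. I \<subseteq> i} \<inter> {I \<in> insert y S. I \<subseteq> j} = {}" by blast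
          qed
        qed (use T' insert.hyps in auto)
        also have "(\<Union>J\<in>T'. {I\<in>insert y S. I \<subseteq> J}) = insert y S" using Tcov' by blast
        finally show ?thesis .
      qed
      define l' where "l' J = l J + (if J \<in> T' then d else 0)" for J
      have ll': "l J \<le> l' J" for J using d0 by (simp add: l'_def)
      have l'0: "0 \<le> l' J" for J using l0[of J] ll'[of J] by linarith
      have cov': "h I - m \<le> (\<Sum>J\<in>{J\<in>A. I \<subseteq> J}. l' J)" if I: "I \<in> insert y S" for I
      proof -
        have finI: "finite {J\<in>A. I \<subseteq> J}" using I insert.prems by (intro fin) auto
        obtain J where J: "J \<in> T'" "I \<subseteq> J" using Tcov'[OF I] by auto
        have "h I - h y \<le> (\<Sum>J\<in>{J\<in>A. I \<subseteq> J}. l J)"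
          using cov[of I] I l0 by (cases "I = y") (auto intro: sum_nonneg)
        moreover have "d \<le> (\<Sum>J\<in>{J\<in>A. I \<subseteq> J}. if J \<in> T' then d else 0)"
          using member_le_sum[of J "{J\<in>A. I \<subseteq> J}" "\<lambda>J. if J \<in> T' then d else 0"] J T' finI d0 by auto
        ultimately show ?thesis by (simp add: l'_def sum.distrib d_def)
      qed
      have "(\<Sum>J\<in>F \<union> T'. l' J * w J) = (\<Sum>J\<in>F \<union> T'. l J * w J) + (\<Sum>J\<in>F \<union> T'. (if J \<in> T' then d * w J else 0))"
        by (auto simp: l'_def algebra_simps sum.distrib[symmetric] intro!: sum.cong)
      also have "(\<Sum>J\<in>F \<union> T'. l J * w J) = (\<Sum>J\<in>F. l J * w J)"
        using F T' lF by (intro sum.mono_neutral_right) auto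
      also have "(\<Sum>J\<in>F \<union> T'. (if J \<in> T' then d * w J else 0)) = (\<Sum>J\<in>T'. d * w J)"
        using F T' by (subst sum.inter_restrict[symmetric]) (auto intro!: sum.cong)
      also have "\<dots> = d * (\<Sum>I\<in>insert y S. x' I)" by (simp add: sum_distrib_left[symmetric] Tsum)
      also have "\<dots> = d * \<delta> + d * (\<Sum>I\<in>S. x I)"
      proof -
        have "(\<Sum>I\<in>S. x' I) = (\<Sum>I\<in>S. x I)" using y by (intro sum.cong) (auto simp: x'_def)
        then show ?thesis using y insert.hyps(1) by (simp add: x'_def distrib_left)
      qed
      also have "(\<Sum>J\<in>F. l J * w J) + (d * \<delta> + d * (\<Sum>I\<in>S. x I))
          \<le> (\<Sum>I\<in>S. (h I - h y) * x I) + (d * \<delta> + d * (\<Sum>I\<in>S. x I))"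
        using cost by simp
      also have "\<dots> = (\<Sum>I\<in>S. (h I - m) * x I) + d * \<delta>"
        by (simp add: d_def sum_distrib_left sum.distrib[symmetric] algebra_simps)
      also have "\<dots> = (\<Sum>I\<in>insert y S. (h I - m) * x' I)"
      proof -
        have "(\<Sum>I\<in>S. (h I - m) * x' I) = (\<Sum>I\<in>S. (h I - m) * x I)"
          using y by (intro sum.cong) (auto simp: x'_def)
        then show ?thesis using y insert.hyps(1) by (simp add: x'_def d_def)
      qed
      finally have cost': "(\<Sum>J\<in>F \<union> T'. l' J * w J) \<le> (\<Sum>I\<in>insert y S. (h I - m) * x' I)" .
      have x'0: "\<And>I. 0 \<le> x' I" using x0 \<delta>0 by (simp add: x'_def)
      have l'F: "\<And>J. J \<notin> F \<union> T' \<Longrightarrow> l' J = 0" using lF by (auto simp: l'_def)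
      have "optimal_pair A w (\<lambda>I. h I - m) (insert y S) x' l' T' (F \<union> T')"
        unfolding optimal_pair_def using x'0 feas' T' Tcov' tight' l'0 l'F cov' cost' F by simp
      then show "\<exists>x l T F. optimal_pair A w (\<lambda>I. h I - m) (insert y S) x l T F" by blast
    qed
  qed
qed

lemma compact_real_box: "compact {l :: 'a \<Rightarrow> real. \<forall>i. l i \<in> {0..b i}}"
proof -
  have "compactin (product_topology (\<lambda>_. euclidean) UNIV) (PiE UNIV (\<lambda>i. {0..b i}))"
    by (simp add: compactin_PiE)
  moreover have "PiE UNIV (\<lambda>i. {0..b i}) = {l. \<forall>i. l i \<in> {0..b i}}" by (auto simp: PiE_def)
  ultimately have "compactin euclidean {l :: 'a \<Rightarrow> real. \<forall>i. l i \<in> {0..b i}}"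
    by (simp only: euclidean_product_topology)
  then show ?thesis by (simp only: compactin_euclidean_iff)
qed

text \<open>The covers with cost at most \<open>M\<close> form a compact set in the product topology, since each
  \<open>l J\<close> is at most \<open>M / w J\<close>.  Each covering condition is closed because it involves only the finitely many sets
  above \<open>I\<close>, and finitely many of these conditions can be met by the greedy solution.\<close>
lemma laminar_duality:
  fixes A :: "'a set set" and w h :: "'a set \<Rightarrow> real"
  assumes lam: "\<And>I J. I \<in> A \<Longrightarrow> J \<in> A \<Longrightarrow> I \<subseteq> J \<or> J \<subseteq> I \<or> I \<inter> J = {}"
    and ne: "{} \<notin> A"
    and fin: "\<And>I. I \<in> A \<Longrightarrow> finite {J \<in> A. I \<subseteq> J}"
    and w: "\<And>J. J \<in> A \<Longrightarrow> 0 < w J"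
    and h: "\<And>I. I \<in> A \<Longrightarrow> 0 \<le> h I"
    and bound: "\<And>S x. \<lbrakk>finite S; S \<subseteq> A; \<And>I. 0 \<le> x I;
        \<And>J. J \<in> A \<Longrightarrow> (\<Sum>I\<in>{I\<in>S. I \<subseteq> J}. x I) \<le> w J\<rbrakk> \<Longrightarrow> (\<Sum>I\<in>S. h I * x I) \<le> M"
  shows "\<exists>l. (\<forall>J. 0 \<le> l J) \<and> (\<forall>I\<in>A. h I \<le> (\<Sum>J\<in>{J\<in>A. I \<subseteq> J}. l J)) \<and>
    (\<forall>F. finite F \<longrightarrow> F \<subseteq> A \<longrightarrow> (\<Sum>J\<in>F. l J * w J) \<le> M)"
proof -
  define K where "K = {l. \<forall>J. l J \<in> {0..(if J \<in> A then M / w J else 0)}}"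
  define B where "B = (\<Inter>F\<in>{F. finite F \<and> F \<subseteq> A}. {l. (\<Sum>J\<in>F. l J * w J) \<le> M})"
  define C where "C I = {l. h I \<le> (\<Sum>J\<in>{J\<in>A. I \<subseteq> J}. l J)}" for I
  have cont: "continuous_on UNIV (\<lambda>l :: 'a set \<Rightarrow> real. l J)" for J by simp
  have "closed {l. (\<Sum>J\<in>F. l J * w J) \<le> M}" for F
    by (intro closed_Collect_le continuous_on_sum continuous_on_mult cont continuous_on_const)
  then have "closed B" unfolding B_def by (intro closed_INT) auto
  then have comp: "compact (K \<inter> B)" unfolding K_def by (intro compact_Int_closed compact_real_box)
  have closedC: "closed (C I)" for I
    unfolding C_def by (intro closed_Collect_le continuous_on_sum cont continuous_on_const)
  have "(K \<inter> B) \<inter> (\<Inter>I\<in>A. C I) \<noteq> {}"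
  proof (rule compact_imp_fip_image[OF comp])
    fix S assume S: "finite S" "S \<subseteq> A"
    have w': "\<And>J. J \<in> A \<Longrightarrow> 0 \<le> w J" using w less_imp_le by blast
    have "\<forall>I\<in>S. 0 \<le> h I" using h S by auto
    then obtain x l T F where st: "optimal_pair A w h S x l T F"
      using laminar_greedy_duality[where A = A and w = w and S = S and m = 0 and h = h, OF lam ne fin w' S] by auto
    then have
      x0: "\<And>I. 0 \<le> x I" and feas: "\<And>J. J \<in> A \<Longrightarrow> (\<Sum>I\<in>{I\<in>S. I \<subseteq> J}. x I) \<le> w J"
      and F: "finite F" "F \<subseteq> A" and l0: "\<And>J. 0 \<le> l J" and lF: "\<And>J. J \<notin> F \<Longrightarrow> l J = 0"
      and cov: "\<And>I. I \<in> S \<Longrightarrow> h I \<le> (\<Sum>J\<in>{J\<in>A. I \<subseteq> J}. l J)"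
      and cost: "(\<Sum>J\<in>F. l J * w J) \<le> (\<Sum>I\<in>S. h I * x I)"
      by (simp_all add: optimal_pair_def)
    have M: "(\<Sum>J\<in>F. l J * w J) \<le> M" using cost bound[OF S x0 feas] by linarith
    have costG: "(\<Sum>J\<in>G. l J * w J) \<le> M" if "finite G" "G \<subseteq> A" for G
    proof -
      have "(\<Sum>J\<in>G. l J * w J) = (\<Sum>J\<in>G \<inter> F. l J * w J)"
        using that lF by (intro sum.mono_neutral_right) auto
      also have "\<dots> \<le> (\<Sum>J\<in>F. l J * w J)"
        using F l0 w' by (intro sum_mono2) auto
      finally show ?thesis using M by linarith
    qed
    have "l \<in> K"
    proof -
      have "l J \<le> M / w J" if "J \<in> A" for J
        using costG[of "{J}"] that w[OF that] by (simp add: field_simps)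
      moreover have "l J = 0" if "J \<notin> A" for J using lF F that by auto
      ultimately show ?thesis using l0 by (auto simp: K_def)
    qed
    then have "l \<in> (K \<inter> B) \<inter> (\<Inter>I\<in>S. C I)" using costG cov by (auto simp: B_def C_def)
    then show "(K \<inter> B) \<inter> (\<Inter>I\<in>S. C I) \<noteq> {}" by blast
  qed (rule closedC)
  then obtain l where "l \<in> K" "l \<in> B" "l \<in> (\<Inter>I\<in>A. C I)" by auto
  then show ?thesis by (intro exI[of _ l]) (auto simp: K_def B_def C_def)
qed

section \<open>Admissible sequences are Carleson measures\<close>

lemma sum_layers:
  fixes x d :: "'a \<Rightarrow> real"
  assumes S: "finite S" and x: "\<And>i. i \<in> S \<Longrightarrow> 0 \<le> x i"
    and p: "0 < p" "p < \<gamma>" and C: "0 \<le> C" and r: "0 < r"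
    and small: "\<And>\<rho>. \<rho> > 0 \<Longrightarrow> (\<Sum>i\<in>{i\<in>S. d i < \<rho>}. x i) \<le> C * \<rho> powr p"
  shows "(\<Sum>i\<in>S. x i * max r (d i) powr -\<gamma>) \<le> C * layer_const p \<gamma> * r powr (p - \<gamma>)"
proof -
  let ?N = "point_measure S (\<lambda>i. ennreal (x i))"
  have "ennreal (\<Sum>i\<in>S. x i * max r (d i) powr -\<gamma>) = (\<integral>\<^sup>+i. ennreal (max r (d i) powr -\<gamma>) \<partial>?N)"
    using S x by (simp add: nn_integral_point_measure_finite ennreal_mult[symmetric] sum_ennreal)
  also have "\<dots> \<le> ennreal (C * layer_const p \<gamma> * r powr (p - \<gamma>))"
  proof (rule nn_integral_layers)
    show "emeasure ?N {i \<in> space ?N. d i < \<rho>} \<le> ennreal (C * \<rho> powr p)" if "0 < \<rho>" for \<rho>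
    proof -
      have "emeasure ?N {i \<in> space ?N. d i < \<rho>} = (\<Sum>i\<in>{i\<in>S. d i < \<rho>}. ennreal (x i))"
        using S by (subst emeasure_point_measure_finite) (auto simp: space_point_measure)
      also have "\<dots> = ennreal (\<Sum>i\<in>{i\<in>S. d i < \<rho>}. x i)"
        using x by (intro sum_ennreal) auto
      finally show ?thesis using small[OF that] by (simp add: ennreal_leI)
    qed
  qed (use p C r in auto)
  finally show ?thesis
    using layer_const_nonneg[OF p(2)] C by (simp add: ennreal_le_iff mult_nonneg_nonneg)
qed

text \<open>The point at distance \<open>arc_length I / 2\<close> from the circle below the centre of the arc.  The factor
  \<open>1 / 2\<close> keeps it away from the origin even for the full circle.\<close>
definition arc_pt :: "complex set \<Rightarrow> complex"
  where "arc_pt I = of_real (1 - arc_length I / 2) * arc_mid I"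

lemma powr_le_self_of_ge_one:
  fixes u :: real
  assumes "1 \<le> u" "0 < p" "p \<le> 1"
  shows "u powr p \<le> u"
  using powr_mono[of p 1 u] assms by simp

context dyadic_arcs
begin

lemma norm_arc_pt: "I \<in> Dy \<Longrightarrow> norm (arc_pt I) = 1 - arc_length I / 2"
  using arc_length_pos[of I] arc_length_le_1[of I]
  unfolding arc_pt_def norm_mult norm_of_real norm_arc_mid by simp

lemma arc_pt_in_disc: "I \<in> Dy \<Longrightarrow> arc_pt I \<in> unit_disc"
  using norm_arc_pt[of I] arc_length_pos[of I] by simp

lemma norm_arc_mid_diff_arc_pt: "I \<in> Dy \<Longrightarrow> norm (arc_mid I - arc_pt I) = arc_length I / 2"
proof -
  assume I: "I \<in> Dy"
  have "arc_mid I - arc_pt I = of_real (arc_length I / 2) * arc_mid I"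
    by (simp add: arc_pt_def algebra_simps)
  then show ?thesis
    using arc_length_pos[OF I] by (simp only: norm_mult norm_of_real norm_arc_mid)
qed

lemma hdist_arc_pt_lower:
  assumes I: "I \<in> Dy" and z: "z \<in> unit_disc"
  shows "arc_length I / 2 < hdist (arc_pt I) z" "norm (arc_mid I - z) < hdist (arc_pt I) z"
    and "1 - norm z < hdist (arc_pt I) z"
proof -
  have e: "hdist (arc_pt I) z = arc_length I / 2 + (1 - norm z) + norm (arc_pt I - z)"
    using norm_arc_pt[OF I] by (simp add: hdist_def)
  show "arc_length I / 2 < hdist (arc_pt I) z" "1 - norm z < hdist (arc_pt I) z"
    using z arc_length_pos[OF I] norm_ge_zero[of "arc_pt I - z"] unfolding e by (simp_all del: norm_ge_zero)
  show "norm (arc_mid I - z) < hdist (arc_pt I) z"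
    using norm_triangle_ineq[of "arc_mid I - arc_pt I" "arc_pt I - z"] norm_arc_mid_diff_arc_pt[OF I] z
    unfolding e by simp
qed

text \<open>Packing gives \<open>\<Sum> (arc_length I)\<^sup>2 \<le> 900 * \<rho>\<^sup>2\<close> over the arcs with
  \<open>hdist (arc_pt I) z < \<rho>\<close>, the same growth as for area measure.\<close>
lemma sum_length_squared_hdist_le:
  assumes S: "finite S" "S \<subseteq> Dy" and z: "z \<in> unit_disc" and "2 < \<gamma>"
  shows "(\<Sum>I\<in>S. (arc_length I)\<^sup>2 * hdist (arc_pt I) z powr -\<gamma>) \<le> 900 * layer_const 2 \<gamma> * (1 - norm z) powr (2 - \<gamma>)"
proof -
  have "(\<Sum>I\<in>S. (arc_length I)\<^sup>2 * hdist (arc_pt I) z powr -\<gamma>)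
      = (\<Sum>I\<in>S. (arc_length I)\<^sup>2 * max (1 - norm z) (hdist (arc_pt I) z) powr -\<gamma>)"
    using hdist_arc_pt_lower(3)[OF _ z] S by (intro sum.cong refl) (auto simp: max_def subset_iff dest!: less_imp_le)
  also have "\<dots> \<le> 900 * layer_const 2 \<gamma> * (1 - norm z) powr (2 - \<gamma>)"
  proof (rule sum_layers)
    fix \<rho> :: real assume \<rho>: "0 < \<rho>"
    have "(\<Sum>I\<in>{I \<in> S. hdist (arc_pt I) z < \<rho>}. (arc_length I)\<^sup>2) \<le> 100 * (3 * \<rho>)\<^sup>2"
    proof (rule packing)
      fix I assume I: "I \<in> {I \<in> S. hdist (arc_pt I) z < \<rho>}"
      then have "I \<in> Dy" using S by auto
      from hdist_arc_pt_lower[OF this z] show "norm (arc_mid I - z) + arc_length I \<le> 3 * \<rho>" using I by auto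
    qed (use S \<rho> in auto)
    then show "(\<Sum>I\<in>{I \<in> S. hdist (arc_pt I) z < \<rho>}. (arc_length I)\<^sup>2) \<le> 900 * \<rho> powr 2"
      using \<rho> by (simp add: powr_numeral power_mult_distrib)
  qed (use assms in auto)
  finally show ?thesis .
qed

text \<open>Finitely supported feasible points of the dual program for the weights \<open>arc_length J powr p\<close>.\<close>
definition admissible :: "real \<Rightarrow> complex set set \<Rightarrow> (complex set \<Rightarrow> real) \<Rightarrow> bool"
  where "admissible p S x \<longleftrightarrow> finite S \<and> S \<subseteq> Dy \<and> (\<forall>I. 0 \<le> x I) \<and>
    (\<forall>J\<in>Dy. (\<Sum>I\<in>{I\<in>S. I \<subseteq> J}. x I) \<le> arc_length J powr p)"

text \<open>The condition on dyadic arcs controls balls about arbitrary points, not related to the dyadic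
  system: the arcs that count have length at most \<open>2 * \<rho>\<close> and hence lie below arcs of a generation of length
  comparable to \<open>\<rho>\<close>, and packing bounds the number of the latter.\<close>
lemma admissible_near:
  assumes p: "0 < p" "p \<le> 1" and ad: "admissible p S x" and a: "a \<in> unit_disc" and \<rho>: "0 < \<rho>"
  shows "(\<Sum>I\<in>{I\<in>S. hdist (arc_pt I) a < \<rho>}. x I) \<le> 44100 * \<rho> powr p"
proof -
  have S: "finite S" "S \<subseteq> Dy" and x: "\<And>I. 0 \<le> x I"
    and feas: "\<And>J. J \<in> Dy \<Longrightarrow> (\<Sum>I\<in>{I\<in>S. I \<subseteq> J}. x I) \<le> arc_length J powr p"
    using ad by (auto simp: admissible_def)
  show ?thesis
  proof (cases "\<rho> < 1/4")
    case False
    have "(\<Sum>I\<in>{I\<in>S. hdist (arc_pt I) a < \<rho>}. x I) \<le> (\<Sum>I\<in>{I\<in>S. I \<subseteq> unit_circle}. x I)"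
      using S x subset_circle by (intro sum_mono2) auto
    also have "\<dots> \<le> 1" using feas[OF circle_in_Dy] D_length[of unit_circle 0] D_0 by simp
    also have "\<dots> \<le> (4 * \<rho>) powr p" using False p by (intro ge_one_powr_ge_zero) auto
    also have "\<dots> \<le> 4 * \<rho> powr p" using powr_le_self_of_ge_one[of 4 p] p \<rho> by (simp add: powr_mult)
    also have "\<dots> \<le> 44100 * \<rho> powr p" by simp
    finally show ?thesis .
  next
    case True
    (* generation k has arcs of length between 2 * rho and 4 * rho *)
    obtain k where k: "2 * \<rho> \<le> 1 / 2 ^ k" "1 / 2 ^ k < 2 * (2 * \<rho>)"
      using dyadic_scale[of "2 * \<rho>"] True \<rho> by auto
    define S' where "S' = {I\<in>S. hdist (arc_pt I) a < \<rho>}"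
    have "\<exists>J\<in>D k. I \<subseteq> J" if I: "I \<in> S'" for I
    proof -
      have IDy: "I \<in> Dy" using I S by (auto simp: S'_def)
      then obtain j where j: "I \<in> D j" by (auto simp: Dy_eq)
      have "arc_length I < 1 / 2 ^ k" using hdist_arc_pt_lower(1)[OF IDy a] I k by (simp add: S'_def)
      then have "(2::real) ^ k < 2 ^ j" by (simp add: D_length[OF j] field_simps)
      then have "k \<le> j" by simp
      then show ?thesis using ancestor[OF j] by blast
    qed
    then obtain anc where anc: "\<And>I. I \<in> S' \<Longrightarrow> anc I \<in> D k \<and> I \<subseteq> anc I" by metis
    have finS': "finite S'" using S by (simp add: S'_def)
    define T where "T = anc ` S'"
    have T: "finite T" "T \<subseteq> D k" using finS' anc by (auto simp: T_def)
    have TDy: "T \<subseteq> Dy" using T by (auto simp: Dy_eq)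
    have "(\<Sum>J\<in>T. (arc_length J)\<^sup>2) \<le> 100 * (21 * \<rho>)\<^sup>2"
    proof (rule packing[OF T(1) TDy])
      fix J assume J: "J \<in> T"
      then obtain I where I: "I \<in> S'" "J = anc I" by (auto simp: T_def)
      have IDy: "I \<in> Dy" using I S by (auto simp: S'_def)
      have "norm (arc_mid I - arc_mid J) \<le> 4 * arc_length J"
        using norm_arc_mid_diff_le[OF IDy] J TDy anc I by auto
      moreover have "norm (arc_mid I - a) < \<rho>"
        using hdist_arc_pt_lower(2)[OF IDy a] I by (simp add: S'_def)
      moreover have "arc_length J < 4 * \<rho>" using k D_length J T by auto
      moreover have "norm (arc_mid J - a) \<le> norm (arc_mid I - arc_mid J) + norm (arc_mid I - a)"
        using norm_triangle_ineq[of "arc_mid J - arc_mid I" "arc_mid I - a"] by (simp add: norm_minus_commute)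
      ultimately show "norm (arc_mid J - a) + arc_length J \<le> 21 * \<rho>" by linarith
    qed (use \<rho> in auto)
    moreover have "(\<Sum>J\<in>T. (2 * \<rho>)\<^sup>2) \<le> (\<Sum>J\<in>T. (arc_length J)\<^sup>2)"
      using k D_length T \<rho> by (intro sum_mono power_mono) auto
    ultimately have "real (card T) * (4 * \<rho>\<^sup>2) \<le> 44100 * \<rho>\<^sup>2"
      by (simp add: power_mult_distrib)
    then have card: "real (card T) \<le> 11025" using \<rho> by (simp add: field_simps)
    have "(\<Sum>I\<in>S'. x I) = (\<Sum>J\<in>T. \<Sum>I\<in>{I\<in>S'. anc I = J}. x I)"
      using finS' unfolding T_def by (rule sum.image_gen)
    also have "\<dots> \<le> (\<Sum>J\<in>T. \<Sum>I\<in>{I\<in>S. I \<subseteq> J}. x I)"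
      using S x anc by (intro sum_mono sum_mono2) (auto simp: S'_def)
    also have "\<dots> \<le> (\<Sum>J\<in>T. (4 * \<rho>) powr p)"
    proof (rule sum_mono)
      fix J assume J: "J \<in> T"
      have "(\<Sum>I\<in>{I\<in>S. I \<subseteq> J}. x I) \<le> arc_length J powr p" using feas J TDy by auto
      also have "\<dots> \<le> (4 * \<rho>) powr p"
        using J T k D_length p by (intro powr_mono2) auto
      finally show "(\<Sum>I\<in>{I\<in>S. I \<subseteq> J}. x I) \<le> (4 * \<rho>) powr p" .
    qed
    also have "\<dots> = real (card T) * (4 powr p * \<rho> powr p)" using \<rho> by (simp add: powr_mult)
    also have "\<dots> \<le> 11025 * (4 * \<rho> powr p)"
      using card powr_le_self_of_ge_one[of 4 p] p by (intro mult_mono) auto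
    finally show ?thesis by (simp add: S'_def)
  qed
qed

end

section \<open>Sums of molecules: pointwise and local bounds\<close>

text \<open>The constants have explicit definitions outside the locale because they must not depend on
  the dyadic system.\<close>
definition pointwise_const :: "real \<Rightarrow> real"
  where "pointwise_const p = 729 * (900 * layer_const 2 (2 + p))"

definition growth_const :: "real \<Rightarrow> real"
  where "growth_const p = pointwise_const p * (4 * (44100 * layer_const p 2))"

definition carleson_const :: "real \<Rightarrow> real"
  where "carleson_const p = pointwise_const p * (352800 * layer_const 2 (4 - p) + 2822400 * layer_const p 2)"

definition test_const :: "real \<Rightarrow> real"
  where "test_const p = 72 * (carleson_const p * layer_const p (2 * p)) + 2400 * growth_const p"

lemma powr_minus_half: "(x / 2) powr -c = 2 powr c * x powr -(c::real)"
proof -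
  have "(x / 2) powr -c = x powr -c / 2 powr -c" by (rule powr_divide)
  then show ?thesis by (simp only: powr_minus[of 2 c] divide_inverse inverse_inverse_eq mult.commute)
qed

context dyadic_arcs
begin

text \<open>The numerator of the derivative of the molecule that belongs to \<open>I\<close>.  It makes the squared
  modulus of this derivative comparable to \<open>x I / arc_length I powr (p + 2)\<close> on the box \<open>Q_up I\<close>.\<close>
definition molecule_coeff :: "real \<Rightarrow> (complex set \<Rightarrow> real) \<Rightarrow> complex set \<Rightarrow> real"
  where "molecule_coeff p x I = sqrt (x I * arc_length I powr -p) * (arc_length I)\<^sup>2"

text \<open>All that is needed from a signed sum of molecules; in particular the bounds
  below hold for all choices of signs at once.\<close>
definition dominated_by_molecules :: "real \<Rightarrow> complex set set \<Rightarrow> (complex set \<Rightarrow> real) \<Rightarrow> (complex \<Rightarrow> complex) \<Rightarrow> bool"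
  where "dominated_by_molecules p S x f \<longleftrightarrow> (\<forall>z\<in>unit_disc.
    norm (f z) \<le> (\<Sum>I\<in>S. molecule_coeff p x I / norm (1 - cnj (arc_pt I) * z) ^ 3))"

lemma hdist_arc_pt_pos: "I \<in> Dy \<Longrightarrow> z \<in> unit_disc \<Longrightarrow> 0 < hdist (arc_pt I) z"
  using hdist_arc_pt_lower(1)[of I z] arc_length_pos[of I] by simp

text \<open>The exponents of the two factors are chosen such that in the Cauchy--Schwarz inequality the
  squares of the second factors sum to \<open>O((1 - norm z) powr -p)\<close>, by
  \<open>sum_length_squared_hdist_le\<close> with \<open>\<gamma> = 2 + p\<close>.  The first factors then carry a power of \<open>hdist\<close>
  that is integrable without any weight.\<close>
lemma molecule_le_sqrt_mult_sqrt:
  assumes p: "0 < p" "p \<le> 1" and I: "I \<in> Dy" and x: "0 \<le> x I" and z: "z \<in> unit_disc"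
  shows "molecule_coeff p x I / norm (1 - cnj (arc_pt I) * z) ^ 3 \<le>
    27 * (sqrt (x I * arc_length I powr (2 - p) * hdist (arc_pt I) z powr -(4 - p)) *
          sqrt ((arc_length I)\<^sup>2 * hdist (arc_pt I) z powr -(2 + p)))"
proof -
  define l h where "l = arc_length I" and "h = hdist (arc_pt I) z"
  have l: "0 < l" using I by (simp add: l_def arc_length_pos)
  have h: "0 < h" using I z by (simp add: h_def hdist_arc_pt_pos)
  have "h / 3 \<le> norm (1 - cnj (arc_pt I) * z)"
    using hdist_le_cross_norm[of "arc_pt I" z] arc_pt_in_disc[OF I] z by (simp add: h_def)
  then have "(h / 3) ^ 3 \<le> norm (1 - cnj (arc_pt I) * z) ^ 3"
    using h by (intro power_mono) auto
  moreover have "0 \<le> molecule_coeff p x I" using x by (simp add: molecule_coeff_def)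
  ultimately have "molecule_coeff p x I / norm (1 - cnj (arc_pt I) * z) ^ 3 \<le> molecule_coeff p x I / (h / 3) ^ 3"
    using h by (intro divide_left_mono mult_pos_pos) (auto simp: zero_less_power intro: less_le_trans[of 0 "(h/3)^3"])
  (* under the roots, the exponents 4 - p and 2 + p of h add up to twice 3, and 2 - p and 2 to 4 - p *)
  also have "\<dots> = 27 * (molecule_coeff p x I * h powr -3)"
    using h by (simp add: powr_minus powr_numeral power_divide field_simps)
  also have "molecule_coeff p x I * h powr -3 = sqrt (x I * l powr (2 - p) * h powr -(4 - p)) * sqrt (l\<^sup>2 * h powr -(2 + p))"
  proof -
    have "sqrt (x I * l powr (2 - p) * h powr -(4 - p)) * sqrt (l\<^sup>2 * h powr -(2 + p))
        = sqrt ((x I * l powr -p) * (l\<^sup>2)\<^sup>2 * (h powr -3)\<^sup>2)"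
    proof -
      have "l powr (2 - p) = l powr -p * l\<^sup>2"
        using l powr_add[of l "-p" 2] by (simp add: powr_numeral)
      moreover have "h powr -(4 - p) * h powr -(2 + p) = (h powr -3)\<^sup>2"
        by (simp add: power2_eq_square powr_add[symmetric])
      ultimately have "(x I * l powr (2 - p) * h powr -(4 - p)) * (l\<^sup>2 * h powr -(2 + p))
         = (x I * l powr -p) * (l\<^sup>2)\<^sup>2 * (h powr -3)\<^sup>2"
        by (simp add: power2_eq_square mult_ac)
      then show ?thesis by (simp only: real_sqrt_mult[symmetric])
    qed
    also have "\<dots> = molecule_coeff p x I * h powr -3"
      by (simp only: real_sqrt_mult real_sqrt_abs) (simp add: molecule_coeff_def l_def real_sqrt_mult)
    finally show ?thesis by simp
  qed
  finally show ?thesis by (simp add: l_def h_def)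
qed

lemma pointwise_bound:
  assumes p: "0 < p" "p \<le> 1" and ad: "admissible p S x" and f: "dominated_by_molecules p S x f" and z: "z \<in> unit_disc"
  shows "(norm (f z))\<^sup>2 \<le> pointwise_const p * (1 - norm z) powr -p *
    (\<Sum>I\<in>S. x I * arc_length I powr (2 - p) * hdist (arc_pt I) z powr -(4 - p))"
proof -
  define u where "u I = x I * arc_length I powr (2 - p) * hdist (arc_pt I) z powr -(4 - p)" for I
  define v where "v I = (arc_length I)\<^sup>2 * hdist (arc_pt I) z powr -(2 + p)" for I
  have S: "finite S" "S \<subseteq> Dy" and x: "\<And>I. 0 \<le> x I" using ad by (auto simp: admissible_def)
  have u0: "0 \<le> u I" "0 \<le> v I" for I using x by (auto simp: u_def v_def)
  have "norm (f z) \<le> (\<Sum>I\<in>S. molecule_coeff p x I / norm (1 - cnj (arc_pt I) * z) ^ 3)"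
    using f z by (simp add: dominated_by_molecules_def)
  also have "\<dots> \<le> (\<Sum>I\<in>S. 27 * (sqrt (u I) * sqrt (v I)))"
    unfolding u_def v_def using S by (intro sum_mono molecule_le_sqrt_mult_sqrt p x z) auto
  also have "\<dots> = 27 * (\<Sum>I\<in>S. sqrt (u I) * sqrt (v I))" by (simp add: sum_distrib_left)
  finally have "(norm (f z))\<^sup>2 \<le> (27 * (\<Sum>I\<in>S. sqrt (u I) * sqrt (v I)))\<^sup>2"
    by (intro power_mono) auto
  also have "\<dots> = 729 * (\<Sum>I\<in>S. sqrt (u I) * sqrt (v I))\<^sup>2" by (simp add: power_mult_distrib)
  also have "\<dots> \<le> 729 * ((\<Sum>I\<in>S. (sqrt (u I))\<^sup>2) * (\<Sum>I\<in>S. (sqrt (v I))\<^sup>2))"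
    by (intro mult_left_mono Cauchy_Schwarz_ineq_sum) auto
  also have "\<dots> = 729 * ((\<Sum>I\<in>S. u I) * (\<Sum>I\<in>S. v I))" using u0 by simp
  also have "\<dots> \<le> 729 * ((\<Sum>I\<in>S. u I) * (900 * layer_const 2 (2 + p) * (1 - norm z) powr (2 - (2 + p))))"
    unfolding v_def using p u0 by (intro mult_left_mono sum_length_squared_hdist_le S z sum_nonneg) auto
  also have "\<dots> = pointwise_const p * (1 - norm z) powr -p * (\<Sum>I\<in>S. u I)"
    by (simp add: pointwise_const_def)
  finally show ?thesis by (simp only: u_def)
qed

lemma pointwise_const_nonneg: "0 < p \<Longrightarrow> 0 \<le> pointwise_const p"
  by (simp add: pointwise_const_def layer_const_nonneg)

text \<open>On each term \<open>arc_length I \<le> 2 * hdist (arc_pt I) z\<close>, so the previous sum is bounded by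
  \<open>\<Sum> x I * hdist (arc_pt I) z powr -2\<close>, to which the layer estimate applies since \<open>p < 2\<close>.\<close>
lemma growth_bound:
  assumes p: "0 < p" "p \<le> 1" and ad: "admissible p S x" and f: "dominated_by_molecules p S x f" and z: "z \<in> unit_disc"
  shows "(norm (f z))\<^sup>2 \<le> growth_const p * (1 - norm z) powr -2"
proof -
  have S: "finite S" "S \<subseteq> Dy" and x: "\<And>I. 0 \<le> x I" using ad by (auto simp: admissible_def)
  have r: "0 < 1 - norm z" using z by simp
  have "(\<Sum>I\<in>S. x I * arc_length I powr (2 - p) * hdist (arc_pt I) z powr -(4 - p))
      \<le> (\<Sum>I\<in>S. 4 * (x I * max (1 - norm z) (hdist (arc_pt I) z) powr -2))"
  proof (rule sum_mono)
    fix I assume "I \<in> S"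
    then have I: "I \<in> Dy" using S by auto
    define h where "h = hdist (arc_pt I) z"
    have h: "0 < h" "1 - norm z \<le> h" "arc_length I \<le> 2 * h"
      using hdist_arc_pt_lower[OF I z] hdist_arc_pt_pos[OF I z] by (auto simp: h_def)
    have "arc_length I powr (2 - p) \<le> (2 * h) powr (2 - p)"
      using h p arc_length_pos[OF I] by (intro powr_mono2) auto
    also have "\<dots> = 2 powr (2 - p) * h powr (2 - p)" using h by (simp add: powr_mult)
    also have "\<dots> \<le> 4 * h powr (2 - p)"
      using powr_mono[of "2 - p" 2 2] p by (intro mult_right_mono) (auto simp: powr_numeral)
    finally have "x I * arc_length I powr (2 - p) * h powr -(4 - p) \<le> x I * (4 * h powr (2 - p)) * h powr -(4 - p)"
      using x by (intro mult_right_mono mult_left_mono) auto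
    also have "\<dots> = 4 * (x I * (h powr (2 - p) * h powr -(4 - p)))" by simp
    also have "h powr (2 - p) * h powr -(4 - p) = h powr -2" by (simp add: powr_add[symmetric])
    finally show "x I * arc_length I powr (2 - p) * hdist (arc_pt I) z powr -(4 - p)
      \<le> 4 * (x I * max (1 - norm z) (hdist (arc_pt I) z) powr -2)"
      using h by (simp add: h_def max_absorb2)
  qed
  also have "\<dots> = 4 * (\<Sum>I\<in>S. x I * max (1 - norm z) (hdist (arc_pt I) z) powr -2)"
    by (simp add: sum_distrib_left)
  also have "(\<Sum>I\<in>S. x I * max (1 - norm z) (hdist (arc_pt I) z) powr -2) \<le> 44100 * layer_const p 2 * (1 - norm z) powr (p - 2)"
    by (rule sum_layers[OF S(1)]) (use p r x admissible_near[OF p ad z] in auto)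
  finally have "(\<Sum>I\<in>S. x I * arc_length I powr (2 - p) * hdist (arc_pt I) z powr -(4 - p))
     \<le> 4 * (44100 * layer_const p 2) * (1 - norm z) powr (p - 2)" by simp
  then have "(norm (f z))\<^sup>2 \<le> pointwise_const p * (1 - norm z) powr -p * (4 * (44100 * layer_const p 2) * (1 - norm z) powr (p - 2))"
    using pointwise_const_nonneg[OF p(1)]
    by (intro order.trans[OF pointwise_bound[OF p ad f z]] mult_left_mono) auto
  also have "\<dots> = growth_const p * ((1 - norm z) powr -p * (1 - norm z) powr (p - 2))"
    by (simp add: growth_const_def)
  also have "(1 - norm z) powr -p * (1 - norm z) powr (p - 2) = (1 - norm z) powr -2"
    by (simp add: powr_add[symmetric])
  finally show ?thesis .
qed

text \<open>For \<open>arc_pt I\<close> close to \<open>a\<close> the integral over the whole disc is already small enough; otherwise \<open>hdist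
  (arc_pt I)\<close> is almost constant on the region of integration, whose area is at most \<open>\<rho>\<^sup>2\<close>.\<close>
lemma molecule_local_integral_le:
  assumes p: "0 < p" "p \<le> 1" and I: "I \<in> Dy" and a: "a \<in> unit_disc" and \<rho>: "0 < \<rho>"
  shows "ennreal (arc_length I powr (2 - p)) *
      (\<integral>\<^sup>+z\<in>{z\<in>unit_disc. hdist a z < \<rho>}. ennreal (hdist (arc_pt I) z powr -(4 - p)) \<partial>dA)
    \<le> ennreal (4 * layer_const 2 (4 - p) * (if hdist (arc_pt I) a < 2 * \<rho> then 1 else 0)
          + 64 * \<rho>\<^sup>2 * max (2 * \<rho>) (hdist (arc_pt I) a) powr -2)"
proof -
  define l d L where "l = arc_length I" and "d = hdist (arc_pt I) a" and "L = layer_const 2 (4 - p)"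
  let ?E = "{z\<in>unit_disc. hdist a z < \<rho>}"
  have l: "0 < l" "l \<le> 2 * d" using arc_length_pos[OF I] hdist_arc_pt_lower(1)[OF I a] by (auto simp: l_def d_def)
  have L: "0 \<le> L" unfolding L_def using p by (intro layer_const_nonneg) auto
  have p2: "2 powr (2 - p) \<le> (4::real)" using powr_mono[of "2 - p" 2 "2::real"] p by (auto simp: powr_numeral)
  show ?thesis
  proof (cases "d < 2 * \<rho>")
    case True
    have "(\<integral>\<^sup>+z\<in>?E. ennreal (hdist (arc_pt I) z powr -(4 - p)) \<partial>dA)
        \<le> (\<integral>\<^sup>+z\<in>unit_disc. ennreal (hdist (arc_pt I) z powr -(4 - p)) \<partial>dA)"
      by (intro nn_integral_mono) (auto simp: indicator_def)
    also have "\<dots> \<le> ennreal (L * (1 - norm (arc_pt I)) powr (2 - (4 - p)))"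
      unfolding L_def using p by (intro nn_integral_hdist_powr_le arc_pt_in_disc I) auto
    finally have "ennreal (l powr (2 - p)) * (\<integral>\<^sup>+z\<in>?E. ennreal (hdist (arc_pt I) z powr -(4 - p)) \<partial>dA)
       \<le> ennreal (l powr (2 - p)) * ennreal (L * (l / 2) powr -(2 - p))"
      using norm_arc_pt[OF I] by (intro mult_left_mono) (auto simp: l_def)
    also have "\<dots> = ennreal (L * (l powr (2 - p) * (l / 2) powr -(2 - p)))"
      using L by (simp add: ennreal_mult[symmetric] mult_ac)
    also have "l powr (2 - p) * (l / 2) powr -(2 - p) = 2 powr (2 - p)"
      using l by (simp only: powr_minus_half) (simp add: powr_add[symmetric])
    also have "ennreal (L * 2 powr (2 - p)) \<le> ennreal (4 * L * 1 + 64 * \<rho>\<^sup>2 * max (2 * \<rho>) d powr -2)"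
      using p2 L by (intro ennreal_leI) (simp add: add_increasing2 mult.commute[of L] mult_right_mono)
    finally show ?thesis using True by (simp add: l_def d_def L_def)
  next
    case False
    then have d: "2 * \<rho> \<le> d" "0 < d" using \<rho> by auto
    have h: "d / 2 \<le> hdist (arc_pt I) z" if "z \<in> ?E" for z
    proof -
      have "d \<le> hdist (arc_pt I) z + hdist z a"
        unfolding d_def using that by (intro hdist_triangle) auto
      then show ?thesis using that d by (simp add: hdist_commute)
    qed
    have "(\<integral>\<^sup>+z\<in>?E. ennreal (hdist (arc_pt I) z powr -(4 - p)) \<partial>dA)
        \<le> (\<integral>\<^sup>+z. ennreal ((d / 2) powr -(4 - p)) * indicator (ball a \<rho>) z \<partial>dA)"
    proof (intro nn_integral_mono)
      fix z
      have "z \<in> ball a \<rho>" if "z \<in> ?E" using that a by (auto simp: hdist_def dist_norm)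
      moreover have "hdist (arc_pt I) z powr -(4 - p) \<le> (d / 2) powr -(4 - p)" if "z \<in> ?E"
        using h[OF that] d p by (intro powr_mono2') auto
      ultimately show "ennreal (hdist (arc_pt I) z powr -(4 - p)) * indicator ?E z
        \<le> ennreal ((d / 2) powr -(4 - p)) * indicator (ball a \<rho>) z"
        by (auto simp: indicator_def intro: ennreal_leI)
    qed
    also have "\<dots> = ennreal ((d / 2) powr -(4 - p)) * emeasure dA (ball a \<rho>)"
      by (intro nn_integral_cmult_indicator) simp
    also have "\<dots> \<le> ennreal ((d / 2) powr -(4 - p)) * ennreal (\<rho>\<^sup>2)"
      using \<rho> by (intro mult_left_mono emeasure_dA_ball_le) auto
    finally have "ennreal (l powr (2 - p)) * (\<integral>\<^sup>+z\<in>?E. ennreal (hdist (arc_pt I) z powr -(4 - p)) \<partial>dA)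
       \<le> ennreal (l powr (2 - p)) * (ennreal ((d / 2) powr -(4 - p)) * ennreal (\<rho>\<^sup>2))"
      by (intro mult_left_mono) auto
    also have "\<dots> = ennreal (l powr (2 - p) * (d / 2) powr -(4 - p) * \<rho>\<^sup>2)"
      by (simp add: ennreal_mult[symmetric] mult_ac)
    also have "l powr (2 - p) * (d / 2) powr -(4 - p) * \<rho>\<^sup>2 \<le> (4 * (d powr (2 - p))) * (16 * d powr -(4 - p)) * \<rho>\<^sup>2"
    proof (intro mult_mono order.refl)
      have "l powr (2 - p) \<le> (2 * d) powr (2 - p)" using l p by (intro powr_mono2) auto
      also have "\<dots> \<le> 4 * d powr (2 - p)" using d p2 by (simp add: powr_mult mult_right_mono)
      finally show "l powr (2 - p) \<le> 4 * d powr (2 - p)" .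
      have "(d / 2) powr -(4 - p) = 2 powr (4 - p) * d powr -(4 - p)"
        by (rule powr_minus_half)
      also have "\<dots> \<le> 16 * d powr -(4 - p)"
        using powr_mono[of "4 - p" 4 "2::real"] p by (intro mult_right_mono) (auto simp: powr_numeral)
      finally show "(d / 2) powr -(4 - p) \<le> 16 * d powr -(4 - p)" .
    qed auto
    also have "(4 * (d powr (2 - p))) * (16 * d powr -(4 - p)) * \<rho>\<^sup>2 = 64 * \<rho>\<^sup>2 * (d powr (2 - p) * d powr -(4 - p))"
      by simp
    also have "d powr (2 - p) * d powr -(4 - p) = max (2 * \<rho>) d powr -2"
      using d by (simp add: powr_add[symmetric] max_absorb2)
    finally show ?thesis using False by (simp add: l_def d_def L_def ennreal_leI)
  qed
qed

end

section \<open>The Green function\<close>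

text \<open>The right-hand side counts, twice, the \<open>n\<close> with \<open>2 ^ n < 1 / s\<close>; there are at least
  \<open>log 2 (1 / s)\<close> of them, and at least one.\<close>
lemma one_plus_ln_le_suminf:
  assumes s: "0 < s" "s < (1::real)"
  shows "ennreal (1 + ln (1 / s)) \<le> 2 * (\<Sum>n. indicator {..<1 / 2 ^ n} s)"
proof -
  define m where "m = nat \<lceil>log 2 (1 / s)\<rceil>"
  have L: "0 < log 2 (1 / s)" using s by (subst zero_less_log_cancel_iff) auto
  then have m: "log 2 (1 / s) \<le> real m" "1 \<le> real m" unfolding m_def by linarith (use L in simp)
  have "ln (1 / s) \<le> log 2 (1 / s)"
    using s L ln_le_minus_one[of 2] by (auto simp: log_def field_simps mult_left_le)
  then have "1 + ln (1 / s) \<le> 2 * real m" using m by linarith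
  then have "ennreal (1 + ln (1 / s)) \<le> 2 * of_nat m"
    by (metis ennreal_leI ennreal_mult ennreal_numeral ennreal_of_nat_eq_real_of_nat of_nat_0_le_iff zero_le_numeral)
  also have "of_nat m = (\<Sum>n<m. indicator {..<1 / 2 ^ n} s :: ennreal)"
  proof -
    have "s < 1 / 2 ^ n" if "n < m" for n
    proof -
      have "real n < log 2 (1 / s)" using that unfolding m_def by linarith
      then have "2 powr real n < 1 / s" using s by (simp add: less_log_iff)
      then show ?thesis using s by (simp add: powr_realpow field_simps)
    qed
    then show ?thesis by (simp add: indicator_def)
  qed
  also have "2 * \<dots> \<le> 2 * (\<Sum>n. indicator {..<1 / 2 ^ n} s)"
    by (intro mult_left_mono sum_le_suminf summableI) auto
  finally show ?thesis .
qed

lemma nn_integral_small_balls_le: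
  assumes "0 < \<delta>"
  shows "(\<integral>\<^sup>+z. (\<Sum>n. indicator (ball a (\<delta> / 2 ^ n)) z) \<partial>dA) \<le> ennreal (4 / 3 * \<delta>\<^sup>2)"
proof -
  have "(\<integral>\<^sup>+z. (\<Sum>n. indicator (ball a (\<delta> / 2 ^ n)) z) \<partial>dA) = (\<Sum>n. emeasure dA (ball a (\<delta> / 2 ^ n)))"
    by (subst nn_integral_suminf) (auto intro!: borel_measurable_indicator)
  also have "\<dots> \<le> (\<Sum>n. ennreal (\<delta>\<^sup>2 * (1 / 4) ^ n))"
  proof (intro suminf_le summableI)
    fix n
    have "(\<delta> / 2 ^ n)\<^sup>2 = \<delta>\<^sup>2 * (1 / 4) ^ n"
      by (simp add: power_divide power_mult[symmetric] mult.commute[of n]) (simp add: power_mult)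
    then show "emeasure dA (ball a (\<delta> / 2 ^ n)) \<le> ennreal (\<delta>\<^sup>2 * (1 / 4) ^ n)"
      using emeasure_dA_ball_le[of "\<delta> / 2 ^ n" a] assms by simp
  qed
  also have "\<dots> = ennreal (\<Sum>n. \<delta>\<^sup>2 * (1 / 4) ^ n)"
    by (intro suminf_ennreal2 summable_mult summable_geometric) auto
  also have "(\<Sum>n. \<delta>\<^sup>2 * (1 / 4 :: real) ^ n) = 4 / 3 * \<delta>\<^sup>2"
    by (simp add: suminf_mult suminf_geometric summable_geometric)
  finally show ?thesis .
qed

lemma cross_norm_lower:
  assumes "norm a < 1" "norm z < 1"
  shows "1 - norm a \<le> norm (1 - cnj a * z)" "1 - cnj a * z \<noteq> 0"
proof -
  have "norm a * norm z \<le> norm a * 1" using assms by (intro mult_left_mono) auto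
  then show *: "1 - norm a \<le> norm (1 - cnj a * z)"
    using norm_triangle_ineq2[of 1 "cnj a * z"] by (simp add: norm_mult)
  then show "1 - cnj a * z \<noteq> 0" using assms by auto
qed

lemma one_minus_sigma_squared:
  assumes "norm a < 1" "norm z < 1"
  shows "1 - (norm (\<sigma> a z))\<^sup>2 = (1 - (norm a)\<^sup>2) * (1 - (norm z)\<^sup>2) / (norm (1 - cnj a * z))\<^sup>2"
proof -
  have "1 - cnj a * z \<noteq> 0" using assms by (rule cross_norm_lower)
  then have "1 - (norm (\<sigma> a z))\<^sup>2 = ((norm (1 - cnj a * z))\<^sup>2 - (norm (a - z))\<^sup>2) / (norm (1 - cnj a * z))\<^sup>2"
  proof -
    have "(norm (\<sigma> a z))\<^sup>2 = (norm (a - z))\<^sup>2 / (norm (1 - cnj a * z))\<^sup>2"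
      by (simp add: \<sigma>_def norm_divide power_divide)
    with \<open>1 - cnj a * z \<noteq> 0\<close> show ?thesis by (simp only: diff_divide_distrib) simp
  qed
  also have "(norm (1 - cnj a * z))\<^sup>2 - (norm (a - z))\<^sup>2 = (1 - (norm a)\<^sup>2) * (1 - (norm z)\<^sup>2)"
    using norm_one_minus_cnj_mult_squared[of a z] by linarith
  finally show ?thesis .
qed

lemma sigma_lt_1:
  assumes "norm a < 1" "norm z < 1"
  shows "norm (\<sigma> a z) < 1"
proof -
  have "0 < (1 - (norm a)\<^sup>2) * (1 - (norm z)\<^sup>2) / (norm (1 - cnj a * z))\<^sup>2"
    using assms cross_norm_lower(2)[OF assms]
    by (intro divide_pos_pos mult_pos_pos) (auto simp: power_less_one_iff abs_square_less_1)
  then have "(norm (\<sigma> a z))\<^sup>2 < 1" using one_minus_sigma_squared[OF assms] by simp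
  then show ?thesis by (simp add: abs_square_less_1)
qed

text \<open>Away from the pole, \<open>ln (1 / s)\<close> is comparable to \<open>1 - s\<^sup>2\<close>, which
  is \<open>(1 - |a|\<^sup>2) (1 - |z|\<^sup>2) / |1 - cnj a z|\<^sup>2\<close>.\<close>
lemma green_powr_le_far:
  assumes p: "0 < p" "p \<le> 1" and a: "norm a < 1" and z: "norm z < 1" and s: "1 / 2 \<le> norm (\<sigma> a z)"
  shows "green z a powr p \<le> 72 * (1 - norm a) powr p * (1 - norm z) powr p * hdist a z powr -(2 * p)"
proof -
  define s where "s = norm (\<sigma> a z)"
  define h where "h = hdist a z"
  have s1: "1 / 2 \<le> s" "s < 1" using s sigma_lt_1[OF a z] by (auto simp: s_def)
  have h: "0 < h" using a z norm_ge_zero[of "a - z"] by (simp add: h_def hdist_def add_pos_nonneg)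
  have "green z a = ln (1 / s)" by (simp add: green_def s_def)
  also have "\<dots> \<le> 1 / s - 1" using s1 by (intro ln_le_minus_one) auto
  also have "\<dots> \<le> 2 * (1 - s\<^sup>2)"
  proof -
    have "2 * (1 - s\<^sup>2) - (1 / s - 1) = (1 - s) * (2 * s * (1 + s) - 1) / s"
      using s1 by (simp add: field_simps power2_eq_square)
    moreover have "0 \<le> (1 - s) * (2 * s * (1 + s) - 1) / s"
      using s1 mult_mono[of "1/2" s 1 "1 + s"] by (intro divide_nonneg_nonneg mult_nonneg_nonneg) auto
    ultimately show ?thesis by linarith
  qed
  also have "1 - s\<^sup>2 = (1 - (norm a)\<^sup>2) * (1 - (norm z)\<^sup>2) / (norm (1 - cnj a * z))\<^sup>2"
    unfolding s_def by (rule one_minus_sigma_squared[OF a z])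
  also have "\<dots> \<le> ((1 - norm a) * 2) * ((1 - norm z) * 2) / (h / 3)\<^sup>2"
  proof (intro frac_le mult_mono power_mono)
    show "1 - (norm a)\<^sup>2 \<le> (1 - norm a) * 2" using power2_diff[of 1 "norm a"] zero_le_power2[of "1 - norm a"] by simp
    show "1 - (norm z)\<^sup>2 \<le> (1 - norm z) * 2" using power2_diff[of 1 "norm z"] zero_le_power2[of "1 - norm z"] by simp
    show "h / 3 \<le> norm (1 - cnj a * z)" using hdist_le_cross_norm[of a z] a z by (simp add: h_def)
  qed (use a z h in \<open>auto simp: power_le_one abs_square_le_1\<close>)
  also have "((1 - norm a) * 2) * ((1 - norm z) * 2) / (h / 3)\<^sup>2 = 36 * ((1 - norm a) * (1 - norm z) / h\<^sup>2)"
  proof -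
    have "((1 - norm a) * 2) * ((1 - norm z) * 2) = 4 * ((1 - norm a) * (1 - norm z))" by (simp add: algebra_simps)
    then show ?thesis by (simp only: power_divide) (simp only: times_divide_eq_right divide_divide_eq_right, simp)
  qed
  finally have "green z a \<le> 72 * ((1 - norm a) * (1 - norm z) / h\<^sup>2)" by simp
  moreover have "0 \<le> green z a" using s1 by (simp add: green_def s_def[symmetric])
  ultimately have "green z a powr p \<le> (72 * ((1 - norm a) * (1 - norm z) / h\<^sup>2)) powr p"
    using p by (intro powr_mono2) auto
  also have "\<dots> = 72 powr p * ((1 - norm a) powr p * (1 - norm z) powr p * h powr -(2 * p))"
  proof -
    have "(h\<^sup>2) powr p = h powr (2 * p)" using h by (simp add: powr_powr flip: powr_numeral)
    moreover have "h powr -(2 * p) = inverse (h powr (2 * p))" by (rule powr_minus)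
    ultimately show ?thesis by (simp only: powr_mult powr_divide) (simp only: divide_inverse mult.assoc)
  qed
  also have "\<dots> \<le> 72 * ((1 - norm a) powr p * (1 - norm z) powr p * h powr -(2 * p))"
    using powr_le_self_of_ge_one[of 72 p] p by (intro mult_right_mono) auto
  finally show ?thesis by (simp add: h_def mult_ac)
qed

text \<open>A point at pseudohyperbolic distance less than \<open>1 / 2\<close> from \<open>a\<close> has about the same height as \<open>a\<close>,
  and there the pseudohyperbolic distance is comparable to the Euclidean one divided by this height.\<close>
lemma near_diagonal:
  assumes a: "norm a < 1" and z: "norm z < 1" and s: "norm (\<sigma> a z) < 1 / 2"
  shows "1 - norm a \<le> 6 * (1 - norm z)" "norm (a - z) \<le> 4 * (1 - norm a) * norm (\<sigma> a z)"
proof -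
  define N where "N = norm (1 - cnj a * z)"
  have N: "1 - norm a \<le> N" "N > 0" using cross_norm_lower[OF a z] by (auto simp: N_def)
  have sN: "norm (a - z) = norm (\<sigma> a z) * N" using N by (simp add: \<sigma>_def norm_divide N_def)
  have "1 - cnj a * z = of_real (1 - (norm a)\<^sup>2) + cnj a * (a - z)"
    using complex_norm_square[of a] by (simp add: algebra_simps)
  then have "N \<le> norm (of_real (1 - (norm a)\<^sup>2) :: complex) + norm (cnj a * (a - z))"
    unfolding N_def by (metis norm_triangle_ineq)
  also have "norm (of_real (1 - (norm a)\<^sup>2) :: complex) = 1 - (norm a)\<^sup>2"
    using a by (simp only: norm_of_real) (simp add: abs_square_le_1 power_le_one)
  also have "1 - (norm a)\<^sup>2 \<le> 2 * (1 - norm a)" using power2_diff[of 1 "norm a"] zero_le_power2[of "1 - norm a"] by simp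
  also have "norm (cnj a * (a - z)) \<le> 1 * norm (a - z)"
    using a unfolding norm_mult by (intro mult_right_mono) auto
  also have "1 * norm (a - z) \<le> N / 2" using s N unfolding sN by simp
  finally have N4: "N \<le> 4 * (1 - norm a)" by simp
  then have "norm (\<sigma> a z) * N \<le> norm (\<sigma> a z) * (4 * (1 - norm a))" by (intro mult_left_mono) auto
  then show "norm (a - z) \<le> 4 * (1 - norm a) * norm (\<sigma> a z)" by (simp add: sN mult_ac)
  have "(norm (\<sigma> a z))\<^sup>2 \<le> (1 / 2)\<^sup>2" using s by (intro power_mono) auto
  then have "3 / 4 \<le> 1 - (norm (\<sigma> a z))\<^sup>2" by (simp add: power2_eq_square)
  then have "3 / 4 \<le> (1 - (norm a)\<^sup>2) * (1 - (norm z)\<^sup>2) / N\<^sup>2"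
    unfolding one_minus_sigma_squared[OF a z] N_def .
  then have "3 / 4 * N\<^sup>2 \<le> (1 - (norm a)\<^sup>2) * (1 - (norm z)\<^sup>2)"
    using N by (simp add: field_simps)
  also have "\<dots> \<le> (2 * (1 - norm a)) * (2 * (1 - norm z))"
    using a z power2_diff[of 1 "norm a"] zero_le_power2[of "1 - norm a"] power2_diff[of 1 "norm z"] zero_le_power2[of "1 - norm z"]
    by (intro mult_mono) (auto simp: abs_square_le_1 power_le_one)
  finally have "3 / 4 * N\<^sup>2 \<le> 4 * ((1 - norm a) * (1 - norm z))" by (simp add: algebra_simps)
  moreover have "(1 - norm a) * (1 - norm a) \<le> N\<^sup>2"
    using N a unfolding power2_eq_square by (intro mult_mono) auto
  ultimately have "3 / 4 * ((1 - norm a) * (1 - norm a)) \<le> 4 * ((1 - norm a) * (1 - norm z))" by linarith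
  then have "(1 - norm a) * (3 / 4 * (1 - norm a)) \<le> (1 - norm a) * (4 * (1 - norm z))"
    by (simp only: mult.left_commute)
  then have "3 / 4 * (1 - norm a) \<le> 4 * (1 - norm z)" using a by (simp only: mult_le_cancel_left_pos diff_gt_0_iff_gt)
  then show "1 - norm a \<le> 6 * (1 - norm z)" using z by simp
qed

text \<open>Near the pole the logarithm is replaced by a sum of indicator functions of shrinking balls, whose
  areas form a geometric series.\<close>
lemma green_powr_le_near:
  assumes p: "0 < p" "p \<le> 1" and a: "norm a < 1" and z: "norm z < 1" and s: "norm (\<sigma> a z) < 1 / 2"
  shows "ennreal (green z a powr p) \<le> 2 * (\<Sum>n. indicator (ball a (5 * (1 - norm a) / 2 ^ n)) z)"
proof (cases "norm (\<sigma> a z) = 0")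
  case True
  then show ?thesis by (simp add: green_def)
next
  case False
  define s where "s = norm (\<sigma> a z)"
  have s: "0 < s" "s < 1 / 2" using False s by (auto simp: s_def)
  have g: "green z a = ln (1 / s)" by (simp add: green_def s_def)
  have g0: "0 \<le> ln (1 / s)" using s by simp
  have "ln (1 / s) powr p \<le> (1 + ln (1 / s)) powr p" using p g0 by (intro powr_mono2) auto
  also have "\<dots> \<le> 1 + ln (1 / s)" using p g0 by (intro powr_le_self_of_ge_one) auto
  finally have "ennreal (green z a powr p) \<le> ennreal (1 + ln (1 / s))" by (simp add: g ennreal_leI)
  also have "\<dots> \<le> 2 * (\<Sum>n. indicator {..<1 / 2 ^ n} s)" using s by (intro one_plus_ln_le_suminf) auto
  also have "\<dots> \<le> 2 * (\<Sum>n. indicator (ball a (5 * (1 - norm a) / 2 ^ n)) z)"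
  proof (intro mult_left_mono suminf_le summableI)
    fix n
    have "z \<in> ball a (5 * (1 - norm a) / 2 ^ n)" if "s < 1 / 2 ^ n"
    proof -
      have "norm (a - z) \<le> 4 * (1 - norm a) * s"
        unfolding s_def by (rule near_diagonal(2)[OF a z]) (use s in \<open>simp add: s_def\<close>)
      also have "\<dots> \<le> 4 * (1 - norm a) * (1 / 2 ^ n)" using that a by (intro mult_left_mono) auto
      also have "\<dots> < 5 * (1 - norm a) * (1 / 2 ^ n)" using a by (intro mult_strict_right_mono) auto
      finally show ?thesis by (simp add: dist_norm)
    qed
    then show "indicator {..<1 / 2 ^ n} s \<le> (indicator (ball a (5 * (1 - norm a) / 2 ^ n)) z :: ennreal)"
      by (auto simp: indicator_def)
  qed auto
  finally show ?thesis .
qed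

section \<open>Sums of molecules: the seminorm\<close>

lemma pred_ball [measurable]: "Measurable.pred borel (\<lambda>z::'a::metric_space. z \<in> ball a r)"
  using borel_open[OF open_ball[of a r]] by (simp add: pred_def ball_def)

context dyadic_arcs
begin

text \<open>The pointwise bound is integrated term by term over \<open>{z. hdist a z < \<rho>}\<close>.  The near terms
  contribute at most a multiple of \<open>\<Sum> x I\<close> over \<open>hdist (arc_pt I) a < 2 * \<rho>\<close>, the far ones at most a
  multiple of \<open>\<rho>\<^sup>2 * (\<Sum> x I * hdist (arc_pt I) a powr -2)\<close>; both are \<open>O(\<rho> powr p)\<close> because \<open>x\<close> is admissible.\<close>
lemma carleson_box_bound:
  assumes p: "0 < p" "p \<le> 1" and ad: "admissible p S x" and f: "dominated_by_molecules p S x f"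
    and a: "a \<in> unit_disc" and \<rho>: "0 < \<rho>"
  shows "(\<integral>\<^sup>+z\<in>{z\<in>unit_disc. hdist a z < \<rho>}. ennreal ((norm (f z))\<^sup>2 * (1 - norm z) powr p) \<partial>dA)
    \<le> ennreal (carleson_const p * \<rho> powr p)"
proof -
  let ?E = "{z\<in>unit_disc. hdist a z < \<rho>}"
  have S: "finite S" "S \<subseteq> Dy" and x: "\<And>I. 0 \<le> x I" using ad by (auto simp: admissible_def)
  have P: "0 \<le> pointwise_const p" using p by (simp add: pointwise_const_nonneg)
  define L where "L = layer_const 2 (4 - p)"
  define L' where "L' = layer_const p 2"
  have L: "0 \<le> L" "0 \<le> L'" unfolding L_def L'_def using p by (auto intro!: layer_const_nonneg)
  define d where "d I = hdist (arc_pt I) a" for I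
  have [measurable]: "?E \<in> sets borel" unfolding hdist_def by measurable
  have [measurable]: "(\<lambda>z. hdist (arc_pt I) z) \<in> borel_measurable borel" for I unfolding hdist_def by measurable
  have "(\<integral>\<^sup>+z\<in>?E. ennreal ((norm (f z))\<^sup>2 * (1 - norm z) powr p) \<partial>dA)
     \<le> (\<integral>\<^sup>+z. ennreal (pointwise_const p) * (\<Sum>I\<in>S. ennreal (x I * arc_length I powr (2 - p)) *
           (ennreal (hdist (arc_pt I) z powr -(4 - p)) * indicator ?E z)) \<partial>dA)"
  proof (intro nn_integral_mono)
    fix z
    show "ennreal ((norm (f z))\<^sup>2 * (1 - norm z) powr p) * indicator ?E z \<le>
      ennreal (pointwise_const p) * (\<Sum>I\<in>S. ennreal (x I * arc_length I powr (2 - p)) *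
           (ennreal (hdist (arc_pt I) z powr -(4 - p)) * indicator ?E z))"
    proof (cases "z \<in> ?E")
      case True
      then have z: "z \<in> unit_disc" by simp
      have "(norm (f z))\<^sup>2 * (1 - norm z) powr p \<le> pointwise_const p * (1 - norm z) powr -p *
         (\<Sum>I\<in>S. x I * arc_length I powr (2 - p) * hdist (arc_pt I) z powr -(4 - p)) * (1 - norm z) powr p"
        by (intro mult_right_mono pointwise_bound[OF p ad f z]) auto
      also have "\<dots> = pointwise_const p * ((1 - norm z) powr -p * (1 - norm z) powr p) *
         (\<Sum>I\<in>S. x I * arc_length I powr (2 - p) * hdist (arc_pt I) z powr -(4 - p))" by simp
      also have "(1 - norm z) powr -p * (1 - norm z) powr p = 1" using z by (simp add: powr_add[symmetric])
      finally have "ennreal ((norm (f z))\<^sup>2 * (1 - norm z) powr p) \<le> ennreal (pointwise_const p *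
         (\<Sum>I\<in>S. x I * arc_length I powr (2 - p) * hdist (arc_pt I) z powr -(4 - p)))"
        by (simp add: ennreal_leI)
      also have "\<dots> = ennreal (pointwise_const p) * (\<Sum>I\<in>S. ennreal (x I * arc_length I powr (2 - p)) *
           ennreal (hdist (arc_pt I) z powr -(4 - p)))"
        using x P by (simp add: ennreal_mult sum_nonneg sum_ennreal[symmetric] del: sum_ennreal)
      finally show ?thesis using True by simp
    qed simp
  qed
  also have "\<dots> = ennreal (pointwise_const p) * (\<Sum>I\<in>S. ennreal (x I * arc_length I powr (2 - p)) *
           (\<integral>\<^sup>+z\<in>?E. ennreal (hdist (arc_pt I) z powr -(4 - p)) \<partial>dA))"
  proof -
    define q where "q I z = ennreal (hdist (arc_pt I) z powr -(4 - p)) * indicator ?E z" for I z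
    have "q I \<in> borel_measurable borel" for I unfolding q_def by measurable
    then have [measurable]: "q I \<in> borel_measurable dA" for I by (rule borel_measurable_dA)
    show ?thesis unfolding q_def[symmetric] by (simp add: nn_integral_cmult nn_integral_sum)
  qed
  also have "\<dots> \<le> ennreal (pointwise_const p) * (\<Sum>I\<in>S. ennreal (x I * (4 * L * (if d I < 2 * \<rho> then 1 else 0)
          + 64 * \<rho>\<^sup>2 * max (2 * \<rho>) (d I) powr -2)))"
  proof (intro mult_left_mono sum_mono)
    fix I assume "I \<in> S"
    then have I: "I \<in> Dy" using S by auto
    have "ennreal (x I * arc_length I powr (2 - p)) * (\<integral>\<^sup>+z\<in>?E. ennreal (hdist (arc_pt I) z powr -(4 - p)) \<partial>dA)
      = ennreal (x I) * (ennreal (arc_length I powr (2 - p)) * (\<integral>\<^sup>+z\<in>?E. ennreal (hdist (arc_pt I) z powr -(4 - p)) \<partial>dA))"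
      using x by (simp add: ennreal_mult mult.assoc)
    also have "\<dots> \<le> ennreal (x I) * ennreal (4 * L * (if d I < 2 * \<rho> then 1 else 0)
          + 64 * \<rho>\<^sup>2 * max (2 * \<rho>) (d I) powr -2)"
      unfolding L_def d_def by (intro mult_left_mono molecule_local_integral_le p I a \<rho>) auto
    also have "\<dots> = ennreal (x I * (4 * L * (if d I < 2 * \<rho> then 1 else 0)
          + 64 * \<rho>\<^sup>2 * max (2 * \<rho>) (d I) powr -2))"
      using x L by (subst ennreal_mult) auto
    finally show "ennreal (x I * arc_length I powr (2 - p)) * (\<integral>\<^sup>+z\<in>?E. ennreal (hdist (arc_pt I) z powr -(4 - p)) \<partial>dA)
      \<le> ennreal (x I * (4 * L * (if d I < 2 * \<rho> then 1 else 0) + 64 * \<rho>\<^sup>2 * max (2 * \<rho>) (d I) powr -2))" .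
  qed auto
  also have "\<dots> = ennreal (pointwise_const p * (\<Sum>I\<in>S. x I * (4 * L * (if d I < 2 * \<rho> then 1 else 0)
          + 64 * \<rho>\<^sup>2 * max (2 * \<rho>) (d I) powr -2)))"
    using x L P by (subst sum_ennreal) (auto intro!: ennreal_mult[symmetric] sum_nonneg)
  also have "pointwise_const p * (\<Sum>I\<in>S. x I * (4 * L * (if d I < 2 * \<rho> then 1 else 0)
          + 64 * \<rho>\<^sup>2 * max (2 * \<rho>) (d I) powr -2)) \<le> pointwise_const p * (352800 * L + 2822400 * L') * \<rho> powr p"
  proof -
    have "(\<Sum>I\<in>S. x I * (4 * L * (if d I < 2 * \<rho> then 1 else 0) + 64 * \<rho>\<^sup>2 * max (2 * \<rho>) (d I) powr -2))
       = 4 * L * (\<Sum>I\<in>S. if d I < 2 * \<rho> then x I else 0) + 64 * \<rho>\<^sup>2 * (\<Sum>I\<in>S. x I * max (2 * \<rho>) (d I) powr -2)"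
      unfolding sum_distrib_left sum.distrib[symmetric] by (intro sum.cong) (auto simp: algebra_simps)
    also have "(\<Sum>I\<in>S. if d I < 2 * \<rho> then x I else 0) = (\<Sum>I\<in>{I\<in>S. d I < 2 * \<rho>}. x I)"
      using S by (simp add: sum.inter_filter)
    also have "\<dots> \<le> 44100 * (2 * \<rho>) powr p"
      unfolding d_def using \<rho> by (intro admissible_near[OF p ad a]) auto
    also have "(\<Sum>I\<in>S. x I * max (2 * \<rho>) (d I) powr -2) \<le> 44100 * L' * (2 * \<rho>) powr (p - 2)"
      unfolding L'_def d_def by (rule sum_layers[OF S(1)]) (use p \<rho> x admissible_near[OF p ad a] in auto)
    finally have "(\<Sum>I\<in>S. x I * (4 * L * (if d I < 2 * \<rho> then 1 else 0) + 64 * \<rho>\<^sup>2 * max (2 * \<rho>) (d I) powr -2))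
       \<le> 4 * L * (44100 * (2 * \<rho>) powr p) + 64 * \<rho>\<^sup>2 * (44100 * L' * (2 * \<rho>) powr (p - 2))"
      using L by (simp add: mult_left_mono)
    also have "\<dots> \<le> 4 * L * (44100 * (2 * \<rho> powr p)) + 64 * (44100 * L' * \<rho> powr p)"
    proof (rule add_mono)
      have "(2 * \<rho>) powr p \<le> 2 * \<rho> powr p" using powr_le_self_of_ge_one[of 2 p] p \<rho> by (simp add: powr_mult)
      then show "4 * L * (44100 * (2 * \<rho>) powr p) \<le> 4 * L * (44100 * (2 * \<rho> powr p))"
        using L by (intro mult_left_mono) auto
      have "\<rho>\<^sup>2 * (2 * \<rho>) powr (p - 2) \<le> \<rho>\<^sup>2 * \<rho> powr (p - 2)"
        using \<rho> p by (intro mult_left_mono powr_mono2') auto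
      also have "\<dots> = \<rho> powr p" using \<rho> powr_add[of \<rho> 2 "p - 2"] by (simp add: powr_numeral)
      finally have "(64 * 44100 * L') * (\<rho>\<^sup>2 * (2 * \<rho>) powr (p - 2)) \<le> (64 * 44100 * L') * \<rho> powr p"
        using L by (intro mult_left_mono) auto
      then show "64 * \<rho>\<^sup>2 * (44100 * L' * (2 * \<rho>) powr (p - 2)) \<le> 64 * (44100 * L' * \<rho> powr p)"
        by (simp add: mult_ac)
    qed
    also have "\<dots> = (352800 * L + 2822400 * L') * \<rho> powr p" by (simp add: algebra_simps)
    finally show ?thesis using P by (simp only: mult.assoc mult_left_mono)
  qed
  finally show ?thesis by (simp add: carleson_const_def L_def L'_def ennreal_leI)
qed

lemma carleson_const_nonneg: "0 < p \<Longrightarrow> p \<le> 1 \<Longrightarrow> 0 \<le> carleson_const p"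
  unfolding carleson_const_def
  by (intro mult_nonneg_nonneg add_nonneg_nonneg pointwise_const_nonneg layer_const_nonneg) auto

lemma growth_const_nonneg: "0 < p \<Longrightarrow> p \<le> 1 \<Longrightarrow> 0 \<le> growth_const p"
  unfolding growth_const_def
  by (intro mult_nonneg_nonneg pointwise_const_nonneg layer_const_nonneg) auto

text \<open>The layer estimate for the measure \<open>|f|\<^sup>2 (1 - |z|)^p dA\<close>, with \<open>r = 1 - norm a\<close> and \<open>\<gamma> = 2 * p\<close>.\<close>
lemma carleson_kernel_bound:
  assumes p: "0 < p" "p \<le> 1" and ad: "admissible p S x" and f: "dominated_by_molecules p S x f"
    and fm [measurable]: "f \<in> borel_measurable borel" and a: "a \<in> unit_disc"
  shows "(\<integral>\<^sup>+z\<in>unit_disc. ennreal ((norm (f z))\<^sup>2 * (1 - norm z) powr p * hdist a z powr -(2 * p)) \<partial>dA)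
    \<le> ennreal (carleson_const p * layer_const p (2 * p) * (1 - norm a) powr -p)"
proof -
  define k where "k z = ennreal ((norm (f z))\<^sup>2 * (1 - norm z) powr p) * indicator unit_disc z" for z
  have [measurable]: "(\<lambda>z. hdist a z) \<in> borel_measurable borel" unfolding hdist_def by measurable
  have "k \<in> borel_measurable borel" unfolding k_def by measurable
  then have k [measurable]: "k \<in> borel_measurable dA" by (rule borel_measurable_dA)
  have hm: "hdist a \<in> borel_measurable dA" by (rule borel_measurable_dA) measurable
  have r: "0 < 1 - norm a" using a by simp
  have "(\<integral>\<^sup>+z\<in>unit_disc. ennreal ((norm (f z))\<^sup>2 * (1 - norm z) powr p * hdist a z powr -(2 * p)) \<partial>dA)
      = (\<integral>\<^sup>+z. k z * ennreal (max (1 - norm a) (hdist a z) powr -(2 * p)) \<partial>dA)"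
  proof (intro nn_integral_cong)
    fix z
    have "1 - norm a \<le> hdist a z" if "norm z < 1" using that norm_ge_zero[of "a - z"] by (simp add: hdist_def add_increasing2 del: norm_ge_zero)
    then show "ennreal ((norm (f z))\<^sup>2 * (1 - norm z) powr p * hdist a z powr -(2 * p)) * indicator unit_disc z
      = k z * ennreal (max (1 - norm a) (hdist a z) powr -(2 * p))"
      by (auto simp: k_def indicator_def max_absorb2 ennreal_mult)
  qed
  also have "\<dots> = (\<integral>\<^sup>+z. ennreal (max (1 - norm a) (hdist a z) powr -(2 * p)) \<partial>density dA k)"
    using hm by (intro nn_integral_density[symmetric]) auto
  also have "\<dots> \<le> ennreal (carleson_const p * layer_const p (2 * p) * (1 - norm a) powr (p - 2 * p))"
  proof (rule nn_integral_layers)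
    fix \<rho> :: real assume \<rho>: "0 < \<rho>"
    have "{z \<in> space (density dA k). hdist a z < \<rho>} \<in> sets dA"
      using hm by simp
    then have "emeasure (density dA k) {z \<in> space (density dA k). hdist a z < \<rho>}
        = (\<integral>\<^sup>+z. k z * indicator {z. hdist a z < \<rho>} z \<partial>dA)"
      by (subst emeasure_density) auto
    also have "\<dots> = (\<integral>\<^sup>+z\<in>{z\<in>unit_disc. hdist a z < \<rho>}. ennreal ((norm (f z))\<^sup>2 * (1 - norm z) powr p) \<partial>dA)"
      by (intro nn_integral_cong) (auto simp: k_def indicator_def)
    also have "\<dots> \<le> ennreal (carleson_const p * \<rho> powr p)"
      by (rule carleson_box_bound[OF p ad f a \<rho>])
    finally show "emeasure (density dA k) {z \<in> space (density dA k). hdist a z < \<rho>} \<le> ennreal (carleson_const p * \<rho> powr p)" .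
  qed (use p r hm carleson_const_nonneg[OF p] in auto)
  finally show ?thesis by simp
qed

text \<open>Where \<open>|\<sigma> a z| \<ge> 1 / 2\<close> the Green function is controlled by \<open>carleson_kernel_bound\<close>; the rest is a
  region of area comparable to \<open>(1 - |a|)\<^sup>2\<close> on which \<open>|f|\<^sup>2\<close> is at most a multiple of \<open>(1 - |a|) powr -2\<close>.\<close>
lemma green_integral_bound:
  assumes p: "0 < p" "p \<le> 1" and ad: "admissible p S x" and f: "dominated_by_molecules p S x f"
    and fm [measurable]: "f \<in> borel_measurable borel" and a: "a \<in> unit_disc"
  shows "(\<integral>\<^sup>+z\<in>unit_disc. ennreal ((norm (f z))\<^sup>2 * green z a powr p) \<partial>dA) \<le> ennreal (test_const p)"
proof -
  define \<delta> where "\<delta> = 1 - norm a"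
  have \<delta>: "0 < \<delta>" using a by (simp add: \<delta>_def)
  define G where "G = growth_const p"
  have G: "0 \<le> G" using growth_const_nonneg[OF p] by (simp add: G_def)
  define A where "A z = ennreal ((norm (f z))\<^sup>2 * (1 - norm z) powr p * hdist a z powr -(2 * p)) * indicator unit_disc z" for z
  define B :: "complex \<Rightarrow> ennreal" where "B z = (\<Sum>n. indicator (ball a (5 * \<delta> / 2 ^ n)) z)" for z
  have [measurable]: "(\<lambda>z. hdist a z) \<in> borel_measurable borel" unfolding hdist_def by measurable
  have "A \<in> borel_measurable borel" "B \<in> borel_measurable borel" unfolding A_def B_def by measurable
  then have [measurable]: "A \<in> borel_measurable dA" "B \<in> borel_measurable dA" by (simp_all add: borel_measurable_dA)
  have pt: "ennreal ((norm (f z))\<^sup>2 * green z a powr p) * indicator unit_disc z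
     \<le> ennreal (72 * \<delta> powr p) * A z + ennreal (72 * G * \<delta> powr -2) * B z" for z
  proof (cases "z \<in> unit_disc")
    case z: True
    show ?thesis
    proof (cases "1 / 2 \<le> norm (\<sigma> a z)")
      case True
      have "(norm (f z))\<^sup>2 * green z a powr p \<le> (norm (f z))\<^sup>2 * (72 * \<delta> powr p * (1 - norm z) powr p * hdist a z powr -(2 * p))"
        unfolding \<delta>_def using green_powr_le_far[OF p _ _ True] a z by (intro mult_left_mono) auto
      also have "\<dots> = 72 * \<delta> powr p * ((norm (f z))\<^sup>2 * (1 - norm z) powr p * hdist a z powr -(2 * p))" by simp
      finally have "ennreal ((norm (f z))\<^sup>2 * green z a powr p) \<le> ennreal (72 * \<delta> powr p) * A z"
        using z by (simp add: A_def ennreal_mult[symmetric] ennreal_leI)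
      then show ?thesis using z by (simp add: add_increasing2)
    next
      case False
      then have s: "norm (\<sigma> a z) < 1 / 2" by simp
      have "\<delta> \<le> 6 * (1 - norm z)" unfolding \<delta>_def by (rule near_diagonal(1)[OF _ _ s]) (use a z in auto)
      then have "(1 - norm z) powr -2 \<le> (\<delta> / 6) powr -2" using \<delta> by (intro powr_mono2') auto
      also have "\<dots> = 36 * \<delta> powr -2" using \<delta> by (simp add: powr_minus powr_numeral power_divide field_simps)
      finally have "growth_const p * (1 - norm z) powr -2 \<le> G * (36 * \<delta> powr -2)"
        using G unfolding G_def by (intro mult_left_mono) auto
      then have f2: "(norm (f z))\<^sup>2 \<le> 36 * G * \<delta> powr -2" using growth_bound[OF p ad f z] by simp
      have "ennreal ((norm (f z))\<^sup>2 * green z a powr p) = ennreal ((norm (f z))\<^sup>2) * ennreal (green z a powr p)"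
        by (simp add: ennreal_mult)
      also have "\<dots> \<le> ennreal (36 * G * \<delta> powr -2) * (2 * B z)"
        unfolding B_def \<delta>_def using f2 green_powr_le_near[OF p _ _ s] a z
        by (intro mult_mono) (auto simp: \<delta>_def intro!: ennreal_leI)
      also have "\<dots> = ennreal (72 * G * \<delta> powr -2) * B z"
      proof -
        have "ennreal (72 * G * \<delta> powr -2) = ennreal (36 * G * \<delta> powr -2) * ennreal 2"
          using G by (subst ennreal_mult[symmetric]) auto
        then show ?thesis by (simp add: mult.assoc)
      qed
      finally show ?thesis using z by (simp add: add_increasing)
    qed
  qed simp
  have "(\<integral>\<^sup>+z\<in>unit_disc. ennreal ((norm (f z))\<^sup>2 * green z a powr p) \<partial>dA)
     \<le> (\<integral>\<^sup>+z. ennreal (72 * \<delta> powr p) * A z + ennreal (72 * G * \<delta> powr -2) * B z \<partial>dA)"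
    by (intro nn_integral_mono pt)
  also have "\<dots> = ennreal (72 * \<delta> powr p) * (\<integral>\<^sup>+z. A z \<partial>dA) + ennreal (72 * G * \<delta> powr -2) * (\<integral>\<^sup>+z. B z \<partial>dA)"
    by (simp add: nn_integral_add nn_integral_cmult)
  also have "\<dots> \<le> ennreal (72 * \<delta> powr p) * ennreal (carleson_const p * layer_const p (2 * p) * \<delta> powr -p)
      + ennreal (72 * G * \<delta> powr -2) * ennreal (4 / 3 * (5 * \<delta>)\<^sup>2)"
    unfolding A_def B_def using \<delta>
    by (intro add_mono mult_left_mono nn_integral_small_balls_le carleson_kernel_bound[OF p ad f fm a, folded \<delta>_def]) auto
  also have "\<dots> = ennreal (72 * (carleson_const p * layer_const p (2 * p)) + 2400 * G)"
  proof -
    have 1: "\<delta> powr p * \<delta> powr -p = 1" using \<delta> by (simp add: powr_add[symmetric])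
    have 2: "\<delta> powr -2 * \<delta>\<^sup>2 = 1" using \<delta> by (simp add: powr_minus powr_numeral)
    define c where "c = carleson_const p * layer_const p (2 * p)"
    have c: "0 \<le> c"
      using carleson_const_nonneg[OF p] layer_const_nonneg[of p "2 * p"] p by (simp add: c_def)
    have e1: "72 * \<delta> powr p * (c * \<delta> powr -p) = 72 * c"
    proof -
      have "72 * \<delta> powr p * (c * \<delta> powr -p) = 72 * c * (\<delta> powr p * \<delta> powr -p)" by (simp only: mult_ac)
      then show ?thesis by (simp only: 1 mult_1_right)
    qed
    have e2: "72 * G * \<delta> powr -2 * (4 / 3 * (5 * \<delta>)\<^sup>2) = 2400 * G"
    proof -
      have "72 * G * \<delta> powr -2 * (4 / 3 * (5 * \<delta>)\<^sup>2) = 2400 * G * (\<delta> powr -2 * \<delta>\<^sup>2)"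
        by (simp add: power_mult_distrib)
      then show ?thesis by (simp only: 2 mult_1_right)
    qed
    have "ennreal (72 * \<delta> powr p) * ennreal (c * \<delta> powr -p) = ennreal (72 * c)"
      using c by (subst ennreal_mult[symmetric]) (auto simp only: e1 powr_ge_zero mult_nonneg_nonneg zero_le_numeral)
    moreover have "ennreal (72 * G * \<delta> powr -2) * ennreal (4 / 3 * (5 * \<delta>)\<^sup>2) = ennreal (2400 * G)"
      using G by (subst ennreal_mult[symmetric]) (simp_all only: e2, auto)
    ultimately show ?thesis using c G by (simp only: c_def[symmetric]) (simp add: ennreal_plus)
  qed
  finally show ?thesis by (simp add: test_const_def G_def)
qed

end

section \<open>The gauge is bounded by the embedding constant\<close>

text \<open>By the parallelogram law, \<open>\<integral> |G + v|\<^sup>2 w\<close> and \<open>\<integral> |G - v|\<^sup>2 w\<close> have mean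
  \<open>\<integral> |G|\<^sup>2 w + \<integral> |v|\<^sup>2 w\<close>, so one of them is at least this mean; the signs are chosen
  one after the other.\<close>
lemma exists_signs_orthogonal:
  fixes v :: "'i \<Rightarrow> 'a \<Rightarrow> complex" and w :: "'a \<Rightarrow> ennreal"
  assumes S: "finite S" and v [measurable]: "\<And>i. v i \<in> borel_measurable M" and w [measurable]: "w \<in> borel_measurable M"
  shows "\<exists>\<epsilon> :: 'i \<Rightarrow> real. (\<forall>i. \<bar>\<epsilon> i\<bar> = 1) \<and>
    (\<Sum>i\<in>S. \<integral>\<^sup>+z. ennreal ((norm (v i z))\<^sup>2) * w z \<partial>M)
      \<le> (\<integral>\<^sup>+z. ennreal ((norm (\<Sum>i\<in>S. of_real (\<epsilon> i) * v i z))\<^sup>2) * w z \<partial>M)"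
  using S
proof (induction S rule: finite_induct)
  case empty
  show ?case by (intro exI[of _ "\<lambda>_. 1"]) auto
next
  case (insert j S)
  then obtain \<epsilon> :: "'i \<Rightarrow> real" where \<epsilon>: "\<And>i. \<bar>\<epsilon> i\<bar> = 1"
    and le: "(\<Sum>i\<in>S. \<integral>\<^sup>+z. ennreal ((norm (v i z))\<^sup>2) * w z \<partial>M)
      \<le> (\<integral>\<^sup>+z. ennreal ((norm (\<Sum>i\<in>S. of_real (\<epsilon> i) * v i z))\<^sup>2) * w z \<partial>M)" by auto
  define G where "G z = (\<Sum>i\<in>S. of_real (\<epsilon> i) * v i z)" for z
  have [measurable]: "G \<in> borel_measurable M" unfolding G_def by measurable
  define X where "X = (\<integral>\<^sup>+z. ennreal ((norm (G z))\<^sup>2) * w z \<partial>M)"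
  define Y where "Y = (\<integral>\<^sup>+z. ennreal ((norm (v j z))\<^sup>2) * w z \<partial>M)"
  define A where "A s = (\<integral>\<^sup>+z. ennreal ((norm (G z + of_real s * v j z))\<^sup>2) * w z \<partial>M)" for s :: real
  have par: "(norm (a + b))\<^sup>2 + (norm (a - b))\<^sup>2 = 2 * (norm a)\<^sup>2 + 2 * (norm b)\<^sup>2" for a b :: complex
    by (simp only: cmod_power2) (simp add: power2_eq_square algebra_simps)
  have "A 1 + A (-1) = (\<integral>\<^sup>+z. ennreal ((norm (G z + v j z))\<^sup>2) * w z + ennreal ((norm (G z - v j z))\<^sup>2) * w z \<partial>M)"
    unfolding A_def by (subst nn_integral_add[symmetric]) auto
  also have "\<dots> = (\<integral>\<^sup>+z. 2 * (ennreal ((norm (G z))\<^sup>2) * w z) + 2 * (ennreal ((norm (v j z))\<^sup>2) * w z) \<partial>M)"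
  proof (intro nn_integral_cong)
    fix z
    have "ennreal ((norm (G z + v j z))\<^sup>2) * w z + ennreal ((norm (G z - v j z))\<^sup>2) * w z
       = ennreal ((norm (G z + v j z))\<^sup>2 + (norm (G z - v j z))\<^sup>2) * w z"
      by (simp add: ennreal_plus distrib_right)
    also have "\<dots> = (ennreal 2 * ennreal ((norm (G z))\<^sup>2) + ennreal 2 * ennreal ((norm (v j z))\<^sup>2)) * w z"
      unfolding par by (simp add: ennreal_plus ennreal_mult)
    finally show "ennreal ((norm (G z + v j z))\<^sup>2) * w z + ennreal ((norm (G z - v j z))\<^sup>2) * w z
       = 2 * (ennreal ((norm (G z))\<^sup>2) * w z) + 2 * (ennreal ((norm (v j z))\<^sup>2) * w z)"
      by (simp add: distrib_right mult.assoc)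
  qed
  also have "\<dots> = 2 * (X + Y)"
    unfolding X_def Y_def by (simp add: nn_integral_add nn_integral_cmult distrib_left)
  finally have sum: "A 1 + A (-1) = 2 * (X + Y)" .
  have "2 * (X + Y) = A 1 + A (-1)" by (rule sum[symmetric])
  also have "\<dots> \<le> max (A 1) (A (-1)) + max (A 1) (A (-1))" by (intro add_mono) auto
  also have "\<dots> = 2 * max (A 1) (A (-1))" by (rule mult_2[symmetric])
  finally have "X + Y \<le> max (A 1) (A (-1))"
    by (rule ennreal_mult_le_mult_iff[THEN iffD1, rotated 2]) auto
  then obtain s :: real where s: "s = 1 \<or> s = -1" "X + Y \<le> A s" by (auto simp: max_def split: if_splits)
  define \<epsilon>' where "\<epsilon>' = \<epsilon>(j := s)"
  have eq: "(\<Sum>i\<in>insert j S. of_real (\<epsilon>' i) * v i z) = G z + of_real s * v j z" for z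
  proof -
    have "(\<Sum>i\<in>S. of_real (\<epsilon>' i) * v i z) = G z"
      unfolding G_def using insert.hyps by (intro sum.cong) (auto simp: \<epsilon>'_def)
    then show ?thesis using insert.hyps by (simp add: \<epsilon>'_def add.commute)
  qed
  have "(\<Sum>i\<in>insert j S. \<integral>\<^sup>+z. ennreal ((norm (v i z))\<^sup>2) * w z \<partial>M) \<le> Y + X"
    using insert.hyps le by (simp add: Y_def X_def G_def add_left_mono)
  also have "\<dots> \<le> A s" using s(2) by (simp add: add.commute)
  finally have "(\<Sum>i\<in>insert j S. \<integral>\<^sup>+z. ennreal ((norm (v i z))\<^sup>2) * w z \<partial>M)
     \<le> (\<integral>\<^sup>+z. ennreal ((norm (\<Sum>i\<in>insert j S. of_real (\<epsilon>' i) * v i z))\<^sup>2) * w z \<partial>M)"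
    unfolding eq A_def .
  moreover have "\<bar>\<epsilon>' i\<bar> = 1" for i using \<epsilon> s(1) by (auto simp: \<epsilon>'_def)
  ultimately show ?case by blast
qed

lemma molecule_primitive:
  fixes b c z :: complex
  assumes b: "b \<noteq> 0" and z: "1 - b * z \<noteq> 0"
  shows "((\<lambda>z. c / (2 * b * (1 - b * z)\<^sup>2)) has_field_derivative c / (1 - b * z) ^ 3) (at z)"
proof -
  have "((\<lambda>z. (1 - b * z)\<^sup>2) has_field_derivative 2 * (1 - b * z) * (- b)) (at z)"
    by (auto intro!: derivative_eq_intros)
  then have "((\<lambda>z. c / (2 * b) * inverse ((1 - b * z)\<^sup>2)) has_field_derivative
      c / (2 * b) * - (inverse ((1 - b * z)\<^sup>2) * (2 * (1 - b * z) * (- b)) * inverse ((1 - b * z)\<^sup>2))) (at z)"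
    using z by (intro DERIV_cmult DERIV_inverse') auto
  moreover have "c / (2 * b) * inverse ((1 - b * z)\<^sup>2) = c / (2 * b * (1 - b * z)\<^sup>2)" for z
    by (simp only: divide_inverse inverse_mult_distrib mult.assoc)
  moreover have "c / (2 * b) * - (inverse (u\<^sup>2) * (2 * u * (- b)) * inverse (u\<^sup>2)) = c / u ^ 3" if "u \<noteq> 0" for u
    using b that by (simp add: field_simps power2_eq_square power3_eq_cube)
  note this[OF z]
  ultimately show ?thesis by (simp only:)
qed

lemma weight_measurable:
  assumes "locally_integrable_disc W"
  shows "(\<lambda>z. ennreal (W z) * indicator unit_disc z) \<in> borel_measurable dA"
proof -
  have "(\<lambda>z. indicator (cball 0 (1 - 1 / real (Suc n))) z *\<^sub>R W z) \<in> borel_measurable dA" for n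
  proof -
    have "0 < 1 / real (Suc n)" by simp
    then have "cball (0::complex) (1 - 1 / real (Suc n)) \<subseteq> unit_disc" by (simp only: cball_subset_ball_iff) simp
    then have "set_integrable dA (cball 0 (1 - 1 / real (Suc n))) W"
      using assms compact_cball unfolding locally_integrable_disc_def by blast
    then show ?thesis unfolding set_integrable_def by (rule borel_measurable_integrable)
  qed
  moreover have "(\<lambda>n. indicator (cball 0 (1 - 1 / real (Suc n))) z *\<^sub>R W z) \<longlonglongrightarrow> indicator unit_disc z *\<^sub>R W z" for z :: complex
  proof (rule tendsto_eventually)
    show "\<forall>\<^sub>F n in sequentially. indicator (cball 0 (1 - 1 / real (Suc n))) z *\<^sub>R W z = indicator unit_disc z *\<^sub>R W z"
    proof (cases "norm z < 1")
      case True
      then obtain N where N: "inverse (real (Suc N)) < 1 - norm z"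
        using reals_Archimedean[of "1 - norm z"] by auto
      have "z \<in> cball 0 (1 - 1 / real (Suc n))" if "n \<ge> N" for n
      proof -
        have "1 / real (Suc n) \<le> 1 / real (Suc N)" using that by (simp add: frac_le)
        then show ?thesis using N by (simp add: inverse_eq_divide)
      qed
      then show ?thesis using True unfolding eventually_sequentially by (intro exI[of _ N]) (auto simp: indicator_def)
    next
      case False
      have "z \<notin> cball 0 (1 - 1 / real (Suc n))" for n
      proof -
        have "0 < 1 / real (Suc n)" by simp
        then have "\<not> norm z \<le> 1 - 1 / real (Suc n)" using False by linarith
        then show ?thesis by (simp del: of_nat_Suc)
      qed
      then show ?thesis using False by (intro always_eventually) auto
    qed
  qed
  ultimately have "(\<lambda>z. indicator unit_disc z *\<^sub>R W z) \<in> borel_measurable dA"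
    by (rule borel_measurable_LIMSEQ_metric)
  then have "(\<lambda>z. ennreal (indicator unit_disc z *\<^sub>R W z)) \<in> borel_measurable dA" by simp
  also have "(\<lambda>z. ennreal (indicator unit_disc z *\<^sub>R W z)) = (\<lambda>z. ennreal (W z) * indicator unit_disc z)"
    by (auto simp: indicator_def)
  finally show ?thesis .
qed

context dyadic_arcs
begin

lemma Q_up_subset_disc: "I \<in> Dy \<Longrightarrow> Q_up I \<subseteq> unit_disc"
  using Q_upD(2)[OF Dy_arc] arc_length_pos by fastforce

lemma h_weight_finite:
  assumes W: "locally_integrable_disc W" and I: "I \<in> Dy"
  shows "h_weight p W I < \<infinity>"
proof -
  define K where "K = cball (0::complex) (1 - arc_length I / 2)"
  have "Q_up I \<subseteq> K" using Q_upD(2)[OF Dy_arc[OF I]] by (force simp: K_def)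
  then have "(\<integral>\<^sup>+z\<in>Q_up I. ennreal (W z) \<partial>dA) \<le> (\<integral>\<^sup>+z. ennreal (norm (indicator K z *\<^sub>R W z)) \<partial>dA)"
    by (intro nn_integral_mono) (auto simp: indicator_def intro: ennreal_leI)
  also have "\<dots> < \<infinity>"
  proof -
    have "K \<subseteq> unit_disc" unfolding K_def cball_subset_ball_iff using arc_length_pos[OF I] by simp
    then have "set_integrable dA K W"
      using W compact_cball unfolding locally_integrable_disc_def K_def by blast
    then show ?thesis unfolding set_integrable_def by (simp add: integrable_iff_bounded)
  qed
  finally show ?thesis using arc_length_pos[OF I]
    by (auto simp: h_weight_def ennreal_divide_eq_top_iff less_top[symmetric])
qed

lemma cross_norm_le_on_Q_up:
  assumes I: "I \<in> Dy" and z: "z \<in> Q_up I"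
  shows "norm (1 - cnj (arc_pt I) * z) \<le> 14 * arc_length I"
proof -
  have zd: "norm z < 1" using z Q_up_subset_disc[OF I] by auto
  have "norm (arc_pt I - z) \<le> norm (arc_mid I - arc_pt I) + norm (z - arc_mid I)"
    using norm_triangle_ineq[of "arc_pt I - arc_mid I" "arc_mid I - z"] by (simp add: norm_minus_commute)
  also have "\<dots> \<le> arc_length I / 2 + 5 * arc_length I"
    using norm_arc_mid_diff_arc_pt[OF I] Q_upD(3)[OF Dy_arc[OF I] z] by simp
  finally have "hdist (arc_pt I) z \<le> 7 * arc_length I"
    using norm_arc_pt[OF I] Q_upD(1)[OF Dy_arc[OF I] z] by (simp add: hdist_def)
  then show ?thesis
    using cross_norm_le_hdist[of "arc_pt I" z] arc_pt_in_disc[OF I] zd by simp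
qed

lemma molecule_lower:
  assumes p: "0 < p" "p \<le> 1" and x: "0 \<le> x I" and I: "I \<in> Dy" and z: "z \<in> Q_up I"
  shows "x I / arc_length I powr (p + 2) / 14 ^ 6 \<le> (norm (of_real (molecule_coeff p x I) / (1 - cnj (arc_pt I) * z) ^ 3))\<^sup>2"
proof -
  define l N where "l = arc_length I" and "N = norm (1 - cnj (arc_pt I) * z)"
  have l: "0 < l" using arc_length_pos[OF I] by (simp add: l_def)
  have zd: "norm z < 1" using z Q_up_subset_disc[OF I] by auto
  have N: "0 < N" "N \<le> 14 * l"
    using cross_norm_lower(2)[of "arc_pt I" z] arc_pt_in_disc[OF I] zd cross_norm_le_on_Q_up[OF I z]
    by (auto simp: N_def l_def)
  have "x I / l powr (p + 2) / 14 ^ 6 = x I * l powr -p * l ^ 4 / (14 * l) ^ 6"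
    using l by (simp add: powr_add powr_numeral powr_minus power_mult_distrib divide_simps)
  also have "\<dots> \<le> x I * l powr -p * l ^ 4 / N ^ 6"
    using N x l by (intro divide_left_mono power_mono mult_pos_pos mult_nonneg_nonneg) auto
  also have "\<dots> = (molecule_coeff p x I)\<^sup>2 / N ^ 6"
    using x by (simp add: molecule_coeff_def l_def power_mult_distrib)
  also have "\<dots> = (norm (of_real (molecule_coeff p x I) / (1 - cnj (arc_pt I) * z) ^ 3))\<^sup>2"
    by (simp add: N_def norm_divide norm_power power_divide)
  finally show ?thesis by (simp add: l_def)
qed

text \<open>The embedding inequality is tested on a sum of molecules with well chosen signs.\<close>
lemma embedding_bounds_dual_sum:
  assumes p: "0 < p" "p \<le> 1" and W0: "\<And>z. z \<in> unit_disc \<Longrightarrow> 0 \<le> W z" and W: "locally_integrable_disc W"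
    and emb: "embedding_bound p W C" and C: "0 \<le> C" and ad: "admissible p S x"
  shows "(\<Sum>I\<in>S. enn2real (h_weight p W I) * x I) \<le> 14 ^ 6 * test_const p * C"
proof -
  have S: "finite S" "S \<subseteq> Dy" and x: "\<And>I. 0 \<le> x I" using ad by (auto simp: admissible_def)
  define w where "w = (\<lambda>z. ennreal (W z) * indicator unit_disc z)"
  have wm [measurable]: "w \<in> borel_measurable dA" unfolding w_def by (rule weight_measurable[OF W])
  define v where "v I z = of_real (molecule_coeff p x I) / (1 - cnj (arc_pt I) * z) ^ 3" for I z
  have vb [measurable]: "v I \<in> borel_measurable borel" for I unfolding v_def by measurable
  have "\<exists>\<epsilon> :: complex set \<Rightarrow> real. (\<forall>i. \<bar>\<epsilon> i\<bar> = 1) \<and>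
    (\<Sum>i\<in>S. \<integral>\<^sup>+z. ennreal ((norm (v i z))\<^sup>2) * w z \<partial>dA)
      \<le> (\<integral>\<^sup>+z. ennreal ((norm (\<Sum>i\<in>S. of_real (\<epsilon> i) * v i z))\<^sup>2) * w z \<partial>dA)"
    by (intro exists_signs_orthogonal S wm borel_measurable_dA vb)
  then obtain \<epsilon> :: "complex set \<Rightarrow> real" where \<epsilon>: "\<And>i. \<bar>\<epsilon> i\<bar> = 1"
    and le: "(\<Sum>i\<in>S. \<integral>\<^sup>+z. ennreal ((norm (v i z))\<^sup>2) * w z \<partial>dA)
      \<le> (\<integral>\<^sup>+z. ennreal ((norm (\<Sum>i\<in>S. of_real (\<epsilon> i) * v i z))\<^sup>2) * w z \<partial>dA)" by auto
  (* F is the explicit primitive of the signed sum f *)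
  define f where "f z = (\<Sum>I\<in>S. of_real (\<epsilon> I) * v I z)" for z
  define F where "F z = (\<Sum>I\<in>S. of_real (\<epsilon> I * molecule_coeff p x I) / (2 * cnj (arc_pt I) * (1 - cnj (arc_pt I) * z)\<^sup>2))" for z
  have fm: "f \<in> borel_measurable borel" unfolding f_def by measurable
  have nz: "1 - cnj (arc_pt I) * z \<noteq> 0" if "I \<in> S" "z \<in> unit_disc" for I z
    using cross_norm_lower(2)[of "arc_pt I" z] arc_pt_in_disc[of I] that S by auto
  have anz: "cnj (arc_pt I) \<noteq> 0" if "I \<in> S" for I
  proof -
    have "I \<in> Dy" using that S by auto
    then have "norm (arc_pt I) \<noteq> 0" using norm_arc_pt[of I] arc_length_le_1[of I] by simp
    then show ?thesis by simp
  qed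
  have dF: "(F has_field_derivative f z) (at z)" if z: "z \<in> unit_disc" for z
    unfolding F_def f_def
  proof (rule DERIV_sum)
    fix I assume I: "I \<in> S"
    define b where "b = cnj (arc_pt I)"
    have b: "b \<noteq> 0" "1 - b * z \<noteq> 0" using anz[OF I] nz[OF I z] by (auto simp: b_def)
    have "((\<lambda>z. of_real (\<epsilon> I * molecule_coeff p x I) / (2 * b * (1 - b * z)\<^sup>2)) has_field_derivative
       of_real (\<epsilon> I * molecule_coeff p x I) / (1 - b * z) ^ 3) (at z)"
      using b by (rule molecule_primitive)
    also have "of_real (\<epsilon> I * molecule_coeff p x I) / (1 - b * z) ^ 3 = of_real (\<epsilon> I) * v I z"
      by (simp add: v_def b_def)
    finally show "((\<lambda>z. of_real (\<epsilon> I * molecule_coeff p x I) / (2 * cnj (arc_pt I) * (1 - cnj (arc_pt I) * z)\<^sup>2))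
       has_field_derivative of_real (\<epsilon> I) * v I z) (at z)" by (simp add: b_def)
  qed
  have Fhol: "F holomorphic_on unit_disc"
    unfolding holomorphic_on_open[OF open_ball] using dF by blast
  have derF: "deriv F z = f z" if "z \<in> unit_disc" for z using dF[OF that] by (rule DERIV_imp_deriv)
  have dom: "dominated_by_molecules p S x f"
    unfolding dominated_by_molecules_def
  proof
    fix z
    have c0: "0 \<le> molecule_coeff p x I" for I using x by (simp add: molecule_coeff_def)
    have "norm (f z) \<le> (\<Sum>I\<in>S. norm (of_real (\<epsilon> I) * v I z))" unfolding f_def by (rule norm_sum)
    also have "\<dots> = (\<Sum>I\<in>S. molecule_coeff p x I / norm (1 - cnj (arc_pt I) * z) ^ 3)"
      using c0 by (intro sum.cong refl) (simp add: v_def norm_mult norm_divide norm_power \<epsilon>)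
    finally show "norm (f z) \<le> (\<Sum>I\<in>S. molecule_coeff p x I / norm (1 - cnj (arc_pt I) * z) ^ 3)" .
  qed
  have Q: "Q_seminorm_sq p F \<le> ennreal (test_const p)"
    unfolding Q_seminorm_sq_def
  proof (rule SUP_least)
    fix a assume a: "a \<in> unit_disc"
    have "(\<integral>\<^sup>+z\<in>unit_disc. ennreal ((norm (deriv F z))\<^sup>2 * green z a powr p) \<partial>dA)
        = (\<integral>\<^sup>+z\<in>unit_disc. ennreal ((norm (f z))\<^sup>2 * green z a powr p) \<partial>dA)"
      by (intro nn_integral_cong) (auto simp: indicator_def derF)
    also have "\<dots> \<le> ennreal (test_const p)" by (rule green_integral_bound[OF p ad dom fm a])
    finally show "(\<integral>\<^sup>+z\<in>unit_disc. ennreal ((norm (deriv F z))\<^sup>2 * green z a powr p) \<partial>dA) \<le> ennreal (test_const p)" .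
  qed
  have "F \<in> Q_space p" using Fhol Q by (auto simp: Q_space_def less_top[symmetric] top_unique)
  then have "(\<integral>\<^sup>+z\<in>unit_disc. ennreal ((norm (deriv F z))\<^sup>2 * W z) \<partial>dA) \<le> ennreal C * Q_seminorm_sq p F"
    using emb by (simp add: embedding_bound_def)
  also have "\<dots> \<le> ennreal C * ennreal (test_const p)" by (intro mult_left_mono Q) simp
  also have "(\<integral>\<^sup>+z\<in>unit_disc. ennreal ((norm (deriv F z))\<^sup>2 * W z) \<partial>dA) = (\<integral>\<^sup>+z. ennreal ((norm (f z))\<^sup>2) * w z \<partial>dA)"
    using W0 by (intro nn_integral_cong) (auto simp: indicator_def derF w_def ennreal_mult)
  finally have up: "(\<integral>\<^sup>+z. ennreal ((norm (f z))\<^sup>2) * w z \<partial>dA) \<le> ennreal C * ennreal (test_const p)" .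
  have low: "ennreal (enn2real (h_weight p W I) * x I / 14 ^ 6) \<le> (\<integral>\<^sup>+z. ennreal ((norm (v I z))\<^sup>2) * w z \<partial>dA)" if IS: "I \<in> S" for I
  proof -
    have I: "I \<in> Dy" using IS S by auto
    define q where "q z = ennreal (W z) * indicator (Q_up I) z" for z
    have qw: "q z = w z * indicator (Q_up I) z" for z
      using Q_up_subset_disc[OF I] by (auto simp: q_def w_def indicator_def)
    have [measurable]: "Q_up I \<in> sets dA" using Q_up_measurable[OF Dy_arc[OF I]] by simp
    have qm [measurable]: "q \<in> borel_measurable dA" unfolding qw by measurable
    define B where "B = arc_length I powr (p + 2)"
    have B: "0 < B" using arc_length_pos[OF I] by (simp add: B_def)
    define c where "c = enn2real (h_weight p W I)"
    have c: "ennreal c = h_weight p W I" using h_weight_finite[OF W I] by (simp add: c_def less_top)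
    have "ennreal (c * x I / 14 ^ 6) = ennreal (c * (x I / 14 ^ 6))" by simp
    also have "\<dots> = ennreal c * ennreal (x I / 14 ^ 6)"
      using x by (intro ennreal_mult) (auto simp: c_def enn2real_nonneg)
    also note c
    also have "h_weight p W I = (\<integral>\<^sup>+z. q z \<partial>dA) / ennreal B" by (simp add: h_weight_def q_def B_def)
    also have "(\<integral>\<^sup>+z. q z \<partial>dA) / ennreal B * ennreal (x I / 14 ^ 6) = ennreal (x I / B / 14 ^ 6) * (\<integral>\<^sup>+z. q z \<partial>dA)"
    proof -
      have "x I / B / 14 ^ 6 = inverse B * (x I / 14 ^ 6)" by (simp only: divide_inverse mult_ac)
      moreover have "ennreal (inverse B * (x I / 14 ^ 6)) = ennreal (inverse B) * ennreal (x I / 14 ^ 6)"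
        using B x[of I] by (intro ennreal_mult) auto
      moreover have "ennreal (inverse B) = inverse (ennreal B)" by (rule inverse_ennreal[OF B, symmetric])
      ultimately have "ennreal (x I / B / 14 ^ 6) = inverse (ennreal B) * ennreal (x I / 14 ^ 6)" by metis
      then show ?thesis by (metis divide_ennreal_def mult.assoc mult.commute)
    qed
    also have "\<dots> = (\<integral>\<^sup>+z. ennreal (x I / B / 14 ^ 6) * q z \<partial>dA)" by (rule nn_integral_cmult[symmetric]) (rule qm)
    also have "\<dots> \<le> (\<integral>\<^sup>+z. ennreal ((norm (v I z))\<^sup>2) * w z \<partial>dA)"
    proof (intro nn_integral_mono)
      fix z
      show "ennreal (x I / B / 14 ^ 6) * q z \<le> ennreal ((norm (v I z))\<^sup>2) * w z"
        using molecule_lower[OF p x I, of z] unfolding qw B_def v_def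
        by (auto simp: indicator_def intro!: mult_right_mono ennreal_leI)
    qed
    finally show ?thesis unfolding c_def .
  qed
  have "ennreal (\<Sum>I\<in>S. enn2real (h_weight p W I) * x I / 14 ^ 6) = (\<Sum>I\<in>S. ennreal (enn2real (h_weight p W I) * x I / 14 ^ 6))"
    using x by (intro sum_ennreal[symmetric]) auto
  also have "\<dots> \<le> (\<Sum>I\<in>S. \<integral>\<^sup>+z. ennreal ((norm (v I z))\<^sup>2) * w z \<partial>dA)" by (intro sum_mono low)
  also note le
  also note up[unfolded f_def]
  also have "ennreal C * ennreal (test_const p) = ennreal (C * test_const p)" using C by (simp add: ennreal_mult')
  finally have "(\<Sum>I\<in>S. enn2real (h_weight p W I) * x I / 14 ^ 6) \<le> C * test_const p"
  proof (rule ennreal_le_iff[THEN iffD1, rotated])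
    show "0 \<le> C * test_const p"
      unfolding test_const_def using C p carleson_const_nonneg[OF p] growth_const_nonneg[OF p] layer_const_nonneg[of p "2 * p"] by simp
  qed
  then show ?thesis by (simp add: sum_divide_distrib[symmetric] field_simps)
qed

text \<open>Duality turns the bound for all admissible sequences into a cover of the same cost.\<close>
lemma gauge_le_embedding_constant:
  assumes p: "0 < p" "p \<le> 1" and W0: "\<And>z. z \<in> unit_disc \<Longrightarrow> 0 \<le> W z" and W: "locally_integrable_disc W"
    and emb: "embedding_bound p W C" and C: "0 \<le> C"
  shows "capacity_gauge p Dy (h_weight p W) \<le> ennreal (14 ^ 6 * test_const p * C)"
proof -
  define M where "M = 14 ^ 6 * test_const p * C"
  have "\<exists>l. (\<forall>J. 0 \<le> l J) \<and> (\<forall>I\<in>Dy. enn2real (h_weight p W I) \<le> (\<Sum>J\<in>{J\<in>Dy. I \<subseteq> J}. l J)) \<and>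
    (\<forall>F. finite F \<longrightarrow> F \<subseteq> Dy \<longrightarrow> (\<Sum>J\<in>F. l J * arc_length J powr p) \<le> M)"
  proof (rule laminar_duality)
    show "{} \<notin> Dy" using nonempty by auto
    show "(\<Sum>I\<in>S. enn2real (h_weight p W I) * x I) \<le> M" if "finite S" "S \<subseteq> Dy" "\<And>I. 0 \<le> x I"
      "\<And>J. J \<in> Dy \<Longrightarrow> (\<Sum>I\<in>{I\<in>S. I \<subseteq> J}. x I) \<le> arc_length J powr p" for S x
      unfolding M_def using that by (intro embedding_bounds_dual_sum p W0 W emb C) (auto simp: admissible_def)
    show "0 < arc_length J powr p" if "J \<in> Dy" for J using arc_length_pos[OF that] by simp
  qed (use laminar finite_ancestors in \<open>auto simp: enn2real_nonneg\<close>)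
  then obtain l where l0: "\<And>J. 0 \<le> l J"
    and cov: "\<And>I. I \<in> Dy \<Longrightarrow> enn2real (h_weight p W I) \<le> (\<Sum>J\<in>{J\<in>Dy. I \<subseteq> J}. l J)"
    and cost: "\<And>F. finite F \<Longrightarrow> F \<subseteq> Dy \<Longrightarrow> (\<Sum>J\<in>F. l J * arc_length J powr p) \<le> M"
    by auto
  have "capacity_gauge p Dy (h_weight p W) \<le> (\<Sum>\<^sub>\<infinity>J\<in>Dy. ennreal (l J * arc_length J powr p))"
    unfolding capacity_gauge_def
  proof (rule Inf_lower, intro CollectI exI[of _ l] conjI refl ballI)
    fix I assume I: "I \<in> Dy"
    have "h_weight p W I = ennreal (enn2real (h_weight p W I))" using h_weight_finite[OF W I] by (simp add: less_top)
    also have "\<dots> \<le> ennreal (\<Sum>J\<in>{J\<in>Dy. I \<subseteq> J}. l J)" by (intro ennreal_leI cov I)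
    also have "\<dots> = (\<Sum>J\<in>{J\<in>Dy. I \<subseteq> J}. ennreal (l J))" using l0 by (simp add: sum_ennreal)
    also have "\<dots> = (\<Sum>\<^sub>\<infinity>J\<in>{J\<in>Dy. I \<subseteq> J}. ennreal (l J))" using finite_ancestors[OF I] by simp
    finally show "h_weight p W I \<le> (\<Sum>\<^sub>\<infinity>J\<in>{J\<in>Dy. I \<subseteq> J}. ennreal (l J))" .
  qed (rule l0)
  also have "\<dots> = (SUP F\<in>{F. finite F \<and> F \<subseteq> Dy}. \<Sum>J\<in>F. ennreal (l J * arc_length J powr p))"
    by (rule nonneg_infsum_complete) simp
  also have "\<dots> \<le> ennreal M"
  proof (rule SUP_least)
    fix F assume F: "F \<in> {F. finite F \<and> F \<subseteq> Dy}"
    have "(\<Sum>J\<in>F. ennreal (l J * arc_length J powr p)) = ennreal (\<Sum>J\<in>F. l J * arc_length J powr p)"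
      using l0 by (simp add: sum_ennreal)
    then show "(\<Sum>J\<in>F. ennreal (l J * arc_length J powr p)) \<le> ennreal M" using cost F by (simp add: ennreal_leI)
  qed
  finally show ?thesis by (simp add: M_def)
qed

end

section \<open>The embedding constant is bounded by the gauge\<close>

lemma infsum_ennreal_eq_nn_integral:
  fixes f :: "'a \<Rightarrow> ennreal"
  assumes A: "countable A"
  shows "(\<Sum>\<^sub>\<infinity>x\<in>A. f x) = (\<integral>\<^sup>+x. f x \<partial>count_space A)"
proof -
  have sup: "(\<Sum>\<^sub>\<infinity>x\<in>A. f x) = (SUP F\<in>{F. finite F \<and> F \<subseteq> A}. sum f F)"
    by (rule nonneg_infsum_complete) simp
  show ?thesis
  proof (cases "finite A")
    case True
    then show ?thesis by (simp add: nn_integral_count_space_finite)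
  next
    case False
    note bij = bij_betw_from_nat_into[OF A False]
    have inj: "inj (from_nat_into A)" using bij by (rule bij_betw_imp_inj_on)
    have "(\<integral>\<^sup>+x. f x \<partial>count_space A) = (\<Sum>n. f (from_nat_into A n))"
      by (simp add: nn_integral_bij_count_space[symmetric, OF bij] nn_integral_count_space_nat)
    also have "\<dots> = (SUP n. \<Sum>i<n. f (from_nat_into A i))" by (rule suminf_eq_SUP)
    also have "\<dots> \<le> (SUP F\<in>{F. finite F \<and> F \<subseteq> A}. sum f F)"
    proof (rule SUP_least)
      fix n
      have "(\<Sum>i<n. f (from_nat_into A i)) = sum f (from_nat_into A ` {..<n})"
        using inj by (subst sum.reindex) (auto intro: inj_on_subset)
      also have "\<dots> \<le> (SUP F\<in>{F. finite F \<and> F \<subseteq> A}. sum f F)"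
        using from_nat_into[of A] False by (intro SUP_upper) auto
      finally show "(\<Sum>i<n. f (from_nat_into A i)) \<le> (SUP F\<in>{F. finite F \<and> F \<subseteq> A}. sum f F)" .
    qed
    finally have "(\<integral>\<^sup>+x. f x \<partial>count_space A) \<le> (\<Sum>\<^sub>\<infinity>x\<in>A. f x)" by (simp add: sup)
    moreover have "(\<Sum>\<^sub>\<infinity>x\<in>A. f x) \<le> (\<integral>\<^sup>+x. f x \<partial>count_space A)"
      unfolding sup
    proof (rule SUP_least)
      fix F assume F: "F \<in> {F. finite F \<and> F \<subseteq> A}"
      have "sum f F = (\<integral>\<^sup>+x. f x * indicator F x \<partial>count_space A)"
        using F by (subst nn_integral_count_space'[of F]) (auto simp: indicator_def)
      also have "\<dots> \<le> (\<integral>\<^sup>+x. f x \<partial>count_space A)"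
        by (intro nn_integral_mono) (auto simp: indicator_def)
      finally show "sum f F \<le> (\<integral>\<^sup>+x. f x \<partial>count_space A)" .
    qed
    ultimately show ?thesis by simp
  qed
qed

lemma nn_integral_count_space_le_of_finite_sums:
  fixes f :: "'a \<Rightarrow> ennreal"
  assumes "countable A" "\<And>F. finite F \<Longrightarrow> F \<subseteq> A \<Longrightarrow> sum f F \<le> M"
  shows "(\<integral>\<^sup>+x. f x \<partial>count_space A) \<le> M"
  unfolding infsum_ennreal_eq_nn_integral[OF assms(1), symmetric]
  by (subst nonneg_infsum_complete) (auto intro!: SUP_least assms(2))

context dyadic_arcs
begin

text \<open>A neighbourhood of the box \<open>Q_up I\<close> that stays away from the circle by a multiple of
  \<open>arc_length I\<close> and contains the balls of radius \<open>arc_length I / 4\<close> about the points of the box.\<close>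
definition whitney :: "complex set \<Rightarrow> complex set"
  where "whitney I = {w\<in>unit_disc. arc_length I / 4 < 1 - norm w \<and> norm (w - arc_mid I) < 6 * arc_length I}"

lemma whitney_measurable [measurable]: "whitney I \<in> sets borel"
  unfolding whitney_def by measurable

text \<open>If \<open>w\<close> is in the region of \<open>I\<close> then \<open>arc_length I\<close> is comparable to \<open>1 - norm w\<close> and
  the box of \<open>I\<close> is within that distance of \<open>w\<close>, so packing applies.\<close>
lemma whitney_overlap:
  assumes S: "finite S" "S \<subseteq> Dy"
  shows "real (card {I\<in>S. w \<in> whitney I}) \<le> 2822400"
proof (cases "{I\<in>S. w \<in> whitney I} = {}")
  case True
  then show ?thesis by (simp only: True card.empty of_nat_0 zero_le_numeral)
next
  case False
  define t where "t = 1 - norm w"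
  let ?S = "{I\<in>S. w \<in> whitney I}"
  have t: "0 < t" using False by (auto simp: whitney_def t_def)
  have b: "t \<le> 6 * arc_length I" "arc_length I \<le> 4 * t" "norm (arc_mid I - w) < 6 * arc_length I" if "I \<in> ?S" for I
  proof -
    have "t \<le> norm (arc_mid I - w)" using norm_triangle_ineq2[of "arc_mid I" w] by (simp add: t_def)
    moreover show "norm (arc_mid I - w) < 6 * arc_length I" "arc_length I \<le> 4 * t"
      using that by (auto simp: whitney_def t_def norm_minus_commute)
    ultimately show "t \<le> 6 * arc_length I" by linarith
  qed
  have "t / 6 \<le> arc_length I" if "I \<in> ?S" for I using b(1)[OF that] by simp
  then have "(\<Sum>I\<in>?S. (t / 6)\<^sup>2) \<le> (\<Sum>I\<in>?S. (arc_length I)\<^sup>2)"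
    using t by (intro sum_mono power_mono) simp_all
  also have "\<dots> \<le> 100 * (28 * t)\<^sup>2"
  proof (rule packing[where w = w])
    show "norm (arc_mid I - w) + arc_length I \<le> 28 * t" if "I \<in> ?S" for I using b[OF that] by linarith
  qed (use S t in auto)
  finally have "real (card ?S) * (t / 6)\<^sup>2 \<le> 2822400 * (t / 6)\<^sup>2" by (simp add: power_mult_distrib power_divide)
  then show ?thesis using t by (subst (asm) mult_le_cancel_right) auto
qed

lemma whitney_mean_value_bound:
  assumes p: "0 < p" "p \<le> 1" and f: "f holomorphic_on unit_disc" and I: "I \<in> Dy" and z: "z \<in> Q_up I"
  shows "ennreal ((norm (f z))\<^sup>2 * arc_length I powr (p + 2))
    \<le> ennreal 2048 * (\<integral>\<^sup>+w\<in>whitney I. ennreal ((norm (f w))\<^sup>2 * (1 - norm w) powr p) \<partial>dA)"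
proof -
  define l where "l = arc_length I"
  have l: "0 < l" using arc_length_pos[OF I] by (simp add: l_def)
  have zb: "norm z < 1 - l / 2" "norm (z - arc_mid I) \<le> 5 * l"
    using Q_upD[OF Dy_arc[OF I] z] by (auto simp: l_def)
  have sub: "w \<in> whitney I" if "w \<in> ball z (l / 4)" for w
  proof -
    have d: "norm (z - w) < l / 4" using that by (simp add: dist_norm)
    have "norm w \<le> norm z + norm (z - w)" using norm_triangle_ineq2[of w z] by (simp add: norm_minus_commute)
    moreover have "norm (w - arc_mid I) \<le> norm (z - w) + norm (z - arc_mid I)"
      using norm_triangle_ineq[of "w - z" "z - arc_mid I"] by (simp add: norm_minus_commute)
    ultimately show ?thesis using d zb l unfolding whitney_def l_def[symmetric] by auto
  qed
  then have disc: "ball z (l / 4) \<subseteq> unit_disc" by (auto simp: whitney_def)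
  define k where "k w = ennreal ((norm (f w))\<^sup>2 * (1 - norm w) powr p) * indicator (whitney I) w" for w
  have km: "k \<in> borel_measurable dA"
  proof -
    have c: "continuous_on unit_disc (\<lambda>w. (norm (f w))\<^sup>2 * (1 - norm w) powr p)"
      by (intro continuous_intros holomorphic_on_imp_continuous_on[OF f]) auto
    have "whitney I \<subseteq> unit_disc" by (auto simp: whitney_def)
    then have "k \<in> borel_measurable borel" unfolding k_def
      by (intro borel_measurable_ennreal_indicator continuous_on_subset[OF c]) auto
    then show ?thesis by (rule borel_measurable_dA)
  qed
  have "ennreal ((norm (f z))\<^sup>2) \<le> ennreal (32 / (l / 4)\<^sup>2) * (\<integral>\<^sup>+w\<in>ball z (l / 4). ennreal ((norm (f w))\<^sup>2) \<partial>dA)"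
    using l by (intro norm_squared_le_area_mean holomorphic_on_subset[OF f] disc) auto
  also have "(\<integral>\<^sup>+w\<in>ball z (l / 4). ennreal ((norm (f w))\<^sup>2) \<partial>dA) \<le> (\<integral>\<^sup>+w. ennreal (4 * l powr -p) * k w \<partial>dA)"
  proof (intro nn_integral_mono)
    fix w
    show "ennreal ((norm (f w))\<^sup>2) * indicator (ball z (l / 4)) w \<le> ennreal (4 * l powr -p) * k w"
    proof (cases "w \<in> ball z (l / 4)")
      case True
      have w: "w \<in> whitney I" by (rule sub[OF True])
      have "1 = 4 powr p * l powr -p * (l / 4) powr p"
        using l by (simp add: powr_divide powr_minus)
      also have "\<dots> \<le> 4 * l powr -p * (1 - norm w) powr p"
        using w powr_le_self_of_ge_one[of 4 p] p l
        by (intro mult_mono[OF mult_right_mono powr_mono2]) (auto simp: whitney_def l_def[symmetric])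
      finally have "(norm (f w))\<^sup>2 * 1 \<le> (norm (f w))\<^sup>2 * (4 * l powr -p * (1 - norm w) powr p)"
        by (intro mult_left_mono) auto
      then have "ennreal ((norm (f w))\<^sup>2) \<le> ennreal (4 * l powr -p * ((norm (f w))\<^sup>2 * (1 - norm w) powr p))"
        by (intro ennreal_leI) (simp add: mult_ac)
      also have "\<dots> = ennreal (4 * l powr -p) * ennreal ((norm (f w))\<^sup>2 * (1 - norm w) powr p)"
        by (intro ennreal_mult) auto
      finally show ?thesis using True w by (simp add: k_def)
    qed simp
  qed
  also have "\<dots> = ennreal (4 * l powr -p) * (\<integral>\<^sup>+w. k w \<partial>dA)" by (rule nn_integral_cmult) (rule km)
  finally have "ennreal ((norm (f z))\<^sup>2) \<le> ennreal (32 / (l / 4)\<^sup>2) * (ennreal (4 * l powr -p) * (\<integral>\<^sup>+w. k w \<partial>dA))"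
    by (simp add: mult_left_mono)
  then have "ennreal (l powr (p + 2)) * ennreal ((norm (f z))\<^sup>2)
     \<le> ennreal (l powr (p + 2)) * (ennreal (32 / (l / 4)\<^sup>2) * (ennreal (4 * l powr -p) * (\<integral>\<^sup>+w. k w \<partial>dA)))"
    by (intro mult_left_mono) auto
  also have "\<dots> = ennreal (l powr (p + 2) * (32 / (l / 4)\<^sup>2 * (4 * l powr -p))) * (\<integral>\<^sup>+w. k w \<partial>dA)"
    by (simp only: ennreal_mult' mult.assoc powr_ge_zero zero_le_divide_iff zero_le_power2 zero_le_numeral mult_nonneg_nonneg simp_thms)
  also have "l powr (p + 2) * (32 / (l / 4)\<^sup>2 * (4 * l powr -p)) = 2048"
    using l by (simp add: powr_add powr_minus powr_numeral power_divide field_simps)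
  also have "ennreal (l powr (p + 2)) * ennreal ((norm (f z))\<^sup>2) = ennreal ((norm (f z))\<^sup>2 * arc_length I powr (p + 2))"
    by (simp add: ennreal_mult l_def mult.commute)
  finally show ?thesis by (simp add: k_def)
qed

text \<open>In a Carleson box over \<open>J\<close>, \<open>|1 - cnj a w|\<close> is at most a multiple of \<open>arc_length J\<close> for \<open>a = arc_pt J\<close>; hence
  \<open>1 - |\<sigma> a w|\<^sup>2\<close>, and with it the Green function, is at least a multiple of \<open>(1 - |w|) / arc_length J\<close>.
  The pole has to be excluded because \<open>green\<close> takes the value \<open>0\<close> there.\<close>
lemma height_le_green:
  assumes p: "0 < p" "p \<le> 1" and J: "J \<in> Dy" and w: "w \<in> unit_disc" "w \<noteq> arc_pt J"
    and near: "norm (w - arc_mid J) < 10 * arc_length J"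
  shows "(1 - norm w) powr p \<le> 7056 * arc_length J powr p * green w (arc_pt J) powr p"
proof -
  define l a N s where "l = arc_length J" and "a = arc_pt J" and "N = norm (1 - cnj a * w)" and "s = norm (\<sigma> a w)"
  have l: "0 < l" "l \<le> 1" using arc_length_pos[OF J] arc_length_le_1[OF J] by (auto simp: l_def)
  have na: "norm a = 1 - l / 2" using norm_arc_pt[OF J] by (simp add: a_def l_def)
  have a1: "norm a < 1" and w1: "norm w < 1" using na l w by auto
  have "1 - norm w \<le> norm (w - arc_mid J)"
    using norm_triangle_ineq2[of "arc_mid J" w] by (simp add: norm_minus_commute)
  moreover have "norm (a - w) \<le> norm (arc_mid J - a) + norm (w - arc_mid J)"
    using norm_triangle_ineq[of "a - arc_mid J" "arc_mid J - w"] by (simp add: norm_minus_commute)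
  ultimately have "hdist a w \<le> 21 * l"
    using near norm_arc_mid_diff_arc_pt[OF J] na by (simp add: hdist_def l_def a_def)
  then have N42: "N \<le> 42 * l" using cross_norm_le_hdist[of a w] a1 w1 by (simp add: N_def)
  have N0: "0 < N" using cross_norm_lower(2)[OF a1 w1] by (simp add: N_def)
  have s: "0 < s" "s < 1"
    using w(2) N0 sigma_lt_1[OF a1 w1] by (auto simp: s_def \<sigma>_def a_def N_def norm_divide)
  have "(l / 2) * (1 - norm w) \<le> (1 - (norm a)\<^sup>2) * (1 - (norm w)\<^sup>2)"
  proof (intro mult_mono)
    have "l * l \<le> l" using l by (simp add: mult_left_le)
    moreover have "1 - (norm a)\<^sup>2 = l - l * l / 4" by (simp add: na power2_eq_square algebra_simps)
    ultimately show "l / 2 \<le> 1 - (norm a)\<^sup>2" using l by linarith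
    show "1 - norm w \<le> 1 - (norm w)\<^sup>2" using w1 by (simp add: power2_eq_square mult_left_le)
  qed (use l w1 na in \<open>auto simp: power_le_one\<close>)
  also have "\<dots> = (1 - s\<^sup>2) * N\<^sup>2"
    using one_minus_sigma_squared[OF a1 w1] N0 by (simp add: s_def N_def)
  also have "\<dots> \<le> (1 - s\<^sup>2) * (42 * l)\<^sup>2"
    using N42 N0 s by (intro mult_left_mono power_mono) (auto simp: power_le_one)
  finally have "l * (1 - norm w) \<le> l * (3528 * l * (1 - s\<^sup>2))" by (simp add: power2_eq_square mult_ac)
  then have 1: "1 - norm w \<le> 3528 * l * (1 - s\<^sup>2)" using l by (simp only: mult_le_cancel_left_pos)
  have "1 - s\<^sup>2 \<le> 2 * (1 - s)"
    using zero_le_power2[of "1 - s"] by (simp add: power2_eq_square algebra_simps)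
  also have "1 - s \<le> ln (1 / s)"
    using ln_le_minus_one[of s] s by (simp add: ln_div)
  finally have "3528 * l * (1 - s\<^sup>2) \<le> 3528 * l * (2 * ln (1 / s))" using l by (intro mult_left_mono) auto
  then have 2: "1 - norm w \<le> 7056 * l * green w a" using 1 by (simp add: green_def s_def)
  have "(1 - norm w) powr p \<le> (7056 * l * green w a) powr p"
    using 2 w1 p by (intro powr_mono2) auto
  also have "\<dots> = 7056 powr p * (l powr p * green w a powr p)" by (simp add: powr_mult)
  also have "\<dots> \<le> 7056 * (l powr p * green w a powr p)"
    using powr_le_self_of_ge_one[of 7056 p] p by (intro mult_right_mono) auto
  finally show ?thesis by (simp add: l_def a_def)
qed

text \<open>The masses of the Whitney regions are feasible for the dual program, up to a constant and the
  factor \<open>Q_seminorm_sq p F\<close>.\<close>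
lemma sum_whitney_le_seminorm:
  assumes p: "0 < p" "p \<le> 1" and F: "F holomorphic_on unit_disc" and J: "J \<in> Dy"
    and S: "finite S" "S \<subseteq> {I\<in>Dy. I \<subseteq> J}"
  shows "(\<Sum>I\<in>S. \<integral>\<^sup>+w\<in>whitney I. ennreal ((norm (deriv F w))\<^sup>2 * (1 - norm w) powr p) \<partial>dA)
    \<le> ennreal (2822400 * 7056 * arc_length J powr p) * Q_seminorm_sq p F"
proof -
  define f where "f = deriv F"
  have f: "f holomorphic_on unit_disc" unfolding f_def by (intro holomorphic_deriv F) auto
  have SDy: "S \<subseteq> Dy" using S by auto
  define a where "a = arc_pt J"
  have a: "a \<in> unit_disc" unfolding a_def by (rule arc_pt_in_disc[OF J])
  define u where "u w = ennreal ((norm (f w))\<^sup>2) * indicator unit_disc w" for w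
  have um [measurable]: "u \<in> borel_measurable borel"
    unfolding u_def
    by (intro borel_measurable_ennreal_indicator continuous_intros holomorphic_on_imp_continuous_on[OF f]) auto
  define k where "k w = u w * ennreal ((1 - norm w) powr p)" for w
  have km: "k \<in> borel_measurable borel" unfolding k_def by measurable
  then have [measurable]: "k \<in> borel_measurable dA" by (rule borel_measurable_dA)
  have W [measurable]: "whitney I \<in> sets dA" for I using whitney_measurable[of I] by simp
  define g where "g w = u w * ennreal (green w a powr p)" for w
  have "g \<in> borel_measurable borel" unfolding g_def green_def \<sigma>_def by measurable
  then have gm: "g \<in> borel_measurable dA" by (rule borel_measurable_dA)
  have "(\<Sum>I\<in>S. \<integral>\<^sup>+w\<in>whitney I. ennreal ((norm (deriv F w))\<^sup>2 * (1 - norm w) powr p) \<partial>dA)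
      = (\<Sum>I\<in>S. \<integral>\<^sup>+w. k w * indicator (whitney I) w \<partial>dA)"
    by (intro sum.cong refl nn_integral_cong)
       (auto simp: k_def u_def f_def whitney_def indicator_def ennreal_mult)
  also have "\<dots> = (\<integral>\<^sup>+w. (\<Sum>I\<in>S. k w * indicator (whitney I) w) \<partial>dA)"
    by (rule nn_integral_sum[symmetric]) measurable
  also have "\<dots> \<le> (\<integral>\<^sup>+w. ennreal (2822400 * 7056 * arc_length J powr p) * g w \<partial>dA)"
  proof (rule nn_integral_mono_AE)
    show "AE w in dA. (\<Sum>I\<in>S. k w * indicator (whitney I) w) \<le> ennreal (2822400 * 7056 * arc_length J powr p) * g w"
      using AE_dA_neq[of a]
    proof eventually_elim
      case (elim w)
      have "(\<Sum>I\<in>S. k w * indicator (whitney I) w) = k w * (\<Sum>I\<in>S. if w \<in> whitney I then 1 else 0)"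
        by (simp add: sum_distrib_left indicator_def of_bool_def cong: if_cong)
      also have "(\<Sum>I\<in>S. if w \<in> whitney I then 1 else 0) = (of_nat (card {I\<in>S. w \<in> whitney I}) :: ennreal)"
        using S by (simp add: sum.inter_filter[symmetric])
      finally have eq: "(\<Sum>I\<in>S. k w * indicator (whitney I) w) = k w * of_nat (card {I\<in>S. w \<in> whitney I})" .
      show ?case
      proof (cases "{I\<in>S. w \<in> whitney I} = {}")
        case True
        then show ?thesis by (simp only: eq True) simp
      next
        case False
        then obtain I where I: "I \<in> S" "w \<in> whitney I" by auto
        have IJ: "I \<in> Dy" "I \<subseteq> J" using I S by auto
        have w: "w \<in> unit_disc" "norm (w - arc_mid I) < 6 * arc_length I" using I by (auto simp: whitney_def)
        have "norm (w - arc_mid J) \<le> norm (w - arc_mid I) + norm (arc_mid I - arc_mid J)"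
          using norm_triangle_ineq[of "w - arc_mid I" "arc_mid I - arc_mid J"] by simp
        then have near: "norm (w - arc_mid J) < 10 * arc_length J"
          using w(2) norm_arc_mid_diff_le[OF IJ(1) J IJ(2)] length_mono[OF IJ(1) J IJ(2)] by linarith
        have h: "(1 - norm w) powr p \<le> 7056 * arc_length J powr p * green w a powr p"
          unfolding a_def by (rule height_le_green[OF p J w(1) _ near]) (use elim in \<open>simp add: a_def\<close>)
        have "k w * of_nat (card {I\<in>S. w \<in> whitney I})
            \<le> (u w * ennreal (7056 * arc_length J powr p * green w a powr p)) * ennreal 2822400"
          unfolding k_def using whitney_overlap[OF S(1) SDy, of w] h
          by (intro mult_mono) (auto simp: ennreal_of_nat_eq_real_of_nat intro!: ennreal_leI mult_left_mono simp del: ennreal_numeral)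
        also have "\<dots> = u w * (ennreal (7056 * arc_length J powr p * green w a powr p) * ennreal 2822400)"
          by (rule mult.assoc)
        also have "ennreal (7056 * arc_length J powr p * green w a powr p) * ennreal 2822400
           = ennreal (2822400 * 7056 * arc_length J powr p * green w a powr p)"
          by (subst ennreal_mult[symmetric]) (auto simp: mult_ac)
        also have "\<dots> = ennreal (2822400 * 7056 * arc_length J powr p) * ennreal (green w a powr p)"
          by (intro ennreal_mult) auto
        finally show ?thesis unfolding eq g_def by (simp only: mult.left_commute)
      qed
    qed
  qed
  also have "\<dots> = ennreal (2822400 * 7056 * arc_length J powr p) * (\<integral>\<^sup>+w. g w \<partial>dA)"
    by (rule nn_integral_cmult) (rule gm)
  also have "(\<integral>\<^sup>+w. g w \<partial>dA) \<le> Q_seminorm_sq p F"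
  proof -
    have "(\<integral>\<^sup>+w. g w \<partial>dA) = (\<integral>\<^sup>+z\<in>unit_disc. ennreal ((norm (deriv F z))\<^sup>2 * green z a powr p) \<partial>dA)"
      by (intro nn_integral_cong) (auto simp: g_def u_def f_def indicator_def ennreal_mult)
    also have "\<dots> \<le> Q_seminorm_sq p F" unfolding Q_seminorm_sq_def using a by (rule SUP_upper)
    finally show ?thesis .
  qed
  finally show ?thesis by (simp add: mult_left_mono)
qed

definition carleson_mass :: "real \<Rightarrow> (complex \<Rightarrow> complex) \<Rightarrow> complex set \<Rightarrow> ennreal"
  where "carleson_mass p F I = (\<integral>\<^sup>+w\<in>whitney I. ennreal ((norm (deriv F w))\<^sup>2 * (1 - norm w) powr p) \<partial>dA)"

text \<open>The weight \<open>W\<close> enters only through its integrals over the boxes, because \<open>|F'|\<^sup>2\<close> is bounded on a box by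
  the mass of its Whitney region.\<close>
lemma weighted_integral_le_tree_sum:
  assumes p: "0 < p" "p \<le> 1" and W0: "\<And>z. z \<in> unit_disc \<Longrightarrow> 0 \<le> W z" and W: "locally_integrable_disc W"
    and F: "F holomorphic_on unit_disc"
  shows "(\<integral>\<^sup>+z\<in>unit_disc. ennreal ((norm (deriv F z))\<^sup>2 * W z) \<partial>dA)
    \<le> (\<integral>\<^sup>+I. ennreal 2048 * carleson_mass p F I * h_weight p W I \<partial>count_space Dy)"
proof -
  define f where "f = deriv F"
  have f: "f holomorphic_on unit_disc" unfolding f_def by (intro holomorphic_deriv F) auto
  define w where "w = (\<lambda>z. ennreal (W z) * indicator unit_disc z)"
  have wm [measurable]: "w \<in> borel_measurable dA" unfolding w_def by (rule weight_measurable[OF W])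
  define u where "u z = ennreal ((norm (f z))\<^sup>2) * indicator unit_disc z" for z
  have um [measurable]: "u \<in> borel_measurable borel"
    unfolding u_def
    by (intro borel_measurable_ennreal_indicator continuous_intros holomorphic_on_imp_continuous_on[OF f]) auto
  then have [measurable]: "u \<in> borel_measurable dA" by (rule borel_measurable_dA)
  have Qm: "Q_up I \<in> sets dA" if "I \<in> Dy" for I using Q_up_measurable[OF Dy_arc[OF that]] by simp
  have m: "(\<lambda>z. u z * w z * indicator (Q_up I) z) \<in> borel_measurable dA" if "I \<in> Dy" for I
    using Qm[OF that] by measurable
  have "(\<integral>\<^sup>+z\<in>unit_disc. ennreal ((norm (deriv F z))\<^sup>2 * W z) \<partial>dA)
      \<le> (\<integral>\<^sup>+z. \<integral>\<^sup>+I. u z * w z * indicator (Q_up I) z \<partial>count_space Dy \<partial>dA)"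
  proof (intro nn_integral_mono)
    fix z
    show "ennreal ((norm (deriv F z))\<^sup>2 * W z) * indicator unit_disc z \<le> (\<integral>\<^sup>+I. u z * w z * indicator (Q_up I) z \<partial>count_space Dy)"
    proof (cases "z \<in> unit_disc")
      case True
      then obtain I where I: "I \<in> Dy" "z \<in> Q_up I" using Q_up_cover by blast
      have "ennreal ((norm (deriv F z))\<^sup>2 * W z) * indicator unit_disc z = u z * w z * indicator (Q_up I) z"
        using True I W0[OF True] by (simp add: u_def w_def f_def ennreal_mult)
      also have "\<dots> \<le> (\<integral>\<^sup>+I. u z * w z * indicator (Q_up I) z \<partial>count_space Dy)"
        using I(1) by (rule nn_integral_ge_point)
      finally show ?thesis .
    qed simp
  qed
  also have "\<dots> = (\<integral>\<^sup>+I. \<integral>\<^sup>+z. u z * w z * indicator (Q_up I) z \<partial>dA \<partial>count_space Dy)"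
    by (rule nn_integral_count_space_nn_integral[OF countable_Dy m])
  also have "\<dots> \<le> (\<integral>\<^sup>+I. ennreal 2048 * carleson_mass p F I * h_weight p W I \<partial>count_space Dy)"
  proof (intro nn_integral_mono)
    fix I assume "I \<in> space (count_space Dy)"
    then have I: "I \<in> Dy" by simp
    define B where "B = arc_length I powr (p + 2)"
    have B: "0 < B" using arc_length_pos[OF I] by (simp add: B_def)
    define q where "q z = w z * indicator (Q_up I) z" for z
    have qm: "q \<in> borel_measurable dA" unfolding q_def using Qm[OF I] by measurable
    define c where "c = ennreal 2048 * carleson_mass p F I"
    have bB: "inverse (ennreal B) * ennreal B = 1"
      using B by (simp add: inverse_ennreal ennreal_mult[symmetric])
    have "(\<integral>\<^sup>+z. u z * w z * indicator (Q_up I) z \<partial>dA) \<le> (\<integral>\<^sup>+z. (c * inverse (ennreal B)) * q z \<partial>dA)"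
    proof (intro nn_integral_mono)
      fix z
      show "u z * w z * indicator (Q_up I) z \<le> (c * inverse (ennreal B)) * q z"
      proof (cases "z \<in> Q_up I")
        case True
        have zd: "z \<in> unit_disc" using True Q_up_subset_disc[OF I] by auto
        have "u z * ennreal B \<le> c"
          using whitney_mean_value_bound[OF p f I True] zd by (simp add: u_def c_def carleson_mass_def f_def B_def ennreal_mult)
        then have "inverse (ennreal B) * (u z * ennreal B) \<le> inverse (ennreal B) * c" by (rule mult_left_mono) simp
        also have "inverse (ennreal B) * (u z * ennreal B) = u z * (inverse (ennreal B) * ennreal B)"
          by (simp only: mult_ac)
        also have "\<dots> = u z" by (simp only: bB mult_1_right)
        finally have "u z \<le> c * inverse (ennreal B)" by (simp only: mult.commute)
        then have "u z * w z \<le> c * inverse (ennreal B) * w z" by (rule mult_right_mono) simp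
        then show ?thesis using True by (simp add: q_def)
      qed simp
    qed
    also have "\<dots> = (c * inverse (ennreal B)) * (\<integral>\<^sup>+z. q z \<partial>dA)" by (rule nn_integral_cmult) (rule qm)
    also have "(\<integral>\<^sup>+z. q z \<partial>dA) = (\<integral>\<^sup>+z\<in>Q_up I. ennreal (W z) \<partial>dA)"
      using Q_up_subset_disc[OF I] by (intro nn_integral_cong) (auto simp: q_def w_def indicator_def)
    also have "c * inverse (ennreal B) * \<dots> = c * h_weight p W I"
      by (simp only: h_weight_def B_def divide_ennreal_def mult_ac)
    finally show "(\<integral>\<^sup>+z. u z * w z * indicator (Q_up I) z \<partial>dA) \<le> ennreal 2048 * carleson_mass p F I * h_weight p W I"
      by (simp only: c_def)
  qed
  finally show ?thesis .
qed

text \<open>Weak duality: \<open>h\<close> is replaced by the sums of \<open>l\<close> over larger arcs, the two sums are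
  exchanged, and the masses below each \<open>J\<close> are bounded by \<open>sum_whitney_le_seminorm\<close>.\<close>
lemma embedding_le_cover_cost:
  assumes p: "0 < p" "p \<le> 1" and W0: "\<And>z. z \<in> unit_disc \<Longrightarrow> 0 \<le> W z" and W: "locally_integrable_disc W"
    and F: "F holomorphic_on unit_disc" and l0: "\<And>J. J \<in> Dy \<Longrightarrow> 0 \<le> l J"
    and cov: "\<And>I. I \<in> Dy \<Longrightarrow> h_weight p W I \<le> (\<Sum>\<^sub>\<infinity>J\<in>{J\<in>Dy. I \<subseteq> J}. ennreal (l J))"
  shows "(\<integral>\<^sup>+z\<in>unit_disc. ennreal ((norm (deriv F z))\<^sup>2 * W z) \<partial>dA)
    \<le> ennreal (2048 * (2822400 * 7056)) * (\<Sum>\<^sub>\<infinity>J\<in>Dy. ennreal (l J * arc_length J powr p)) * Q_seminorm_sq p F"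
proof -
  define T where "T = carleson_mass p F"
  define Q where "Q = Q_seminorm_sq p F"
  define c where "c = 2822400 * (7056::real)"
  have cov': "h_weight p W I \<le> (\<integral>\<^sup>+J. ennreal (l J) * of_bool (I \<subseteq> J) \<partial>count_space Dy)" if I: "I \<in> Dy" for I
  proof -
    have "(\<Sum>\<^sub>\<infinity>J\<in>{J\<in>Dy. I \<subseteq> J}. ennreal (l J)) = (\<Sum>\<^sub>\<infinity>J\<in>Dy. ennreal (l J) * of_bool (I \<subseteq> J))"
      by (rule infsum_cong_neutral) auto
    then show ?thesis using cov[OF I] infsum_ennreal_eq_nn_integral[OF countable_Dy] by metis
  qed
  have "(\<integral>\<^sup>+z\<in>unit_disc. ennreal ((norm (deriv F z))\<^sup>2 * W z) \<partial>dA)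
    \<le> (\<integral>\<^sup>+I. ennreal 2048 * T I * h_weight p W I \<partial>count_space Dy)"
    unfolding T_def by (rule weighted_integral_le_tree_sum[OF p W0 W F])
  also have "\<dots> \<le> (\<integral>\<^sup>+I. ennreal 2048 * T I * (\<integral>\<^sup>+J. ennreal (l J) * of_bool (I \<subseteq> J) \<partial>count_space Dy) \<partial>count_space Dy)"
    using cov' by (intro nn_integral_mono mult_left_mono) auto
  also have "\<dots> = (\<integral>\<^sup>+I. \<integral>\<^sup>+J. ennreal 2048 * T I * (ennreal (l J) * of_bool (I \<subseteq> J)) \<partial>count_space Dy \<partial>count_space Dy)"
    by (intro nn_integral_cong nn_integral_cmult[symmetric]) simp
  also have "\<dots> = (\<integral>\<^sup>+J. \<integral>\<^sup>+I. ennreal 2048 * T I * (ennreal (l J) * of_bool (I \<subseteq> J)) \<partial>count_space Dy \<partial>count_space Dy)"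
    by (rule nn_integral_count_space_nn_integral[OF countable_Dy]) simp
  also have "\<dots> \<le> (\<integral>\<^sup>+J. (ennreal (2048 * c) * Q) * ennreal (l J * arc_length J powr p) \<partial>count_space Dy)"
  proof (intro nn_integral_mono)
    fix J assume "J \<in> space (count_space Dy)"
    then have J: "J \<in> Dy" by simp
    have "(\<integral>\<^sup>+I. ennreal 2048 * T I * (ennreal (l J) * of_bool (I \<subseteq> J)) \<partial>count_space Dy)
        = (\<integral>\<^sup>+I. (ennreal 2048 * ennreal (l J)) * (T I * of_bool (I \<subseteq> J)) \<partial>count_space Dy)"
      by (intro nn_integral_cong) (simp only: mult_ac)
    also have "\<dots> = (ennreal 2048 * ennreal (l J)) * (\<integral>\<^sup>+I. T I * of_bool (I \<subseteq> J) \<partial>count_space Dy)"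
      by (rule nn_integral_cmult) simp
    also have "(\<integral>\<^sup>+I. T I * of_bool (I \<subseteq> J) \<partial>count_space Dy) \<le> ennreal (c * arc_length J powr p) * Q"
    proof (rule nn_integral_count_space_le_of_finite_sums[OF countable_Dy])
      fix S assume S: "finite S" "S \<subseteq> Dy"
      have "(\<Sum>I\<in>S. T I * of_bool (I \<subseteq> J)) = (\<Sum>I\<in>{I\<in>S. I \<subseteq> J}. T I)"
        using S by (simp add: sum.inter_filter of_bool_def if_distrib cong: if_cong)
      also have "\<dots> \<le> ennreal (c * arc_length J powr p) * Q"
        unfolding T_def Q_def c_def carleson_mass_def using S
        by (intro sum_whitney_le_seminorm p F J) auto
      finally show "(\<Sum>I\<in>S. T I * of_bool (I \<subseteq> J)) \<le> ennreal (c * arc_length J powr p) * Q" .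
    qed
    also have "(ennreal 2048 * ennreal (l J)) * (ennreal (c * arc_length J powr p) * Q)
       = (ennreal (2048 * c) * Q) * ennreal (l J * arc_length J powr p)"
    proof -
      have "ennreal (c * arc_length J powr p) = ennreal c * ennreal (arc_length J powr p)"
        "ennreal (2048 * c) = ennreal 2048 * ennreal c"
        "ennreal (l J * arc_length J powr p) = ennreal (l J) * ennreal (arc_length J powr p)"
        using l0[OF J] by (intro ennreal_mult; simp add: c_def)+
      then show ?thesis by (simp only: mult_ac)
    qed
    finally show "(\<integral>\<^sup>+I. ennreal 2048 * T I * (ennreal (l J) * of_bool (I \<subseteq> J)) \<partial>count_space Dy)
        \<le> (ennreal (2048 * c) * Q) * ennreal (l J * arc_length J powr p)" by (simp add: mult_left_mono)
  qed
  also have "\<dots> = (ennreal (2048 * c) * Q) * (\<integral>\<^sup>+J. ennreal (l J * arc_length J powr p) \<partial>count_space Dy)"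
    by (rule nn_integral_cmult) simp
  also have "\<dots> = ennreal (2048 * c) * (\<Sum>\<^sub>\<infinity>J\<in>Dy. ennreal (l J * arc_length J powr p)) * Q"
    unfolding infsum_ennreal_eq_nn_integral[OF countable_Dy] by (simp only: mult_ac)
  finally show ?thesis by (simp only: c_def Q_def)
qed

end

section \<open>The standard dyadic system\<close>

definition std_arc :: "nat \<Rightarrow> nat \<Rightarrow> complex set"
  where "std_arc k j = cis ` {2 * pi * (real j / 2 ^ k)..<2 * pi * (real (Suc j) / 2 ^ k)}"

lemma circle_coordinate:
  assumes "z \<in> unit_circle"
  obtains u where "0 \<le> u" "u < 1" "z = cis (2 * pi * u)"
proof
  show "0 \<le> Arg2pi z / (2 * pi)" "Arg2pi z / (2 * pi) < 1"
    using Arg2pi_ge_0[of z] Arg2pi_lt_2pi[of z] by (auto simp: field_simps)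
  show "z = cis (2 * pi * (Arg2pi z / (2 * pi)))"
    using Arg2pi_eq[of z] assms by (simp add: cis_conv_exp)
qed

text \<open>In the coordinate \<open>u\<close> the arc of index \<open>j\<close> is determined by the integer part of \<open>u * 2 ^ k\<close>;
  partition, cardinality and nesting are read off from this.\<close>
lemma std_arc_iff:
  assumes u: "0 \<le> u" "u < 1" and j: "j < 2 ^ k"
  shows "cis (2 * pi * u) \<in> std_arc k j \<longleftrightarrow> real j \<le> u * 2 ^ k \<and> u * 2 ^ k < real j + 1"
proof
  assume "real j \<le> u * 2 ^ k \<and> u * 2 ^ k < real j + 1"
  then have "real j / 2 ^ k \<le> u" "u < real (Suc j) / 2 ^ k" by (auto simp: field_simps)
  then have "2 * pi * (real j / 2 ^ k) \<le> 2 * pi * u" "2 * pi * u < 2 * pi * (real (Suc j) / 2 ^ k)"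
    by (intro mult_left_mono mult_strict_left_mono; simp)+
  then show "cis (2 * pi * u) \<in> std_arc k j"
    unfolding std_arc_def by (intro imageI) (simp only: atLeastLessThan_iff)
next
  assume "cis (2 * pi * u) \<in> std_arc k j"
  then obtain s where s: "s \<in> {2 * pi * (real j / 2 ^ k)..<2 * pi * (real (Suc j) / 2 ^ k)}" "cis (2 * pi * u) = cis s"
    unfolding std_arc_def by auto
  define v where "v = s / (2 * pi)"
  have sv: "s = 2 * pi * v" by (simp add: v_def)
  have tp: "0 < 2 * pi" by simp
  have v: "real j / 2 ^ k \<le> v" "v < real (Suc j) / 2 ^ k"
    using s(1) unfolding sv atLeastLessThan_iff mult_le_cancel_left_pos[OF tp] mult_less_cancel_left_pos[OF tp]
    by auto
  have "real (Suc j) \<le> 2 ^ k" using j by (metis Suc_leI of_nat_le_iff of_nat_numeral of_nat_power)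
  then have "real (Suc j) / 2 ^ k \<le> 1" by simp
  moreover have "0 \<le> real j / 2 ^ k" by simp
  ultimately have v01: "0 \<le> v" "v < 1" using v by linarith+
  obtain n :: int where "s = 2 * pi * u + 2 * pi * n" using s(2) by (metis cis_eq_iff_shift)
  then have "v = u + n" by (simp add: v_def add_divide_distrib)
  then have "n = 0" using v01 u by linarith
  then have "u = v" using \<open>v = u + n\<close> by simp
  then show "real j \<le> u * 2 ^ k \<and> u * 2 ^ k < real j + 1" using v by (simp add: field_simps)
qed

lemma std_arc_unique:
  assumes "z \<in> unit_circle"
  shows "\<exists>j<2 ^ k. z \<in> std_arc k j" and "\<lbrakk>i < 2 ^ k; j < 2 ^ k; z \<in> std_arc k i; z \<in> std_arc k j\<rbrakk> \<Longrightarrow> i = j"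
proof -
  obtain u where u: "0 \<le> u" "u < 1" "z = cis (2 * pi * u)" using assms by (rule circle_coordinate)
  have iff: "z \<in> std_arc k j \<longleftrightarrow> real j \<le> u * 2 ^ k \<and> u * 2 ^ k < real j + 1" if "j < 2 ^ k" for j
    using std_arc_iff[OF u(1,2) that] u(3) by simp
  show "\<exists>j<2 ^ k. z \<in> std_arc k j"
  proof (intro exI conjI)
    define j where "j = nat \<lfloor>u * 2 ^ k\<rfloor>"
    have nn: "0 \<le> u * 2 ^ k" using u by simp
    have jb: "real j \<le> u * 2 ^ k" "u * 2 ^ k < real j + 1" unfolding j_def using nn by linarith+
    moreover have "u * 2 ^ k < 2 ^ k" using u by simp
    ultimately have "real j < 2 ^ k" by linarith
    then show j: "j < 2 ^ k" by (metis of_nat_less_iff of_nat_numeral of_nat_power)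
    show "z \<in> std_arc k j" using iff[OF j] jb by simp
  qed
  show "i = j" if "i < 2 ^ k" "j < 2 ^ k" "z \<in> std_arc k i" "z \<in> std_arc k j"
    using that iff by (simp; linarith)
qed

lemma std_arc_facts:
  shows "half_open_arc (std_arc k j)" "arc_length (std_arc k j) = 1 / 2 ^ k" "std_arc k j \<noteq> {}"
proof -
  let ?a = "2 * pi * (real j / 2 ^ k)" and ?b = "2 * pi * (real (Suc j) / 2 ^ k)"
  have "(1::real) \<le> 2 ^ k" by simp
  then have d: "?b - ?a = 2 * pi * (1 / 2 ^ k)" "?a < ?b" "1 / 2 ^ k \<le> (1::real)"
    by (auto simp: field_simps)
  have "2 * pi * (1 / 2 ^ k) \<le> 2 * pi * 1" using d(3) by (intro mult_left_mono) auto
  then have b: "?b \<le> ?a + 2 * pi" using d(1) by linarith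
  show "half_open_arc (std_arc k j)" unfolding half_open_arc_def std_arc_def using d(2) b by blast
  have "arc_length (std_arc k j) = (?b - ?a) / (2 * pi)"
    unfolding std_arc_def using d(2) b by (intro arc_length_eq image_mono) auto
  also have "\<dots> = 1 / 2 ^ k" unfolding d(1) by simp
  finally show "arc_length (std_arc k j) = 1 / 2 ^ k" .
  show "std_arc k j \<noteq> {}" unfolding std_arc_def using d(2) by auto
qed

lemma std_arc_parent:
  assumes "j < 2 ^ Suc k"
  shows "std_arc (Suc k) j \<subseteq> std_arc k (j div 2)" "j div 2 < 2 ^ k"
proof -
  show j2: "j div 2 < 2 ^ k" using assms by auto
  show "std_arc (Suc k) j \<subseteq> std_arc k (j div 2)"
  proof
    fix z assume z: "z \<in> std_arc (Suc k) j"
    then have "z \<in> unit_circle" using half_open_arc_subset_circle[OF std_arc_facts(1)] by blast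
    then obtain u where u: "0 \<le> u" "u < 1" "z = cis (2 * pi * u)" by (rule circle_coordinate)
    have "real j \<le> 2 * (u * 2 ^ k)" "2 * (u * 2 ^ k) < real j + 1"
      using z std_arc_iff[OF u(1,2) assms] u(3) by (auto simp: mult_ac)
    moreover define d where "d = j div 2"
    have "2 * d \<le> j" "j \<le> 2 * d + 1" unfolding d_def by presburger+
    then have "2 * real d \<le> real j" "real j \<le> 2 * real d + 1" by linarith+
    ultimately have "real d \<le> u * 2 ^ k" "u * 2 ^ k < real d + 1" by linarith+
    then show "z \<in> std_arc k (j div 2)"
      using std_arc_iff[OF u(1,2) j2] u(3) by (simp add: d_def)
  qed
qed

lemma dyadic_system_exists: "\<exists>Dy. dyadic_system Dy"
proof -
  define D where "D k = std_arc k ` {..<2 ^ k}" for k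
  have union: "\<Union> (D k) = unit_circle" for k
    using std_arc_unique(1) half_open_arc_subset_circle[OF std_arc_facts(1)] unfolding D_def by fastforce
  have inj: "i = j" if "i < 2 ^ k" "j < 2 ^ k" "std_arc k i \<inter> std_arc k j \<noteq> {}" for i j k
    using that std_arc_unique(2) half_open_arc_subset_circle[OF std_arc_facts(1)] by blast
  have "partition_on unit_circle (D k)" for k
  proof (rule partition_onI)
    show "\<Union> (D k) = unit_circle" by (rule union)
    show "{} \<notin> D k" using std_arc_facts(3) by (force simp: D_def)
    show "disjnt I J" if "I \<in> D k" "J \<in> D k" "I \<noteq> J" for I J
      using that inj[of _ k] unfolding D_def disjnt_def by blast
  qed
  moreover have "card (D k) = 2 ^ k" for k
    unfolding D_def using inj[of _ k] std_arc_facts(3)[of k] by (subst card_image) (auto simp: inj_on_def)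
  moreover have "\<exists>J\<in>D k. I \<subseteq> J" if "I \<in> D (Suc k)" for I k
    using that std_arc_parent[of _ k] unfolding D_def by blast
  moreover have "D 0 = {unit_circle}"
  proof -
    have "D 0 = {std_arc 0 0}" by (simp add: D_def lessThan_Suc)
    then show ?thesis using union[of 0] by simp
  qed
  ultimately have "dyadic_system (\<Union>k. D k)"
    unfolding dyadic_system_def by (intro exI[of _ D]) (auto simp: D_def std_arc_facts)
  then show ?thesis by blast
qed

lemma divide_ennreal_le_iff:
  assumes "0 < c"
  shows "a / ennreal c \<le> b \<longleftrightarrow> a \<le> ennreal c * b"
proof -
  have i: "ennreal c * inverse (ennreal c) = 1" using assms by (simp add: inverse_ennreal ennreal_mult[symmetric])
  show ?thesis
  proof
    assume "a / ennreal c \<le> b"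
    then have "ennreal c * (a * inverse (ennreal c)) \<le> ennreal c * b"
      by (intro mult_left_mono) (auto simp: divide_ennreal_def)
    also have "ennreal c * (a * inverse (ennreal c)) = (ennreal c * inverse (ennreal c)) * a" by (simp only: mult_ac)
    finally show "a \<le> ennreal c * b" by (simp only: i mult_1)
  next
    assume "a \<le> ennreal c * b"
    then have "a * inverse (ennreal c) \<le> ennreal c * b * inverse (ennreal c)" by (intro mult_right_mono) auto
    also have "\<dots> = (ennreal c * inverse (ennreal c)) * b" by (simp only: mult_ac)
    finally show "a / ennreal c \<le> b" by (simp only: i mult_1 divide_ennreal_def)
  qed
qed

section \<open>Comparison of the constants\<close>

definition upper_const :: real
  where "upper_const = 2048 * (2822400 * 7056)"

lemma upper_const_pos: "0 < upper_const"
  by (simp add: upper_const_def)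

lemma C_best_le_gauge:
  assumes p: "0 < p" "p \<le> 1" and W0: "\<And>z. z \<in> unit_disc \<Longrightarrow> 0 \<le> W z" and W: "locally_integrable_disc W"
    and Dy: "dyadic_system Dy"
  shows "C_best p W \<le> ennreal upper_const * capacity_gauge p Dy (h_weight p W)"
proof -
  obtain D where "dyadic_arcs Dy D" using Dy by (rule dyadic_systemE)
  then interpret dyadic_arcs Dy D .
  have "C_best p W / ennreal upper_const \<le> capacity_gauge p Dy (h_weight p W)"
    unfolding capacity_gauge_def
  proof (rule Inf_greatest, clarify)
    fix l :: "complex set \<Rightarrow> real"
    assume l0: "\<forall>J\<in>Dy. 0 \<le> l J"
      and cov: "\<forall>I\<in>Dy. h_weight p W I \<le> (\<Sum>\<^sub>\<infinity>J\<in>{J\<in>Dy. I \<subseteq> J}. ennreal (l J))"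
    define L where "L = (\<Sum>\<^sub>\<infinity>J\<in>Dy. ennreal (l J * arc_length J powr p))"
    show "C_best p W / ennreal upper_const \<le> (\<Sum>\<^sub>\<infinity>J\<in>Dy. ennreal (l J * arc_length J powr p))"
    proof (cases "L = \<infinity>")
      case True
      then show ?thesis by (simp add: L_def)
    next
      case False
      then obtain r where r: "0 \<le> r" "L = ennreal r" by (cases L) auto
      have "embedding_bound p W (upper_const * r)"
        unfolding embedding_bound_def
      proof
        fix F assume "F \<in> Q_space p"
        then have F: "F holomorphic_on unit_disc" by (simp add: Q_space_def)
        have "(\<integral>\<^sup>+z\<in>unit_disc. ennreal ((norm (deriv F z))\<^sup>2 * W z) \<partial>dA) \<le> ennreal upper_const * L * Q_seminorm_sq p F"
          unfolding upper_const_def L_def using l0 cov by (intro embedding_le_cover_cost p W0 W F) auto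
        also have "ennreal upper_const * L = ennreal (upper_const * r)"
          using upper_const_pos r by (simp add: ennreal_mult)
        finally show "(\<integral>\<^sup>+z\<in>unit_disc. ennreal ((norm (deriv F z))\<^sup>2 * W z) \<partial>dA) \<le> ennreal (upper_const * r) * Q_seminorm_sq p F" .
      qed
      then have "C_best p W \<le> ennreal (upper_const * r)"
        unfolding C_best_def using upper_const_pos r by (intro Inf_lower) auto
      then have "C_best p W \<le> ennreal upper_const * L"
        using upper_const_pos r by (simp add: ennreal_mult)
      then show ?thesis by (simp add: divide_ennreal_le_iff[OF upper_const_pos] L_def)
    qed
  qed
  then show ?thesis by (simp add: divide_ennreal_le_iff[OF upper_const_pos])
qed

lemma gauge_le_C_best:
  assumes p: "0 < p" "p \<le> 1" and W0: "\<And>z. z \<in> unit_disc \<Longrightarrow> 0 \<le> W z" and W: "locally_integrable_disc W"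
    and Dy: "dyadic_system Dy" and c: "0 < c" "14 ^ 6 * test_const p \<le> c"
  shows "capacity_gauge p Dy (h_weight p W) \<le> ennreal c * C_best p W"
proof -
  obtain D where "dyadic_arcs Dy D" using Dy by (rule dyadic_systemE)
  then interpret dyadic_arcs Dy D .
  have "capacity_gauge p Dy (h_weight p W) / ennreal c \<le> C_best p W"
    unfolding C_best_def
  proof (rule Inf_greatest, clarify)
    fix C assume C: "0 \<le> C" "embedding_bound p W C"
    have "capacity_gauge p Dy (h_weight p W) \<le> ennreal (14 ^ 6 * test_const p * C)"
      by (rule gauge_le_embedding_constant[OF p W0 W C(2,1)])
    also have "\<dots> \<le> ennreal (c * C)" using c C by (intro ennreal_leI mult_right_mono) auto
    also have "\<dots> = ennreal c * ennreal C" using c C by (simp add: ennreal_mult)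
    finally show "capacity_gauge p Dy (h_weight p W) / ennreal c \<le> ennreal C"
      by (simp add: divide_ennreal_le_iff[OF c(1)])
  qed
  then show ?thesis by (simp add: divide_ennreal_le_iff[OF c(1)])
qed

lemma C_best_finite_iff: "C_best p W < \<infinity> \<longleftrightarrow> (\<exists>C. embedding_bound p W C)"
proof
  assume "C_best p W < \<infinity>"
  then have "{ennreal C | C. 0 \<le> C \<and> embedding_bound p W C} \<noteq> {}"
    unfolding C_best_def by (metis Inf_empty infinity_ennreal_def less_irrefl top_ennreal_def)
  then show "\<exists>C. embedding_bound p W C" by auto
next
  assume "\<exists>C. embedding_bound p W C"
  then obtain C where C: "embedding_bound p W C" ..
  (* negative constants act like 0 in the embedding inequality *)
  have "ennreal (max 0 C) = ennreal C" by (simp add: max_def ennreal_neg)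
  then have "embedding_bound p W (max 0 C)" using C by (simp add: embedding_bound_def)
  then have "C_best p W \<le> ennreal (max 0 C)" unfolding C_best_def by (intro Inf_lower) auto
  then show "C_best p W < \<infinity>" using le_less_trans ennreal_less_top by fastforce
qed

theorem theorem1p4:
  fixes p :: real
  assumes "0 < p" and "p \<le> 1"
  shows "(\<forall>W :: complex \<Rightarrow> real. (\<forall>z\<in>unit_disc. 0 \<le> W z) \<and> locally_integrable_disc W \<longrightarrow>
            ((\<exists>C. embedding_bound p W C) \<longleftrightarrow>
             (\<exists>\<D>. dyadic_system \<D> \<and> capacity_gauge p \<D> (h_weight p W) < \<infinity>)))
       \<and> (\<exists>K\<ge>1. \<forall>W :: complex \<Rightarrow> real. (\<forall>z\<in>unit_disc. 0 \<le> W z) \<and> locally_integrable_disc W \<longrightarrow>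
            comparable K (C_best p W)
              (INF \<D>\<in>{\<D>. dyadic_system \<D>}. capacity_gauge p \<D> (h_weight p W)) \<and>
            comparable K
              (INF \<D>\<in>{\<D>. dyadic_system \<D>}. capacity_gauge p \<D> (h_weight p W))
              (SUP \<D>\<in>{\<D>. dyadic_system \<D>}. capacity_gauge p \<D> (h_weight p W)))"
proof -
  define c where "c = max 1 (14 ^ 6 * test_const p)"
  have c: "1 \<le> c" "0 < c" "14 ^ 6 * test_const p \<le> c" by (auto simp: c_def)
  define K where "K = c * upper_const"
  have U: "1 \<le> upper_const" by (simp add: upper_const_def)
  (* the product serves both comparisons: going from one gauge to another passes through C_best *)
  have "c * 1 \<le> K" "1 * upper_const \<le> K"
    unfolding K_def using c U by (intro mult_left_mono mult_right_mono; simp)+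
  then have K: "c \<le> K" "upper_const \<le> K" "1 \<le> K" "0 < K" using c U by linarith+
  obtain Dy0 where Dy0: "dyadic_system Dy0" using dyadic_system_exists by blast
  define G where "G W Dy = capacity_gauge p Dy (h_weight p W)" for W Dy
  note up = C_best_le_gauge[OF assms, folded G_def] and low = gauge_le_C_best[OF assms _ _ _ c(2,3), folded G_def]
  have first: "(\<exists>C. embedding_bound p W C) \<longleftrightarrow> (\<exists>Dy. dyadic_system Dy \<and> G W Dy < \<infinity>)"
    if W: "\<And>z. z \<in> unit_disc \<Longrightarrow> 0 \<le> W z" "locally_integrable_disc W" for W
  proof
    assume "\<exists>C. embedding_bound p W C"
    then have "C_best p W < \<infinity>" by (simp only: C_best_finite_iff)
    then have "ennreal c * C_best p W < \<infinity>" by (simp add: ennreal_mult_less_top)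
    then have "G W Dy0 < \<infinity>" using low[OF W Dy0] le_less_trans by blast
    then show "\<exists>Dy. dyadic_system Dy \<and> G W Dy < \<infinity>" using Dy0 by blast
  next
    assume "\<exists>Dy. dyadic_system Dy \<and> G W Dy < \<infinity>"
    then obtain Dy where Dy: "dyadic_system Dy" "G W Dy < \<infinity>" by blast
    then have "ennreal upper_const * G W Dy < \<infinity>" by (simp add: ennreal_mult_less_top)
    then have "C_best p W < \<infinity>" using up[OF W Dy(1)] le_less_trans by blast
    then show "\<exists>C. embedding_bound p W C" by (simp only: C_best_finite_iff)
  qed
  have second: "comparable K (C_best p W) (INF Dy\<in>{Dy. dyadic_system Dy}. G W Dy)"
      "comparable K (INF Dy\<in>{Dy. dyadic_system Dy}. G W Dy) (SUP Dy\<in>{Dy. dyadic_system Dy}. G W Dy)"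
    if W: "\<And>z. z \<in> unit_disc \<Longrightarrow> 0 \<le> W z" "locally_integrable_disc W" for W
  proof -
    let ?I = "INF Dy\<in>{Dy. dyadic_system Dy}. G W Dy" and ?S = "SUP Dy\<in>{Dy. dyadic_system Dy}. G W Dy"
    have weaken: "ennreal a * x \<le> ennreal K * x" if "a \<le> K" for a x
      using that by (intro mult_right_mono ennreal_leI) auto
    have I_le: "?I \<le> G W Dy0" and S_ge: "G W Dy0 \<le> ?S" using Dy0 by (auto intro: INF_lower SUP_upper)
    have "C_best p W / ennreal upper_const \<le> ?I"
      by (rule INF_greatest) (use up[OF W] upper_const_pos in \<open>auto simp: divide_ennreal_le_iff\<close>)
    then have CI: "C_best p W \<le> ennreal upper_const * ?I"
      by (simp add: divide_ennreal_le_iff[OF upper_const_pos])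
    have "?I \<le> ennreal c * C_best p W" using I_le low[OF W Dy0] by (rule order.trans)
    then show "comparable K (C_best p W) ?I"
      unfolding comparable_def divide_ennreal_le_iff[OF K(4)]
      using CI weaken[OF K(1)] weaken[OF K(2)] order.trans by blast
    have "?S \<le> ennreal K * ?I"
    proof (rule SUP_least)
      fix Dy assume "Dy \<in> {Dy. dyadic_system Dy}"
      then have "G W Dy \<le> ennreal c * C_best p W" using low[OF W] by simp
      also have "\<dots> \<le> ennreal c * (ennreal upper_const * ?I)" by (intro mult_left_mono CI) simp
      also have "\<dots> = ennreal K * ?I"
        using c(2) upper_const_pos by (simp add: K_def ennreal_mult mult.assoc)
      finally show "G W Dy \<le> ennreal K * ?I" .
    qed
    moreover have "?I \<le> ennreal K * ?S"
    proof -
      have "?I \<le> ?S" using I_le S_ge by (rule order.trans)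
      also have "?S = ennreal 1 * ?S" by simp
      also have "\<dots> \<le> ennreal K * ?S" by (rule weaken[OF K(3)])
      finally show ?thesis .
    qed
    ultimately show "comparable K ?I ?S"
      unfolding comparable_def divide_ennreal_le_iff[OF K(4)] by blast
  qed
  show ?thesis
    using first second K(3) unfolding G_def by (intro conjI allI impI exI[of _ K]) blast+
qed

end
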